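(* Let $d,q$ be positive integers. (a) Let $F:\Delta_d^{(d+1)(q-1)}\to\mathbb{R}^d$ (or even $F:\Delta^{(d+1)(q-1)}\to\mathbb{R}^d$) be continuous. Every winding partition of $F|_{\Delta_{d-1}^{(d+1)(q-1)}}$ is a Tverberg partition of $F$. (b) Let $d\ge3$ and let $f:\Delta_{d-1}^{(d+1)(q-1)}\to\mathbb{R}^d$ be continuous. Then for every $\varepsilon>0$ there exist a continuous $\bar f:\Delta_{d-1}^{(d+1)(q-1)}\to\mathbb{R}^d$ with $\max_x\|\bar f(x)-f(x)\|<\varepsilon$ and a continuous map $F:\Delta_d^{(d+1)(q-1)}\to\mathbb{R}^d$ (and even a continuous map $F:\Delta^{(d+1)(q-1)}\to\mathbb{R}^d$) extending $\bar f$ such that every Tverberg partition of $F$ is a winding partition of $f$. (c) Let $d=2$ and let $f:\Delta_{1}^{3(q-1)}\to\mathbb{R}^2$ be continuous. Regard $\Delta^{3(q-1)}$ as a face of $\Delta^{4(q-1)}$ and $\mathbb{R}^2$ as $\mathbb{R}^2\times\{0\}\subset\mathbb{R}^3$. Then for every $\varepsilon>0$ there exist a continuous $\bar f:\Delta_{1}^{3(q-1)}\to\mathbb{R}^2$ with $\max_x\|\bar f(x)-f(x)\|<\varepsilon$ and a continuous map $F:\Delta_3^{4(q-1)}\to\mathbb{R}^3$ (and even a continuous map $F:\Delta^{4(q-1)}\to\mathbb{R}^3$) extending $\bar f$ such that for every Tverberg partition $\{\sigma_1,\dots,\sigma_q\}$ of $F$, the set $\{\sigma_1\cap\Delta^{3(q-1)},\dots,\sigma_q\cap\Delta^{3(q-1)}\}$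 is a winding partition of $f$.
   Context: For integers $N\ge 0$ and $0\le k\le N$, $\Delta^N$ denotes the $N$-dimensional simplex (with $N+1$ vertices) and $\Delta^N_k$ its $k$-skeleton; faces are identified with their geometric realizations, and two faces are disjoint if they share no vertex. For a map $f$ from $\Delta_k^{N}$ to $\mathbb{R}^e$, a Tverberg partition of $f$ is a set of $q$ pairwise disjoint faces $\sigma_1,\dots,\sigma_q$ of $\Delta_k^{N}$ with $\bigcap_i f(\sigma_i)\neq\emptyset$ (here $q$ is the fixed integer of the statement). Winding numbers: let $\partial\Delta^d=\Delta^d_{d-1}\cong\mathbb{S}^{d-1}$. For a continuous $g:\partial\Delta^d\to\mathbb{R}^d$ and $p\notin g(\partial\Delta^d)$: if $d\ge2$, "$W(g,p)\neq0$" means that $g$ represents a nonzero element of $\pi_{d-1}(\mathbb{R}^d\setminus\{p\})\cong\mathbb{Z}$; if $d=1$, "$W(g,p)\ne 0$" means that the two points of $g(\partial\Delta^1)$ lie in different components of $\mathbb{R}\setminus\{p\}$. Set $W_{\neq0}(g):=g(\partial\Delta^d)\cup\{x\in\mathbb{R}^d\setminus g(\partial\Delta^d): W(g,x)\neq0\}$. For a continuous $f:\Delta_{d-1}^{(d+1)(q-1)}\to\mathbb{R}^d$, a winding partition of $f$ is a set of $q$ pairwise disjoint faces $\sigma_1,\dots,\sigma_q$ of $\Delta^{(d+1)(q-1)}$, each of dimension at most $d$, for which there exists $p\in\mathbb{R}^d$ such that for every $i$: if $\dim\sigma_i\le d-1$ then $p\in f(\sigma_i)$, and if $\dim\sigma_i=d$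 then $p\in W_{\neq0}(f|_{\partial\sigma_i})$. *)

theory Defs
  imports "HOL-Homology.Homology"
begin

text \<open>
  The simplex with vertices \<open>0, \<dots>, N\<close> is the library's \<^const>\<open>standard_simplex\<close>, whose points are
  barycentric coordinate functions; the product topology on \<^typ>\<open>nat \<Rightarrow> real\<close> induces the usual
  topology on it.  A face is given by its vertex set, and \<open>face_real\<close> is its geometric realization.
  In this encoding \<open>standard_simplex M \<subseteq> standard_simplex N\<close> is a face for \<open>M \<le> N\<close>, and the
  intersection of two faces corresponds to the intersection of their vertex sets.
\<close>

definition face_real :: "nat \<Rightarrow> nat set \<Rightarrow> (nat \<Rightarrow> real) set" where
  "face_real N \<sigma> = {x \<in> standard_simplex N. \<forall>i. i \<notin> \<sigma> \<longrightarrow> x i = 0}"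

text \<open>A face with vertex set \<open>\<sigma>\<close> has dimension \<open>card \<sigma> - 1\<close>.  For \<open>k \<ge> N\<close> the \<open>k\<close>-skeleton is
  the whole simplex.\<close>

definition skeleton_faces :: "nat \<Rightarrow> nat \<Rightarrow> nat set set" where
  "skeleton_faces N k = {\<sigma>. \<sigma> \<noteq> {} \<and> \<sigma> \<subseteq> {..N} \<and> card \<sigma> \<le> k + 1}"

definition skeleton :: "nat \<Rightarrow> nat \<Rightarrow> (nat \<Rightarrow> real) set" where
  "skeleton N k = (\<Union>\<sigma>\<in>skeleton_faces N k. face_real N \<sigma>)"

definition face_boundary :: "nat \<Rightarrow> nat set \<Rightarrow> (nat \<Rightarrow> real) set" where
  "face_boundary N \<sigma> = (\<Union>\<tau>\<in>{\<tau>. \<tau> \<noteq> {} \<and> \<tau> \<subset> \<sigma>}. face_real N \<tau>)"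

lemma skeleton_full: "skeleton N N = standard_simplex N"
proof -
  have "{..N} \<in> skeleton_faces N N" "face_real N {..N} = standard_simplex N"
    by (auto simp: skeleton_faces_def face_real_def standard_simplex_def)
  then show ?thesis
    by (auto simp: skeleton_def face_real_def)
qed

text \<open>Pairwise disjoint nonempty faces are distinct, so a family of \<open>q\<close> such faces is a set of
  cardinality \<open>q\<close>.\<close>

definition tverberg_partition ::
  "nat \<Rightarrow> nat \<Rightarrow> nat \<Rightarrow> ((nat \<Rightarrow> real) \<Rightarrow> real ^ 'n) \<Rightarrow> nat set set \<Rightarrow> bool" where
  "tverberg_partition N k q f P \<longleftrightarrow>
     P \<subseteq> skeleton_faces N k \<and> card P = q \<and> pairwise disjnt P \<and>
     (\<Inter>\<sigma>\<in>P. f ` face_real N \<sigma>) \<noteq> {}"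

text \<open>
  \<open>winding_nonzero S g p\<close> renders \<open>W(g,p) \<noteq> 0\<close> for a map \<open>g\<close> from a \<open>(d-1)\<close>-sphere \<open>S\<close> (the boundary
  of a \<open>d\<close>-simplex) into \<open>\<real>\<^sup>d\<close> minus the point \<open>p\<close>, where \<open>d = CARD('n)\<close>.  For \<open>d \<ge> 2\<close> the element of
  \<open>\<pi>\<^sub>d\<^sub>-\<^sub>1(\<real>\<^sup>d - {p}, g b)\<close> represented by \<open>g\<close> is zero iff \<open>g\<close> is homotopic to the constant map at
  \<open>g b\<close> through maps that keep the base point \<open>b\<close> at \<open>g b\<close>; whether this holds does not depend on
  the choice of \<open>b\<close>.  For \<open>d = 1\<close> the set \<open>S\<close> consists of two points.
\<close>

definition winding_nonzero ::
  "(nat \<Rightarrow> real) set \<Rightarrow> ((nat \<Rightarrow> real) \<Rightarrow> real ^ 'n) \<Rightarrow> real ^ 'n \<Rightarrow> bool" where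
  "winding_nonzero S g p \<longleftrightarrow>
     (if CARD('n) = 1
      then \<exists>x\<in>S. \<exists>y\<in>S. \<not> connected_component (- {p}) (g x) (g y)
      else \<forall>b\<in>S. \<not> homotopic_with_canon (\<lambda>h. h b = g b) S (- {p}) g (\<lambda>_. g b))"

definition W_nonzero ::
  "(nat \<Rightarrow> real) set \<Rightarrow> ((nat \<Rightarrow> real) \<Rightarrow> real ^ 'n) \<Rightarrow> (real ^ 'n) set" where
  "W_nonzero S g = g ` S \<union> {x. x \<notin> g ` S \<and> winding_nonzero S g x}"

text \<open>Only the values of \<open>f\<close> on the \<open>(d-1)\<close>-skeleton matter here, \<open>d = CARD('n)\<close>: the image of
  \<open>\<sigma>\<close> is used if \<open>\<sigma>\<close> has dimension at most \<open>d - 1\<close>, and that of its boundary if it has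
  dimension \<open>d\<close>.\<close>

definition winding_partition ::
  "nat \<Rightarrow> nat \<Rightarrow> ((nat \<Rightarrow> real) \<Rightarrow> real ^ 'n) \<Rightarrow> nat set set \<Rightarrow> bool" where
  "winding_partition N q f P \<longleftrightarrow>
     P \<subseteq> skeleton_faces N CARD('n) \<and> card P = q \<and> pairwise disjnt P \<and>
     (\<exists>p. \<forall>\<sigma>\<in>P.
        (card \<sigma> \<le> CARD('n) \<longrightarrow> p \<in> f ` face_real N \<sigma>) \<and>
        (card \<sigma> = CARD('n) + 1 \<longrightarrow> p \<in> W_nonzero (face_boundary N \<sigma>) f))"

definition plane_in_space :: "real ^ 2 \<Rightarrow> real ^ 3" where
  "plane_in_space x = vector [x $ 1, x $ 2, 0]"

end

theory Submission
  imports Defs "HOL-Analysis.Analysis"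
begin

text \<open>
  A map \<open>g\<close> on the boundary of a \<open>d\<close>-simplex has \<open>W(g,p) = 0\<close> iff it extends over the simplex missing \<open>p\<close>;
  this gives (a).  For \<open>d \<ge> 3\<close> a map that extends missing each point of a finite set \<open>Z\<close> separately
  also extends missing all of \<open>Z\<close>.  To combine extensions missing \<open>A\<close> and \<open>B\<close>, where a hyperplane
  with normal \<open>e\<close> separates \<open>A\<close> from \<open>B\<close>, make sure that no point is sent by the first map into a ray
  leaving \<open>A\<close> in direction \<open>-e\<close> and by the second into a ray leaving \<open>B\<close> in direction \<open>e\<close>.  This is a
  generic condition, as \<open>d + 2 < 2d\<close>; away from those rays the maps can be pushed onto the hyperplane.

  For (b), approximate \<open>f\<close> by a piecewise linear map in general position, so that \<open>q\<close> disjoint faces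
  can only meet in finitely many points, and fill each \<open>d\<close>-face missing those of winding number
  zero; faces of larger dimension do not occur by a codimension count, and winding partitions of
  maps close to \<open>f\<close> are winding partitions of \<open>f\<close> by compactness.

  For (c), collapse the \<open>q - 1\<close> additional vertices to a single apex.  Put triangles of the original
  simplex below the plane and cones over edges above it, and fill the cones over triangles by the
  three-dimensional case.  One face of a Tverberg partition has no additional vertex and one
  contains at most two original vertices, so the common point lies in the plane.
\<close>

section \<open>Extending maps so that they miss finitely many points\<close>

text \<open>The plane behaves differently: a loop that is a commutator of loops around two points
  has winding number zero about each of them, yet no filling disc misses both. Hence the bound
  \<open>d \<ge> 3\<close>, and hence the cones in (c), which turn the planar problem into one about
  filling three-dimensional faces. The points to be missed must be known before the
  \<open>d\<close>-faces are filled. This is not circular: the faces of a Tverberg partition with at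
  most \<open>d\<close> vertices already have total codimension at least \<open>d\<close>. For a map
  in general position they confine the common point to a finite set, which depends only on the map
  on the \<open>(d-1)\<close>-skeleton and which the fillings do not change. Stability rests on
  fillings too: a small change of the boundary values extends over the face with the same bound, and
  added to a filling of the old values it gives a filling of the new ones.\<close>

lemma perturb_off_negligible:
  fixes h :: "'a::euclidean_space \<Rightarrow> 'b::euclidean_space"
  assumes D: "compact D" and S: "closed S" "S \<subseteq> D" and h: "continuous_on D h"
    and L: "closed L" and hS: "h ` S \<inter> L = {}" and \<eta>: "\<eta> > 0"
    and small: "\<And>P::'a \<Rightarrow> 'b. polynomial_function P \<Longrightarrow> negligible {l - P x | l x. l \<in> L \<and> x \<in> D}"
  obtains h' where "continuous_on D h'" "\<And>x. x \<in> S \<Longrightarrow> h' x = h x"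
    "\<And>x. x \<in> D \<Longrightarrow> dist (h' x) (h x) < \<eta>" "h' ` D \<inter> L = {}"
proof (cases "L = {}")
  case True
  then show ?thesis using that[of h] h \<eta> by auto
next
  case Lne: False
  have cS: "compact S" using D S by (metis compact_Int_closed inf.absorb2)
  have "compact (h ` S)" using cS h S by (meson compact_continuous_image continuous_on_subset)
  then obtain r where r: "r > 0" "\<And>x l. x \<in> S \<Longrightarrow> l \<in> L \<Longrightarrow> r \<le> dist (h x) l"
    using separate_compact_closed[OF _ L hS] by (metis imageI)
  \<comment> \<open>Being less than \<open>r\<close>, \<open>\<delta>\<close> keeps the region
    \<open>K\<close>, where \<open>h\<close> is close to \<open>L\<close>, away from
    \<open>S\<close>. It also bounds the displacement, so that outside \<open>K\<close> the new map
    cannot reach \<open>L\<close>.\<close>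
  define \<delta> where "\<delta> = min r \<eta> / 2"
  have \<delta>: "\<delta> > 0" "\<delta> < r" "\<delta> < \<eta>" using r \<eta> by (auto simp: \<delta>_def)
  define K where "K = {x\<in>D. infdist (h x) L \<le> \<delta>}"
  have contI: "continuous_on D (\<lambda>x. infdist (h x) L)"
    by (intro continuous_on_infdist h)
  have clK: "closedin (top_of_set D) K"
  proof -
    have "K = D \<inter> (\<lambda>x. infdist (h x) L) -` {..\<delta>}" by (auto simp: K_def)
    then show ?thesis using continuous_closedin_preimage[OF contI closed_atMost] by simp
  qed
  have clS: "closedin (top_of_set D) S" using S by (meson closed_subset)
  have disj: "K \<inter> S = {}"
  proof -
    { fix x assume x: "x \<in> S"
      have "r \<le> infdist (h x) L"
        unfolding infdist_notempty[OF Lne] using Lne r x by (intro cINF_greatest) auto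
      then have "x \<notin> K" using \<delta> by (auto simp: K_def) }
    then show ?thesis by blast
  qed
  obtain \<kappa> :: "'a \<Rightarrow> real" where \<kappa>: "continuous_on D \<kappa>" "\<And>x. x \<in> D \<Longrightarrow> \<kappa> x \<in> closed_segment 1 0"
    "\<And>x. x \<in> K \<Longrightarrow> \<kappa> x = 1" "\<And>x. x \<in> S \<Longrightarrow> \<kappa> x = 0"
    using Urysohn_local[OF clK clS disj] by metis
  have \<kappa>01: "0 \<le> \<kappa> x" "\<kappa> x \<le> 1" if "x \<in> D" for x
    using \<kappa>(2)[OF that] by (auto simp: closed_segment_eq_real_ivl)
  \<comment> \<open>\<open>P x + u\<close> lies in \<open>L\<close> only if \<open>u\<close> is one
    of the differences \<open>l - P x\<close>. For polynomial \<open>P\<close> these form a null set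
    by hypothesis; the image of a merely continuous map could be too large for this.\<close>
  obtain P where P: "polynomial_function P" "\<And>x. x \<in> D \<Longrightarrow> norm (h x - P x) < \<delta>/2"
    using Stone_Weierstrass_polynomial_function[OF D h, of "\<delta>/2"] \<delta> by auto
  have "\<not> ball 0 (\<delta>/2) \<subseteq> {l - P x | l x. l \<in> L \<and> x \<in> D}"
    using small[OF P(1)] open_not_negligible[of "ball (0::'b) (\<delta>/2)"] \<delta>
    by (metis (no_types, lifting) ball_eq_empty half_gt_zero linorder_not_le negligible_subset open_ball)
  then obtain u where u: "norm u < \<delta>/2" "\<And>l x. l \<in> L \<Longrightarrow> x \<in> D \<Longrightarrow> u \<noteq> l - P x"
    by (auto simp: subset_iff)
  define h' where "h' x = h x + \<kappa> x *\<^sub>R (P x + u - h x)" for x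
  have bd: "dist (h' x) (h x) < \<delta>" if "x \<in> D" for x
  proof -
    have "norm (P x + u - h x) < \<delta>"
      using P(2)[OF that] u(1) norm_triangle_ineq[of "P x - h x" u]
      by (simp add: norm_minus_commute algebra_simps)
    moreover have "\<kappa> x * norm (P x + u - h x) \<le> 1 * norm (P x + u - h x)"
      using \<kappa>01[OF that] by (intro mult_right_mono) auto
    ultimately show ?thesis using \<kappa>01[OF that] by (simp add: h'_def dist_norm)
  qed
  show thesis
  proof
    show "continuous_on D h'"
      unfolding h'_def using P(1) by (intro continuous_intros h \<kappa> continuous_on_polymonial_function)
    show "h' x = h x" if "x \<in> S" for x using \<kappa>(4)[OF that] by (simp add: h'_def)
    show "dist (h' x) (h x) < \<eta>" if "x \<in> D" for x using bd[OF that] \<delta> by simp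
    have "h' x \<notin> L" if x: "x \<in> D" for x
    proof (cases "x \<in> K")
      case True
      then show ?thesis using \<kappa>(3) u(2)[OF _ x, of "h' x"] by (auto simp: h'_def)
    next
      case False
      show ?thesis
      proof
        assume "h' x \<in> L"
        then have "infdist (h x) L \<le> dist (h x) (h' x)" by (rule infdist_le)
        then show False using bd[OF x] False x by (simp add: K_def dist_commute)
      qed
    qed
    then show "h' ` D \<inter> L = {}" by blast
  qed
qed

text \<open>Regarded as one map into the product, the two maps have to miss finitely many
  two-dimensional flats. On \<open>S\<close> they agree, so a forbidden value there would make
  \<open>p - q\<close> a multiple of \<open>e\<close>. Full lines are used instead of rays, which
  makes the forbidden set a union of flats and leaves the dimension count as it is.\<close>

lemma perturb_off_line_pairs:
  fixes GA GB :: "'a::euclidean_space \<Rightarrow> 'a" and e :: 'a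
  assumes dim: "DIM('a) \<ge> 3" and D: "compact D" and S: "closed S" "S \<subseteq> D"
    and G: "continuous_on D GA" "continuous_on D GB" and eq: "\<And>x. x \<in> S \<Longrightarrow> GA x = GB x"
    and fin: "finite A" "finite B" and e: "norm e = 1"
    and gen: "\<And>p q. p \<in> A \<Longrightarrow> q \<in> B \<Longrightarrow> p - q \<notin> span {e}" and \<eta>: "\<eta> > 0"
  obtains HA HB where "continuous_on D HA" "continuous_on D HB"
    "\<And>x. x \<in> S \<Longrightarrow> HA x = GA x \<and> HB x = GB x"
    "\<And>x. x \<in> D \<Longrightarrow> dist (HA x) (GA x) < \<eta>" "\<And>x. x \<in> D \<Longrightarrow> dist (HB x) (GB x) < \<eta>"
    "\<And>x p q s t. x \<in> D \<Longrightarrow> p \<in> A \<Longrightarrow> q \<in> B \<Longrightarrow> HA x = p + s *\<^sub>R e \<Longrightarrow> HB x = q + t *\<^sub>R e \<Longrightarrow> False"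
proof -
  define L where "L = {z. \<exists>p\<in>A. \<exists>q\<in>B. \<exists>s t. z = (p + s *\<^sub>R e, q + t *\<^sub>R e)}"
  have cl1: "closed ((\<lambda>(s::real,t::real). (p + s *\<^sub>R e, q + t *\<^sub>R e)) ` UNIV)" for p q
  proof -
    have "(\<lambda>(s::real,t::real). (p + s *\<^sub>R e, q + t *\<^sub>R e)) ` UNIV
        = ((+) p ` range (\<lambda>s. s *\<^sub>R e)) \<times> ((+) q ` range (\<lambda>s. s *\<^sub>R e))"
      by (auto simp: image_def)
    moreover have "closed (range (\<lambda>s. s *\<^sub>R e))"
      using closed_span[of "{e}"] by (simp add: span_singleton)
    ultimately show ?thesis by (simp add: closed_Times closed_translation)
  qed
  have "L = (\<Union>p\<in>A. \<Union>q\<in>B. (\<lambda>(s,t). (p + s *\<^sub>R e, q + t *\<^sub>R e)) ` UNIV)"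
    unfolding L_def image_def by auto
  then have clL: "closed L" using fin cl1 by (simp add: closed_UN)
  define h where "h x = (GA x, GB x)" for x
  have hS: "h ` S \<inter> L = {}"
  proof -
    { fix x p q s t assume x: "x \<in> S" "p \<in> A" "q \<in> B" "(p + s *\<^sub>R e, q + t *\<^sub>R e) = h x"
      then have "p + s *\<^sub>R e = q + t *\<^sub>R e" using eq[OF x(1)] by (auto simp: h_def)
      then have "p - q = (t - s) *\<^sub>R e" by (simp add: algebra_simps)
      then have False using gen[OF x(2,3)] by (auto simp: span_singleton) }
    then show ?thesis unfolding L_def by fastforce
  qed
  have small: "negligible {l - P x | l x. l \<in> L \<and> x \<in> D}" if P: "polynomial_function P" for P :: "'a \<Rightarrow> 'a \<times> 'a"
  proof -
    have "{l - P x | l x. l \<in> L \<and> x \<in> D} \<subseteq>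
      (\<Union>p\<in>A. \<Union>q\<in>B. (\<lambda>(x,s,t). (p + s *\<^sub>R e, q + t *\<^sub>R e) - P x) ` UNIV)"
    proof
      fix y assume "y \<in> {l - P x | l x. l \<in> L \<and> x \<in> D}"
      then obtain p q s t x where "p \<in> A" "q \<in> B" "y = (p + s *\<^sub>R e, q + t *\<^sub>R e) - P x"
        unfolding L_def by blast
      then show "y \<in> (\<Union>p\<in>A. \<Union>q\<in>B. (\<lambda>(x,s,t). (p + s *\<^sub>R e, q + t *\<^sub>R e) - P x) ` UNIV)"
        by (intro UN_I[of p] UN_I[of q] image_eqI[of _ _ "(x, s, t)"]) auto
    qed
    moreover have "negligible ((\<lambda>(x,s,t). (p + s *\<^sub>R e, q + t *\<^sub>R e) - P x) ` UNIV)" for p q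
    proof (rule negligible_differentiable_image_lowdim)
      show "DIM('a \<times> real \<times> real) < DIM('a \<times> 'a)" using dim by simp
      have "(\<lambda>z. P (fst z)) differentiable (at z)" for z :: "'a \<times> real \<times> real"
        using differentiable_compose[of P fst z UNIV] differentiable_at_polynomial_function[OF P]
        by (simp add: bounded_linear_fst bounded_linear_imp_differentiable)
      moreover have "(\<lambda>z. (p, q) + (fst (snd z) *\<^sub>R e, snd (snd z) *\<^sub>R e)) differentiable (at z)" for z :: "'a \<times> real \<times> real"
      proof (intro differentiable_add differentiable_const bounded_linear_imp_differentiable)
        show "bounded_linear (\<lambda>z::'a \<times> real \<times> real. (fst (snd z) *\<^sub>R e, snd (snd z) *\<^sub>R e))"
          by (intro linear_conv_bounded_linear[THEN iffD1] linearI) (auto simp: algebra_simps)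
      qed
      ultimately show "(\<lambda>(x,s,t). (p + s *\<^sub>R e, q + t *\<^sub>R e) - P x) differentiable_on UNIV"
        unfolding differentiable_on_def case_prod_unfold by (intro ballI differentiable_diff) simp_all
    qed
    then have "negligible (\<Union>q\<in>B. (\<lambda>(x,s,t). (p + s *\<^sub>R e, q + t *\<^sub>R e) - P x) ` UNIV)" for p
      using fin(2) by (intro negligible_Union) auto
    then have "negligible (\<Union>p\<in>A. \<Union>q\<in>B. (\<lambda>(x,s,t). (p + s *\<^sub>R e, q + t *\<^sub>R e) - P x) ` UNIV)"
      using fin(1) by (intro negligible_Union) auto
    ultimately show ?thesis by (rule negligible_subset[rotated])
  qed
  have ch: "continuous_on D h" unfolding h_def using G by (intro continuous_intros)
  obtain h' where h': "continuous_on D h'" "\<And>x. x \<in> S \<Longrightarrow> h' x = h x"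
    "\<And>x. x \<in> D \<Longrightarrow> dist (h' x) (h x) < \<eta>" "h' ` D \<inter> L = {}"
    using perturb_off_negligible[OF D S ch clL hS \<eta> small] by blast
  show thesis
  proof
    show "continuous_on D (\<lambda>x. fst (h' x))" "continuous_on D (\<lambda>x. snd (h' x))"
      using h'(1) by (auto intro: continuous_on_fst continuous_on_snd)
    show "fst (h' x) = GA x \<and> snd (h' x) = GB x" if "x \<in> S" for x
      using h'(2)[OF that] by (simp add: h_def)
    show "dist (fst (h' x)) (GA x) < \<eta>" "dist (snd (h' x)) (GB x) < \<eta>" if "x \<in> D" for x
      using h'(3)[OF that] dist_fst_le[of "h' x" "h x"] dist_snd_le[of "h' x" "h x"] by (auto simp: h_def)
    show False if "x \<in> D" "p \<in> A" "q \<in> B" "fst (h' x) = p + s *\<^sub>R e" "snd (h' x) = q + t *\<^sub>R e" for x p q s t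
    proof -
      have "h' x = (p + s *\<^sub>R e, q + t *\<^sub>R e)" using that by (simp add: prod_eq_iff)
      then have "h' x \<in> L" using that(2,3) unfolding L_def by blast
      then show False using h'(4) that by auto
    qed
  qed
qed

lemma homotopic_with_canonI:
  fixes f g :: "'a::topological_space \<Rightarrow> 'b::topological_space"
  assumes "continuous_on ({0..1::real} \<times> S) (\<lambda>z. h (fst z) (snd z))"
    and "\<And>t x. t \<in> {0..1} \<Longrightarrow> x \<in> S \<Longrightarrow> h t x \<in> U"
    and "\<And>x. x \<in> S \<Longrightarrow> h 0 x = f x" "\<And>x. x \<in> S \<Longrightarrow> h 1 x = g x"
    and P: "\<And>t. t \<in> {0..1} \<Longrightarrow> P (h t)"
    and cong: "\<And>h k. (\<And>x. x \<in> S \<Longrightarrow> h x = k x) \<Longrightarrow> P h \<longleftrightarrow> P k"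
  shows "homotopic_with_canon P S U f g"
proof -
  have *: "continuous_map (prod_topology (top_of_set {0..1}) (top_of_set S)) (top_of_set U) (\<lambda>z. h (fst z) (snd z))"
    using assms(1,2) by (simp add: continuous_map_in_subtopology prod_topology_subtopology_eu Pi_iff)
  have "\<exists>k. continuous_map (prod_topology (top_of_set {0..1::real}) (top_of_set S)) (top_of_set U) k \<and>
      (\<forall>x\<in>topspace (top_of_set S). k (0, x) = f x) \<and> (\<forall>x\<in>topspace (top_of_set S). k (1, x) = g x) \<and>
      (\<forall>t\<in>{0..1}. P (\<lambda>x. k (t, x)))"
    by (rule exI[where x = "\<lambda>z. h (fst z) (snd z)"]) (use * assms(3,4) P in simp)
  then show ?thesis
    by (subst homotopic_with) (auto intro!: cong)
qed

text \<open>Pushing towards the hyperplane also changes the map on \<open>S\<close>, so the combined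
  map \<open>H 1\<close> does not extend \<open>g\<close>. The same push carried out gradually is a
  homotopy on \<open>S\<close> from \<open>g\<close> to \<open>H 1\<close> in the complement of
  \<open>A \<union> B\<close>, and homotopy extension into this open set gives a filling of
  \<open>g\<close> itself.\<close>

lemma extend_avoiding_union:
  fixes g :: "'a::euclidean_space \<Rightarrow> 'a"
  assumes dim: "DIM('a) \<ge> 3" and D: "compact D" and S: "closed S" "S \<subseteq> D"
    and fin: "finite A" "finite B" and e: "norm e = 1"
    and gen: "\<And>p q. p \<in> A \<Longrightarrow> q \<in> B \<Longrightarrow> p - q \<notin> span {e}"
    and below: "\<And>p. p \<in> A \<Longrightarrow> e \<bullet> p < c" and above: "\<And>q. q \<in> B \<Longrightarrow> c < e \<bullet> q"
    and exA: "\<exists>G. continuous_on D G \<and> (\<forall>x\<in>S. G x = g x) \<and> G ` D \<inter> A = {}"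
    and exB: "\<exists>G. continuous_on D G \<and> (\<forall>x\<in>S. G x = g x) \<and> G ` D \<inter> B = {}"
  shows "\<exists>G. continuous_on D G \<and> (\<forall>x\<in>S. G x = g x) \<and> G ` D \<inter> (A \<union> B) = {}"
proof -
  obtain GA where GA: "continuous_on D GA" "\<And>x. x \<in> S \<Longrightarrow> GA x = g x" "GA ` D \<inter> A = {}"
    using exA by blast
  obtain GB where GB: "continuous_on D GB" "\<And>x. x \<in> S \<Longrightarrow> GB x = g x" "GB ` D \<inter> B = {}"
    using exB by blast
  have cA: "compact (GA ` D)" and cB: "compact (GB ` D)"
    using GA GB D by (auto intro: compact_continuous_image)
  obtain rA where rA: "rA > 0" "\<And>x p. x \<in> D \<Longrightarrow> p \<in> A \<Longrightarrow> rA \<le> dist (GA x) p"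
    using separate_compact_closed[OF cA finite_imp_closed[OF fin(1)] GA(3)] by (metis imageI)
  obtain rB where rB: "rB > 0" "\<And>x p. x \<in> D \<Longrightarrow> p \<in> B \<Longrightarrow> rB \<le> dist (GB x) p"
    using separate_compact_closed[OF cB finite_imp_closed[OF fin(2)] GB(3)] by (metis imageI)
  obtain HA HB where cont: "continuous_on D HA" "continuous_on D HB"
    and HS: "\<And>x. x \<in> S \<Longrightarrow> HA x = GA x \<and> HB x = GB x"
    and dA: "\<And>x. x \<in> D \<Longrightarrow> dist (HA x) (GA x) < min rA rB" 
    and dB: "\<And>x. x \<in> D \<Longrightarrow> dist (HB x) (GB x) < min rA rB"
    and no: "\<And>x p q s t. x \<in> D \<Longrightarrow> p \<in> A \<Longrightarrow> q \<in> B \<Longrightarrow> HA x = p + s *\<^sub>R e \<Longrightarrow> HB x = q + t *\<^sub>R e \<Longrightarrow> False"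
    using perturb_off_line_pairs[OF dim D S GA(1) GB(1) _ fin e gen, of "min rA rB"] GA(2) GB(2) rA(1) rB(1)
    by (auto simp: min_less_iff_conj)
  have HAg: "HA x = g x" and HBg: "HB x = g x" if "x \<in> S" for x
    using HS GA(2) GB(2) that by auto
  have HA: "HA x \<notin> A" if "x \<in> D" for x
    using dA[OF that] rA(2)[OF that, of "HA x"] by (auto simp: dist_commute)
  have HB: "HB x \<notin> B" if "x \<in> D" for x
    using dB[OF that] rB(2)[OF that, of "HB x"] by (auto simp: dist_commute)
  \<comment> \<open>A value moving in direction \<open>e\<close> meets a point of \<open>A\<close>
    only if it starts on the ray below that point. So \<open>X\<close> is where the first map must
    not be pushed up, and \<open>Y\<close> is where the second must not be pushed down.\<close>
  define X where "X = {x\<in>D. \<exists>p\<in>A. \<exists>s\<ge>0. HA x = p - s *\<^sub>R e}"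
  define Y where "Y = {x\<in>D. \<exists>q\<in>B. \<exists>s\<ge>0. HB x = q + s *\<^sub>R e}"
  have clray: "closed ((\<lambda>s. p + s *\<^sub>R v) ` {0::real..})" for p v :: 'a
  proof (cases "v = 0")
    case False
    then have "closed ((\<lambda>s. s *\<^sub>R v) ` {0::real..})"
      by (intro closed_injective_linear_image) (auto simp: inj_on_def intro!: linearI algebra_simps)
    from closed_translation[OF this, of p] show ?thesis by (simp add: image_image)
  qed (simp add: image_constant_conv)
  have clX: "closedin (top_of_set D) X"
  proof -
    have "X = D \<inter> HA -` (\<Union>p\<in>A. (\<lambda>s. p + s *\<^sub>R (- e)) ` {0..})"
      by (auto simp: X_def image_iff Bex_def)
    moreover have "closed (\<Union>p\<in>A. (\<lambda>s::real. p + s *\<^sub>R (- e)) ` {0..})"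
      by (rule closed_UN[OF fin(1)]) (intro ballI clray)
    ultimately show ?thesis using continuous_closedin_preimage[OF cont(1)] by simp
  qed
  have clY: "closedin (top_of_set D) Y"
  proof -
    have "Y = D \<inter> HB -` (\<Union>p\<in>B. (\<lambda>s. p + s *\<^sub>R e) ` {0..})"
      by (auto simp: Y_def image_iff Bex_def)
    moreover have "closed (\<Union>p\<in>B. (\<lambda>s::real. p + s *\<^sub>R e) ` {0..})"
      by (rule closed_UN[OF fin(2)]) (intro ballI clray)
    ultimately show ?thesis using continuous_closedin_preimage[OF cont(2)] by simp
  qed
  have "X \<inter> Y = {}"
  proof -
    { fix x p q s t assume "x \<in> D" "p \<in> A" "q \<in> B" "HA x = p - s *\<^sub>R e" "HB x = q + t *\<^sub>R e"
      then have False using no[of x p q "-s" t] by simp }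
    then show ?thesis unfolding X_def Y_def by blast
  qed
  then obtain u :: "'a \<Rightarrow> real" where u: "continuous_on D u" "\<And>x. x \<in> D \<Longrightarrow> u x \<in> closed_segment 1 0"
    "\<And>x. x \<in> X \<Longrightarrow> u x = 1" "\<And>x. x \<in> Y \<Longrightarrow> u x = 0"
    using Urysohn_local[OF clX clY] by metis
  have u01: "0 \<le> u x" "u x \<le> 1" if "x \<in> D" for x
    using u(2)[OF that] by (auto simp: closed_segment_eq_real_ivl)
  \<comment> \<open>The first map is used where \<open>u\<close> is near \<open>1\<close> and the second where it is near \<open>0\<close>; each is pushed
    onto the hyperplane elsewhere, and so both are in between, where they are interpolated.\<close>
  define \<mu> where "\<mu> x = max 0 (3 * u x - 2)" for x
  define \<nu> where "\<nu> x = max 0 (1 - 3 * u x)" for x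
  define l where "l x = max 0 (min 1 (3 * u x - 1))" for x
  have \<mu>1: "0 \<le> \<mu> x" "\<mu> x \<le> 1" "0 \<le> \<nu> x" "\<nu> x \<le> 1" if "x \<in> D" for x
    using u01[OF that] by (auto simp: \<mu>_def \<nu>_def)
  have \<mu>X: "\<mu> x = 1" if "x \<in> X" for x using u(3)[OF that] by (simp add: \<mu>_def)
  have \<nu>Y: "\<nu> x = 1" if "x \<in> Y" for x using u(4)[OF that] by (simp add: \<nu>_def)
  define \<alpha> where "\<alpha> x = e \<bullet> HA x - c" for x
  define \<beta> where "\<beta> x = e \<bullet> HB x - c" for x
  have "compact (\<alpha> ` D \<union> \<beta> ` D)"
    unfolding \<alpha>_def \<beta>_def using D cont by (intro compact_Un compact_continuous_image continuous_intros)
  then have "bounded (\<alpha> ` D \<union> \<beta> ` D)" by (rule compact_imp_bounded)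
  then obtain M where "M > 0" and M: "\<forall>y\<in>\<alpha> ` D \<union> \<beta> ` D. norm y \<le> M"
    unfolding bounded_pos by blast
  have Ma: "\<bar>\<alpha> x\<bar> \<le> M" "\<bar>\<beta> x\<bar> \<le> M" if "x \<in> D" for x
    using M that by auto
  define pr where "pr v = v - (e \<bullet> v) *\<^sub>R e" for v
  have ee: "e \<bullet> e = 1" using e by (simp add: norm_eq_1)
  have epr: "e \<bullet> pr v = 0" for v by (simp add: pr_def inner_diff_right ee)
  have pr_lin: "pr (a *\<^sub>R v) = a *\<^sub>R pr v" "pr (v + w) = pr v + pr w" for a v w
    by (simp_all add: pr_def algebra_simps inner_add_right)
  \<comment> \<open>The height over the hyperplane is split: \<open>HA\<close> supplies the negative
    part and \<open>HB\<close> the positive part. They are raised and lowered by up to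
    \<open>t * M\<close>; as \<open>M\<close> bounds all heights, the full push at
    \<open>t = 1\<close> brings either part to zero. The factors \<open>1 - \<mu> x\<close> and
    \<open>1 - \<nu> x\<close> switch the push off on \<open>X\<close> and \<open>Y\<close>.\<close>
  define \<kappa> where "\<kappa> t x = min (\<alpha> x + t * M * (1 - \<mu> x)) 0 + max (\<beta> x - t * M * (1 - \<nu> x)) 0" for t x
  define H where "H t x = (c + \<kappa> t x) *\<^sub>R e + pr (l x *\<^sub>R HA x + (1 - l x) *\<^sub>R HB x)" for t x
  have eH: "e \<bullet> H t x = c + \<kappa> t x" for t x
    by (simp add: H_def inner_add_right ee epr)
  have recA: "HA x = (c + \<alpha> x) *\<^sub>R e + pr (HA x)" for x
    by (simp add: \<alpha>_def pr_def)
  have recB: "HB x = (c + \<beta> x) *\<^sub>R e + pr (HB x)" for x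
    by (simp add: \<beta>_def pr_def)
  have c\<mu>: "continuous_on D \<mu>" "continuous_on D \<nu>" "continuous_on D l" "continuous_on D \<alpha>" "continuous_on D \<beta>"
    unfolding \<mu>_def \<nu>_def l_def \<alpha>_def \<beta>_def by (intro continuous_intros u cont)+
  have contH1: "continuous_on D (H 1)"
    unfolding H_def \<kappa>_def pr_def by (intro continuous_intros c\<mu> cont)
  have keyA: False if x: "x \<in> D" and p: "p \<in> A" and s: "0 \<le> s" "s = t * (1 - \<mu> x)"
     and eqp: "HA x + s *\<^sub>R e = p" for x p s t
  proof -
    have "HA x = p - s *\<^sub>R e" using eqp by (simp add: algebra_simps)
    then have "x \<in> X" using x p s unfolding X_def by blast
    then have "s = 0" using \<mu>X s by simp
    then show False using eqp p HA[OF x] by simp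
  qed
  have keyB: False if x: "x \<in> D" and p: "p \<in> B" and s: "0 \<le> s" "s = t * (1 - \<nu> x)"
     and eqp: "HB x - s *\<^sub>R e = p" for x p s t
  proof -
    have "HB x = p + s *\<^sub>R e" using eqp by (simp add: algebra_simps)
    then have "x \<in> Y" using x p s unfolding Y_def by blast
    then have "s = 0" using \<nu>Y s by simp
    then show False using eqp p HB[OF x] by simp
  qed
  \<comment> \<open>Hitting \<open>A\<close> requires a negative height and hitting \<open>B\<close>
    a positive one. Each third of the range of \<open>u\<close> allows at most one sign, and there
    \<open>H 1\<close> is one of the two maps pushed along \<open>e\<close>; a hit would have to
    start on a ray where that push is switched off.\<close>
  have avoid1: "H 1 x \<notin> A \<union> B" if x: "x \<in> D" for x
  proof
    assume hit: "H 1 x \<in> A \<union> B"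
    consider "u x \<ge> 2/3" | "u x \<le> 1/3" | "1/3 \<le> u x" "u x \<le> 2/3" by linarith
    then show False
    proof cases
      case 1
      then have l: "l x = 1" "\<nu> x = 0" by (auto simp: l_def \<nu>_def)
      have k: "\<kappa> 1 x = min (\<alpha> x + M * (1 - \<mu> x)) 0" using l Ma[OF x] by (auto simp: \<kappa>_def)
      then have "e \<bullet> H 1 x \<le> c" by (simp add: eH)
      then have inA: "H 1 x \<in> A" using hit above by fastforce
      then have "\<kappa> 1 x < 0" using below[OF inA] by (simp add: eH)
      then have "\<kappa> 1 x = \<alpha> x + M * (1 - \<mu> x)" using k by linarith
      then have "H 1 x = ((c + \<alpha> x) *\<^sub>R e + pr (HA x)) + (M * (1 - \<mu> x)) *\<^sub>R e"
        by (simp only: H_def l scaleR_add_left) (simp add: algebra_simps)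
      then have "H 1 x = HA x + (M * (1 - \<mu> x)) *\<^sub>R e" by (simp only: recA[symmetric])
      then show False using keyA[OF x inA, of "M * (1 - \<mu> x)" M] \<mu>1[OF x] \<open>M > 0\<close> by auto
    next
      case 2
      then have l: "l x = 0" "\<mu> x = 0" by (auto simp: l_def \<mu>_def)
      have k: "\<kappa> 1 x = max (\<beta> x - M * (1 - \<nu> x)) 0" using l Ma[OF x] by (auto simp: \<kappa>_def)
      then have "e \<bullet> H 1 x \<ge> c" by (simp add: eH)
      then have inB: "H 1 x \<in> B" using hit below by fastforce
      then have "\<kappa> 1 x > 0" using above[OF inB] by (simp add: eH)
      then have "\<kappa> 1 x = \<beta> x - M * (1 - \<nu> x)" using k by linarith
      then have "H 1 x = ((c + \<beta> x) *\<^sub>R e + pr (HB x)) - (M * (1 - \<nu> x)) *\<^sub>R e"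
        by (simp only: H_def l scaleR_add_left scaleR_diff_left) (simp add: algebra_simps)
      then have "H 1 x = HB x - (M * (1 - \<nu> x)) *\<^sub>R e" by (simp only: recB[symmetric])
      then show False using keyB[OF x inB, of "M * (1 - \<nu> x)" M] \<mu>1[OF x] \<open>M > 0\<close> by auto
    next
      case 3
      then have "\<mu> x = 0" "\<nu> x = 0" by (auto simp: \<mu>_def \<nu>_def)
      then have "\<kappa> 1 x = 0" using Ma[OF x] by (auto simp: \<kappa>_def)
      then have "e \<bullet> H 1 x = c" by (simp add: eH)
      then show False using hit above below by fastforce
    qed
  qed
  \<comment> \<open>Where the two maps agree, the interpolation by \<open>l\<close> disappears and
    \<open>H t\<close> moves values only along \<open>e\<close>. At \<open>t = 0\<close> the
    negative and the positive part add up to the original height, so \<open>H 0\<close> is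
    \<open>g\<close>.\<close>
  have HgS: "H t x = g x + (\<kappa> t x - \<alpha> x) *\<^sub>R e" and ab: "\<beta> x = \<alpha> x" if x: "x \<in> S" for t x
  proof -
    have "HA x = g x" "HB x = g x" using HAg HBg x by auto
    then have "l x *\<^sub>R HA x + (1 - l x) *\<^sub>R HB x = HA x"
      using \<open>HB x = g x\<close> by (simp add: scaleR_left_diff_distrib)
    then have "H t x = ((c + \<alpha> x) *\<^sub>R e + pr (HA x)) + (\<kappa> t x - \<alpha> x) *\<^sub>R e"
      by (simp only: H_def scaleR_add_left scaleR_diff_left) (simp add: algebra_simps)
    then have "H t x = HA x + (\<kappa> t x - \<alpha> x) *\<^sub>R e" by (simp only: recA[symmetric])
    then show "H t x = g x + (\<kappa> t x - \<alpha> x) *\<^sub>R e" using \<open>HA x = g x\<close> by simp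
    show "\<beta> x = \<alpha> x" using \<open>HA x = g x\<close> \<open>HB x = g x\<close> by (simp add: \<alpha>_def \<beta>_def)
  qed
  have avoid: "H t x \<notin> A \<union> B" if x: "x \<in> S" and t: "t \<in> {0..1}" for t x
  proof
    assume hit: "H t x \<in> A \<union> B"
    have xD: "x \<in> D" using x S by auto
    have nn: "0 \<le> t * M * (1 - \<mu> x)" "0 \<le> t * M * (1 - \<nu> x)"
      using t \<open>M > 0\<close> \<mu>1[OF xD] by auto
    from hit show False
    proof
      assume p: "H t x \<in> A"
      have "\<kappa> t x < 0" using below[OF p] by (simp add: eH)
      then have "\<kappa> t x = \<alpha> x + t * M * (1 - \<mu> x)"
        using ab[OF x] nn by (auto simp: \<kappa>_def min_def max_def split: if_splits)
      then have "H t x = HA x + (t * M * (1 - \<mu> x)) *\<^sub>R e" using HgS[OF x] HAg[OF x] by simp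
      then show False using keyA[OF xD p, of _ "t * M"] nn by auto
    next
      assume p: "H t x \<in> B"
      have "\<kappa> t x > 0" using above[OF p] by (simp add: eH)
      then have "\<kappa> t x = \<alpha> x - t * M * (1 - \<nu> x)"
        using ab[OF x] nn by (auto simp: \<kappa>_def min_def max_def split: if_splits)
      then have "H t x = HB x - (t * M * (1 - \<nu> x)) *\<^sub>R e" using HgS[OF x] HBg[OF x] by simp
      then show False using keyB[OF xD p, of _ "t * M"] nn by auto
    qed
  qed
  have H0: "H 0 x = g x" if "x \<in> S" for x
    using HgS[OF that] ab[OF that] by (simp add: \<kappa>_def min_def max_def)
  have cs: "continuous_on ({0..1::real} \<times> S) (\<lambda>z. f (snd z))" if "continuous_on D f" for f :: "'a \<Rightarrow> 'b::topological_space"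
    by (rule continuous_on_compose2[OF that]) (use S in \<open>auto intro: continuous_intros\<close>)
  have contHS: "continuous_on ({0..1} \<times> S) (\<lambda>z. H (fst z) (snd z))"
    unfolding H_def \<kappa>_def pr_def
    by (intro continuous_intros cs[OF cont(1)] cs[OF cont(2)] cs[OF c\<mu>(1)] cs[OF c\<mu>(2)]
        cs[OF c\<mu>(3)] cs[OF c\<mu>(4)] cs[OF c\<mu>(5)])
  have hom: "homotopic_with_canon (\<lambda>x. True) S (- (A \<union> B)) (H 1) g"
    by (rule homotopic_with_symD, rule homotopic_with_canonI[where h = H]) (use contHS H0 avoid in auto)
  have op: "open (- (A \<union> B))" using fin finite_imp_closed[of "A \<union> B"] by (simp only: open_Compl finite_UnI)
  have im: "H 1 \<in> D \<rightarrow> - (A \<union> B)" using avoid1 by (simp add: Pi_iff)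
  obtain G where "continuous_on D G" "G ` D \<subseteq> - (A \<union> B)" "\<And>x. x \<in> S \<Longrightarrow> G x = g x"
    by (rule Borsuk_homotopy_extension_homotopic[OF closed_subset[OF S(2,1)] disjI2[OF open_imp_ANR[OF op]] contH1 im hom])
      (rule that, assumption, assumption, blast)
  then show ?thesis by blast
qed

text \<open>The bad directions lie in finitely many hyperplanes and lines through the origin, which
  are null sets in dimension at least two. Distinct heights let hyperplanes orthogonal to
  \<open>e\<close> separate the points; the other condition says that no line in direction
  \<open>e\<close> contains two of them.\<close>

lemma exists_generic_direction:
  fixes Z :: "'a::euclidean_space set"
  assumes "finite Z" "DIM('a) \<ge> 2"
  obtains e :: 'a where "norm e = 1" "\<And>p q. p \<in> Z \<Longrightarrow> q \<in> Z \<Longrightarrow> p \<noteq> q \<Longrightarrow> e \<bullet> p \<noteq> e \<bullet> q \<and> p - q \<notin> span {e}"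
proof -
  define V where "V = (\<lambda>(p,q). p - q) ` (Z \<times> Z) - {0}"
  have finV: "finite V" using assms by (auto simp: V_def)
  define W where "W = (\<Union>v\<in>V. {x. v \<bullet> x = 0} \<union> span {v})"
  have "negligible W"
    unfolding W_def
  proof (intro negligible_Union)
    show "finite ((\<lambda>v. {x. v \<bullet> x = 0} \<union> span {v}) ` V)" using finV by simp
    fix t assume "t \<in> (\<lambda>v. {x. v \<bullet> x = 0} \<union> span {v}) ` V"
    then obtain v where v: "v \<in> V" "t = {x. v \<bullet> x = 0} \<union> span {v}" by blast
    have "negligible (span {v})"
      using assms(2) dim_le_card'[of "{v}"] by (intro negligible_lowdim) auto
    moreover have "negligible {x. v \<bullet> x = 0}" using v(1) by (intro negligible_hyperplane) (auto simp: V_def)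
    ultimately show "negligible t" using v by auto
  qed
  then have "W \<union> {0} \<noteq> UNIV"
    by (metis negligible_Un_eq negligible_sing non_negligible_UNIV)
  then obtain w where "w \<notin> W \<union> {0}" by blast
  then have w: "w \<noteq> 0" "\<And>v. v \<in> V \<Longrightarrow> v \<bullet> w \<noteq> 0 \<and> w \<notin> span {v}" by (auto simp: W_def)
  define e where "e = w /\<^sub>R norm w"
  show thesis
  proof
    show "norm e = 1" using w by (simp add: e_def)
    fix p q assume pq: "p \<in> Z" "q \<in> Z" "p \<noteq> q"
    then have v: "p - q \<in> V" by (auto simp: V_def)
    have "p - q \<notin> span {e}"
    proof
      assume "p - q \<in> span {e}"
      then obtain k where k: "p - q = k *\<^sub>R e" by (auto simp: span_singleton)
      then have "k \<noteq> 0" using pq by auto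
      then have "w = (norm w / k) *\<^sub>R (p - q)" using k w by (simp add: e_def)
      then have "w \<in> span {p - q}" by (auto simp: span_singleton)
      then show False using w(2)[OF v] by simp
    qed
    moreover have "e \<bullet> p \<noteq> e \<bullet> q"
      using w(2)[OF v] w(1) by (auto simp: e_def inner_diff_left inner_diff_right inner_commute)
    ultimately show "e \<bullet> p \<noteq> e \<bullet> q \<and> p - q \<notin> span {e}" by blast
  qed
qed

text \<open>The points are added in order of increasing height \<open>e \<bullet> z\<close>, so that
  a hyperplane orthogonal to \<open>e\<close> always separates the new point from all earlier
  ones.\<close>

theorem extend_avoiding_finite:
  fixes g :: "'a::euclidean_space \<Rightarrow> 'a"
  assumes dim: "DIM('a) \<ge> 3" and D: "compact D" and S: "closed S" "S \<subseteq> D"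
    and g: "continuous_on S g" and Z: "finite Z"
    and ex: "\<And>z. z \<in> Z \<Longrightarrow> \<exists>G. continuous_on D G \<and> (\<forall>x\<in>S. G x = g x) \<and> z \<notin> G ` D"
  shows "\<exists>G. continuous_on D G \<and> (\<forall>x\<in>S. G x = g x) \<and> G ` D \<inter> Z = {}"
proof -
  obtain e :: 'a where e: "norm e = 1"
    and gen: "\<And>p q. p \<in> Z \<Longrightarrow> q \<in> Z \<Longrightarrow> p \<noteq> q \<Longrightarrow> e \<bullet> p \<noteq> e \<bullet> q \<and> p - q \<notin> span {e}"
    using exists_generic_direction[OF Z] dim by auto
  have "Z' \<subseteq> Z \<Longrightarrow> \<exists>G. continuous_on D G \<and> (\<forall>x\<in>S. G x = g x) \<and> G ` D \<inter> Z' = {}" if "finite Z'" for Z'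
    using that
  proof (induction Z' rule: finite_ranking_induct[where f = "\<lambda>z. e \<bullet> z"])
    case empty
    have "compact S" using D S by (metis compact_Int_closed inf.absorb2)
    then have "bounded (g ` S)" using g by (simp add: compact_continuous_image compact_imp_bounded)
    then obtain B where B: "B > 0" "\<forall>y\<in>g ` S. norm y \<le> B" unfolding bounded_pos by blast
    obtain G where "continuous_on D G" "\<And>x. x \<in> S \<Longrightarrow> G x = g x"
    proof (rule Tietze[OF g closed_subset[OF S(2,1)], of B])
      show "0 \<le> B" "\<And>x. x \<in> S \<Longrightarrow> norm (g x) \<le> B" using B by auto
    qed (rule that, assumption, blast)
    then show ?case by auto
  next
    case (insert z A)
    then have A: "A \<subseteq> Z" "z \<in> Z" "finite A" by auto
    show ?case
    proof (cases "z \<in> A")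
      case True
      then show ?thesis using insert by (simp add: insert_absorb)
    next
      case False
      have lt: "e \<bullet> p < e \<bullet> z" if "p \<in> A" for p
    proof -
      have "p \<in> Z" "p \<noteq> z" using that A False by auto
      then show ?thesis using gen[of p z] insert.hyps(2)[OF that] A(2) by linarith
    qed
      obtain c where c: "\<And>p. p \<in> A \<Longrightarrow> e \<bullet> p < c" "c < e \<bullet> z"
      proof (cases "A = {}")
        case True
        then show ?thesis using that[of "e \<bullet> z - 1"] by simp
      next
        case ne: False
        define m where "m = Max ((\<bullet>) e ` A)"
        have m: "m < e \<bullet> z" unfolding m_def using A(3) ne lt by simp
        have le: "e \<bullet> p \<le> m" if "p \<in> A" for p unfolding m_def using A(3) that by simp
        show ?thesis
        proof (rule that)
          show "e \<bullet> p < (m + e \<bullet> z)/2" if "p \<in> A" for p using m le[OF that] by simp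
          show "(m + e \<bullet> z)/2 < e \<bullet> z" using m by simp
        qed
      qed
      have "\<exists>G. continuous_on D G \<and> (\<forall>x\<in>S. G x = g x) \<and> G ` D \<inter> (A \<union> {z}) = {}"
      proof (rule extend_avoiding_union[OF dim D S A(3) _ e, where c = c])
        show "p - q \<notin> span {e}" if "p \<in> A" "q \<in> {z}" for p q
          using gen[of p q] that A False by auto
        show "\<exists>G. continuous_on D G \<and> (\<forall>x\<in>S. G x = g x) \<and> G ` D \<inter> {z} = {}"
          using ex[OF A(2)] by auto
        show "\<exists>G. continuous_on D G \<and> (\<forall>x\<in>S. G x = g x) \<and> G ` D \<inter> A = {}"
          using insert A by blast
      qed (simp_all add: c)
      then show ?thesis by simp
    qed
  qed
  then show ?thesis using Z by blast
qed

section \<open>Points in general position\<close>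

text \<open>Flats spanned by disjoint index sets meet at most in the expected dimension; the bound \<open>-1\<close>
  means that they do not meet, as \<^term>\<open>aff_dim {} = -1\<close>.\<close>

definition general_position :: "'i set \<Rightarrow> ('i \<Rightarrow> 'a::euclidean_space) \<Rightarrow> bool" where
  "general_position Y w \<longleftrightarrow>
     (\<forall>\<I>. \<I> \<subseteq> Pow Y \<longrightarrow> pairwise disjnt \<I> \<longrightarrow> {} \<notin> \<I> \<longrightarrow> (\<forall>I\<in>\<I>. card I \<le> DIM('a) + 1) \<longrightarrow>
       aff_dim (\<Inter>I\<in>\<I>. affine hull (w ` I)) \<le>
         max (-1) (int DIM('a) - (\<Sum>I\<in>\<I>. int DIM('a) + 1 - int (card I))))"

text \<open>If \<open>A\<close> and \<open>B\<close> span the space and the enlarged flat meets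
  \<open>A\<close>, the dimension formula applies to these two. Otherwise \<open>v\<close> lies
  outside the span of \<open>A\<close> and \<open>B\<close>, and adding it creates no new
  intersection: by exchange, a new common point \<open>x\<close> would put \<open>v\<close> into the
  span of \<open>x\<close> and \<open>B\<close>.\<close>

lemma aff_dim_Int_insert_le:
  fixes A B :: "'a::euclidean_space set"
  assumes A: "affine A" and B: "affine B"
    and v: "affine hull (A \<union> B) = UNIV \<or> v \<notin> affine hull (A \<union> B)"
    and dA: "aff_dim A \<le> max (-1) a" and dB: "aff_dim B \<le> j - 1"
    and dAB: "aff_dim (A \<inter> B) \<le> max (-1) (a + j - int DIM('a) - 1)"
  shows "aff_dim (A \<inter> affine hull (insert v B)) \<le> max (-1) (a + j - int DIM('a))"
proof (cases "affine hull (A \<union> B) = UNIV")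
  case False
  then have v: "v \<notin> affine hull (A \<union> B)" using v by blast
  have "A \<inter> affine hull (insert v B) \<subseteq> A \<inter> B"
  proof
    fix x assume x: "x \<in> A \<inter> affine hull (insert v B)"
    show "x \<in> A \<inter> B"
    proof (rule ccontr)
      assume "x \<notin> A \<inter> B"
      then have xB: "x \<notin> affine hull B" using x B by (simp add: hull_same)
      have "x \<in> affine hull (insert v B)" using x by simp
      then have "v \<in> affine hull (insert x B)"
        using xB aff_dim_insert[of x "insert v B"] aff_dim_insert[of v B] aff_dim_insert[of x B]
          aff_dim_insert[of v "insert x B"] by (auto simp: insert_commute split: if_splits)
      moreover have "affine hull (insert x B) \<subseteq> affine hull (A \<union> B)"
        using x by (intro hull_mono) auto
      ultimately show False using v by blast
    qed
  qed
  then have "aff_dim (A \<inter> affine hull (insert v B)) \<le> aff_dim (A \<inter> B)" by (rule aff_dim_subset)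
  then show ?thesis using dAB by linarith
next
  case True
  define C where "C = affine hull (insert v B)"
  have C: "affine C" by (simp add: C_def)
  have dC: "aff_dim C \<le> j"
  proof -
    have "aff_dim C = aff_dim (insert v B)" by (simp add: C_def)
    also have "\<dots> \<le> aff_dim B + 1" by (simp add: aff_dim_insert)
    finally show ?thesis using dB by linarith
  qed
  show ?thesis
  proof (cases "A \<inter> C = {}")
    case True
    then show ?thesis by (simp add: C_def)
  next
    case False
    then obtain z where z: "z \<in> A" "z \<in> C" by blast
    \<comment> \<open>The dimension formula involves the set of sums. Translated by
      \<open>- z\<close> for a common point \<open>z\<close>, this set is a flat that contains
      \<open>A\<close> as well as \<open>C\<close>, hence \<open>B\<close>, and so the whole
      space.\<close>
    have "{x + y |x y. x \<in> A \<and> y \<in> C} = UNIV"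
    proof -
      have "affine {x + y |x y. x \<in> A \<and> y \<in> C}"
        unfolding affine_def
      proof clarify
        fix a c a' c' u v assume *: "a \<in> A" "c \<in> C" "a' \<in> A" "c' \<in> C" "u + v = (1::real)"
        have "u *\<^sub>R (a + c) + v *\<^sub>R (a' + c') = (u *\<^sub>R a + v *\<^sub>R a') + (u *\<^sub>R c + v *\<^sub>R c')"
          by (simp add: algebra_simps)
        moreover have "u *\<^sub>R a + v *\<^sub>R a' \<in> A" "u *\<^sub>R c + v *\<^sub>R c' \<in> C"
          using A C * by (auto simp: affine_def)
        ultimately show "\<exists>x y. u *\<^sub>R (a + c) + v *\<^sub>R (a' + c') = x + y \<and> x \<in> A \<and> y \<in> C" by blast
      qed
      then have aff: "affine ((\<lambda>x. x - z) ` {x + y |x y. x \<in> A \<and> y \<in> C})"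
        using affine_translation[of "{x + y |x y. x \<in> A \<and> y \<in> C}" "- z"] by simp
      have "A \<subseteq> (\<lambda>x. x - z) ` {x + y |x y. x \<in> A \<and> y \<in> C}"
        using z by (force simp: image_iff)
      moreover have "C \<subseteq> (\<lambda>x. x - z) ` {x + y |x y. x \<in> A \<and> y \<in> C}"
        using z by (force simp: image_iff)
      moreover have "B \<subseteq> C" unfolding C_def by (meson hull_inc insertCI subsetI)
      ultimately have "affine hull (A \<union> B) \<subseteq> (\<lambda>x. x - z) ` {x + y |x y. x \<in> A \<and> y \<in> C}"
        using aff by (intro hull_minimal) auto
      then have "\<And>u. u \<in> (\<lambda>x. x - z) ` {x + y |x y. x \<in> A \<and> y \<in> C}" using \<open>affine hull (A \<union> B) = UNIV\<close> by auto
      then have "\<And>u. u + z - z \<in> (\<lambda>x. x - z) ` {x + y |x y. x \<in> A \<and> y \<in> C}" by simp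
      then have "u - z + z \<in> {x + y |x y. x \<in> A \<and> y \<in> C}" for u by (smt (verit) add_diff_cancel diff_add_cancel imageE)
      then show ?thesis by auto
    qed
    then have "int DIM('a) = aff_dim A + aff_dim C - aff_dim (A \<inter> C)"
      using aff_dim_sums_Int[OF A C False] by simp
    moreover have "\<not> aff_dim A < 0" using z(1) by auto
    then have "aff_dim A \<le> a" using dA by linarith
    ultimately show ?thesis using dC by (simp add: C_def)
  qed
qed

lemma exists_near_avoiding_proper_affine:
  fixes t :: "'a::euclidean_space"
  assumes "finite F" "\<And>A. A \<in> F \<Longrightarrow> affine A \<and> A \<noteq> UNIV" "\<delta> > 0"
  obtains v where "dist v t < \<delta>" "\<And>A. A \<in> F \<Longrightarrow> v \<notin> A"
proof -
  have "negligible A" if "A \<in> F" for A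
    using assms(2)[OF that] affine_hull_nonempty_interior[of A]
    by (metis affine_imp_convex hull_same negligible_convex_interior)
  then have "negligible (\<Union>F)" using assms(1) by (rule negligible_Union[rotated])
  then have "\<not> ball t \<delta> \<subseteq> \<Union>F"
    using assms(3) open_not_negligible[of "ball t \<delta>"] negligible_subset[of "\<Union>F" "ball t \<delta>"] by auto
  then show ?thesis using that by (auto simp: subset_iff dist_commute)
qed

text \<open>The points are placed one after another. Since the index sets are disjoint, only one of
  them involves the new point, which therefore has to avoid just the proper ones among the finitely
  many joins of flats given by the earlier points.\<close>

lemma general_position_near:
  fixes t :: "'i \<Rightarrow> 'a::euclidean_space"
  assumes "finite Y" "\<delta> > 0"
  shows "\<exists>w. general_position Y w \<and> (\<forall>y\<in>Y. dist (w y) (t y) < \<delta>)"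
  using assms(1)
proof (induction Y rule: finite_induct)
  case empty
  show ?case
    by (auto simp: general_position_def subset_singleton_iff)
next
  case (insert y Y)
  then obtain w where w: "general_position Y w" "\<And>y. y \<in> Y \<Longrightarrow> dist (w y) (t y) < \<delta>" by blast
  define A where "A \<I> = (\<Inter>I\<in>\<I>. affine hull (w ` I))" for \<I>
  define F where "F = {affine hull (A \<I> \<union> affine hull (w ` J)) | \<I> J. \<I> \<subseteq> Pow Y \<and> J \<subseteq> Y} - {UNIV}"
  have "F \<subseteq> (\<lambda>(\<I>, J). affine hull (A \<I> \<union> affine hull (w ` J))) ` (Pow (Pow Y) \<times> Pow Y)"
    by (auto simp: F_def)
  then have "finite F" using insert.hyps(1) by (meson finite_Pow_iff finite_SigmaI finite_imageI finite_subset)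
  moreover have "affine T \<and> T \<noteq> UNIV" if "T \<in> F" for T using that by (auto simp: F_def)
  ultimately obtain v where v: "dist v (t y) < \<delta>" "\<And>T. T \<in> F \<Longrightarrow> v \<notin> T"
    using exists_near_avoiding_proper_affine[of F \<delta> "t y"] assms(2) by blast
  define w' where "w' = w(y := v)"
  have ww: "w' ` I = w ` I" if "y \<notin> I" for I using that by (auto simp: w'_def)
  let ?c = "\<lambda>I::'i set. int DIM('a) + 1 - int (card I)"
  have "general_position (insert y Y) w'"
    unfolding general_position_def
  proof (intro allI impI)
    fix \<I> assume \<I>: "\<I> \<subseteq> Pow (insert y Y)" "pairwise disjnt \<I>" "{} \<notin> \<I>" "\<forall>I\<in>\<I>. card I \<le> DIM('a) + 1"
    have fin\<I>: "finite \<I>" using \<I>(1) insert.hyps(1) by (meson finite_Pow_iff finite_insert finite_subset)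
    show "aff_dim (\<Inter>I\<in>\<I>. affine hull (w' ` I)) \<le> max (-1) (int DIM('a) - (\<Sum>I\<in>\<I>. ?c I))"
    proof (cases "\<exists>I\<in>\<I>. y \<in> I")
      case False
      then have "\<I> \<subseteq> Pow Y" using \<I>(1) by blast
      moreover have "(\<Inter>I\<in>\<I>. affine hull (w' ` I)) = (\<Inter>I\<in>\<I>. affine hull (w ` I))"
        using False ww by auto
      ultimately show ?thesis using w(1) \<I> unfolding general_position_def by simp
    next
      case True
      then obtain I where I: "I \<in> \<I>" "y \<in> I" by blast
      define \<J> where "\<J> = \<I> - {I}"
      define J where "J = I - {y}"
      have noy: "y \<notin> K" if "K \<in> \<J>" for K
        using that I \<I>(2) by (auto simp: \<J>_def pairwise_def disjnt_def)
      have \<J>: "\<J> \<subseteq> Pow Y" using \<I>(1) noy by (auto simp: \<J>_def)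
      have J: "J \<subseteq> Y" using \<I>(1) I by (auto simp: J_def)
      have finI: "finite I" using \<I>(1) I insert.hyps(1) by (meson PowD finite_insert finite_subset in_mono)
      have cI: "card I = Suc (card J)" unfolding J_def using card_Suc_Diff1[OF finI I(2)] by simp
      have gpJ: "aff_dim (A \<J>) \<le> max (-1) (int DIM('a) - (\<Sum>I\<in>\<J>. ?c I))"
        using w(1) \<J> \<I> unfolding general_position_def A_def
        by (auto simp: \<J>_def pairwise_def)
      have sum: "(\<Sum>I\<in>\<I>. ?c I) = ?c I + (\<Sum>I\<in>\<J>. ?c I)"
        unfolding \<J>_def using fin\<I> I(1) by (rule sum.remove)
      \<comment> \<open>For nonempty \<open>J\<close> this is the general position of the earlier
        points, applied to the family with \<open>I\<close> replaced by \<open>J\<close>. For empty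
        \<open>J\<close> there is no flat and the bound \<open>-1\<close> holds.\<close>
      have gpJI: "aff_dim (A \<J> \<inter> affine hull (w ` J)) \<le>
          max (-1) (int DIM('a) - (\<Sum>I\<in>\<J>. ?c I) + int (card J) - int DIM('a) - 1)"
      proof (cases "J = {}")
        case True
        then show ?thesis by simp
      next
        case False
        have "disjnt I K" if "K \<in> \<J>" for K using that \<I>(2) I by (auto simp: \<J>_def pairwise_def)
        then have JnJ: "J \<notin> \<J>"
          using False by (auto simp: J_def disjnt_def)
        have "insert J \<J> \<subseteq> Pow Y" using \<J> J by auto
        moreover have "pairwise disjnt (insert J \<J>)"
          using \<I>(2) I by (auto simp: J_def \<J>_def pairwise_def disjnt_def)
        moreover have "{} \<notin> insert J \<J>" using \<I>(3) False by (auto simp: \<J>_def)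
        moreover have "\<forall>I\<in>insert J \<J>. card I \<le> DIM('a) + 1"
          using \<I>(4) cI I(1) by (auto simp: \<J>_def)
        ultimately have "aff_dim (\<Inter>I\<in>insert J \<J>. affine hull (w ` I)) \<le> max (-1) (int DIM('a) - (\<Sum>I\<in>insert J \<J>. ?c I))"
          using w(1) unfolding general_position_def by blast
        moreover have "finite \<J>" using fin\<I> by (simp add: \<J>_def)
        ultimately show ?thesis using JnJ by (simp add: A_def Int_commute algebra_simps)
      qed
      have "aff_dim (A \<J> \<inter> affine hull (insert v (affine hull (w ` J)))) \<le>
          max (-1) (int DIM('a) - (\<Sum>I\<in>\<J>. ?c I) + int (card J) - int DIM('a))"
      proof (rule aff_dim_Int_insert_le)
        show "affine (A \<J>)" unfolding A_def by (intro affine_Inter) auto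
        show "affine (affine hull (w ` J))" by simp
        show "affine hull (A \<J> \<union> affine hull (w ` J)) = UNIV \<or> v \<notin> affine hull (A \<J> \<union> affine hull (w ` J))"
          using v(2)[of "affine hull (A \<J> \<union> affine hull (w ` J))"] \<J> J unfolding F_def by blast
        have "finite J" using finI by (simp add: J_def)
        then have "aff_dim (w ` J) \<le> int (card (w ` J)) - 1" by (intro aff_dim_le_card) auto
        then show "aff_dim (affine hull (w ` J)) \<le> int (card J) - 1"
          using card_image_le[OF \<open>finite J\<close>, of w] by simp
      qed (use gpJ gpJI in auto)
      moreover have "(\<Inter>I\<in>\<I>. affine hull (w' ` I)) = A \<J> \<inter> affine hull (insert v (affine hull (w ` J)))"
      proof -
        have "I = insert y J" using I(2) by (auto simp: J_def)
        then have "w' ` I = insert v (w ` J)" using ww[of J] by (auto simp: J_def w'_def)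
        then have "affine hull (w' ` I) = affine hull (insert v (affine hull (w ` J)))"
          by (metis hull_insert)
        moreover have "(\<Inter>I\<in>\<J>. affine hull (w' ` I)) = A \<J>" unfolding A_def using noy ww by auto
        moreover have "\<I> = insert I \<J>" using I by (auto simp: \<J>_def)
        ultimately show ?thesis by auto
      qed
      ultimately show ?thesis using sum cI by (simp add: algebra_simps)
    qed
  qed
  moreover have "\<forall>z\<in>insert y Y. dist (w' z) (t z) < \<delta>" using v(1) w(2) by (auto simp: w'_def)
  ultimately show ?case by blast
qed

section \<open>A fine simplicial partition of unity\<close>

lemma continuous_on_Max_image:
  fixes f :: "'i \<Rightarrow> 'a::topological_space \<Rightarrow> real"
  assumes "finite I" "I \<noteq> {}" "\<And>i. i \<in> I \<Longrightarrow> continuous_on S (f i)"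
  shows "continuous_on S (\<lambda>x. Max ((\<lambda>i. f i x) ` I))"
  using assms
proof (induction I rule: finite_ne_induct)
  case (insert i I)
  have "continuous_on S (\<lambda>x. max (f i x) (Max ((\<lambda>i. f i x) ` I)))"
    using insert by (intro continuous_on_max) auto
  then show ?case using insert.hyps by (simp add: Max_insert)
qed simp

lemma continuous_on_Min_image:
  fixes f :: "'i \<Rightarrow> 'a::topological_space \<Rightarrow> real"
  assumes "finite I" "I \<noteq> {}" "\<And>i. i \<in> I \<Longrightarrow> continuous_on S (f i)"
  shows "continuous_on S (\<lambda>x. Min ((\<lambda>i. f i x) ` I))"
  using assms
proof (induction I rule: finite_ne_induct)
  case (insert i I)
  have "continuous_on S (\<lambda>x. min (f i x) (Min ((\<lambda>i. f i x) ` I)))"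
    using insert by (intro continuous_on_min) auto
  then show ?case using insert.hyps by (simp add: Min_insert)
qed simp

text \<open>This is Freudenthal's triangulation.  For \<open>0 \<le> t < 1\<close> rounding down the scaled partial sums of
  \<open>x\<close>, shifted by \<open>t\<close>, yields a vertex of the simplex of the triangulation containing \<open>x\<close>, and the
  barycentric coordinate of that vertex is the measure of the set of \<open>t\<close> that yield it.\<close>

definition scaled_sum :: "nat \<Rightarrow> (nat \<Rightarrow> real) \<Rightarrow> nat \<Rightarrow> real" where
  "scaled_sum m x i = m * (\<Sum>j<i. x j)"

definition grid_vertex :: "nat \<Rightarrow> (nat \<Rightarrow> real) \<Rightarrow> real \<Rightarrow> nat \<Rightarrow> real" where
  "grid_vertex m x t i = (of_int \<lfloor>scaled_sum m x (Suc i) + t\<rfloor> - of_int \<lfloor>scaled_sum m x i + t\<rfloor>) / m"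

lemma scaled_sum_0 [simp]: "scaled_sum m x 0 = 0"
  by (simp add: scaled_sum_def)

lemma scaled_sum_Suc: "scaled_sum m x (Suc i) = scaled_sum m x i + m * x i"
  by (simp add: scaled_sum_def algebra_simps)

lemma scaled_sum_simplex:
  assumes "x \<in> standard_simplex N" "\<And>j. j \<ge> i \<Longrightarrow> x j = 0"
  shows "scaled_sum m x i = m"
proof -
  have "(\<Sum>j<i. x j) = (\<Sum>j\<le>N. x j)"
  proof (rule sum.mono_neutral_cong)
    show "x j = 0" if "j \<in> {..N} - {..<i}" for j using that assms(2) by auto
    show "x j = 0" if "j \<in> {..<i} - {..N}" for j using that assms(1) by (auto simp: standard_simplex_def)
  qed auto
  then show ?thesis using assms(1) by (simp add: scaled_sum_def standard_simplex_def)
qed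

text \<open>The differences telescope, and \<open>0 \<le> t < 1\<close> makes the rounded sum at
  index \<open>0\<close> vanish.\<close>

lemma scaled_sum_grid_vertex:
  assumes "m > 0" "0 \<le> t" "t < 1"
  shows "scaled_sum m (grid_vertex m x t) i = of_int \<lfloor>scaled_sum m x i + t\<rfloor>"
proof (induction i)
  case 0
  have "\<lfloor>t\<rfloor> = 0" using assms by (simp add: floor_eq_iff)
  then show ?case by simp
next
  case (Suc i)
  have "m * grid_vertex m x t i = of_int \<lfloor>scaled_sum m x (Suc i) + t\<rfloor> - of_int \<lfloor>scaled_sum m x i + t\<rfloor>"
    using assms by (simp add: grid_vertex_def)
  then show ?case using Suc by (simp only: scaled_sum_Suc[of m "grid_vertex m x t"])
qed

lemma grid_vertex_eq_0:
  assumes "x i = 0"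
  shows "grid_vertex m x t i = 0"
  using assms by (simp add: grid_vertex_def scaled_sum_Suc)

lemma grid_vertex_near:
  assumes "m > 0"
  shows "\<bar>grid_vertex m x t i - x i\<bar> < 1 / m"
proof -
  have "\<bar>m * grid_vertex m x t i - m * x i\<bar> < 1"
    using assms of_int_floor_le[of "scaled_sum m x (Suc i) + t"] of_int_floor_le[of "scaled_sum m x i + t"]
      floor_correct[of "scaled_sum m x (Suc i) + t"] floor_correct[of "scaled_sum m x i + t"] scaled_sum_Suc[of m x i]
    by (simp only: grid_vertex_def abs_less_iff) (simp, linarith)
  then have "m * \<bar>grid_vertex m x t i - x i\<bar> < 1"
    by (simp add: abs_mult flip: right_diff_distrib)
  then show ?thesis using assms by (simp add: field_simps)
qed

lemma grid_vertex_in_simplex: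
  assumes x: "x \<in> standard_simplex N" and m: "m > 0" and t: "0 \<le> t" "t < 1"
  shows "grid_vertex m x t \<in> standard_simplex N"
proof -
  have nn: "0 \<le> grid_vertex m x t i" for i
  proof -
    have "\<lfloor>scaled_sum m x i + t\<rfloor> \<le> \<lfloor>scaled_sum m x (Suc i) + t\<rfloor>"
      using x by (intro floor_mono) (simp add: scaled_sum_Suc standard_simplex_def)
    then show ?thesis by (simp add: grid_vertex_def)
  qed
  have z: "grid_vertex m x t i = 0" if "i > N" for i
    using x that by (intro grid_vertex_eq_0) (auto simp: standard_simplex_def)
  have "scaled_sum m x (Suc N) = m"
    using x by (intro scaled_sum_simplex) (auto simp: standard_simplex_def)
  then have "scaled_sum m (grid_vertex m x t) (Suc N) = m"
    using t by (simp add: scaled_sum_grid_vertex[OF m t] floor_eq_iff)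
  then have s: "(\<Sum>j\<le>N. grid_vertex m x t j) = 1"
    using m by (simp add: scaled_sum_def lessThan_Suc_atMost)
  have "grid_vertex m x t i \<le> 1" for i
  proof (cases "i \<le> N")
    case True
    then have "grid_vertex m x t i \<le> (\<Sum>j\<le>N. grid_vertex m x t j)"
      using nn by (intro member_le_sum) auto
    then show ?thesis using s by simp
  qed (use z in auto)
  then show ?thesis using nn z s by (auto simp: standard_simplex_def)
qed

text \<open>Only partial sums at the support of \<open>x\<close> matter. Their floors increase with
  \<open>t\<close>, so the sum \<open>\<Psi> t\<close> of these floors determines each of them and
  thus the grid vertex. It remains to count the values of \<open>\<Psi>\<close>: each floor rises by
  at most one while \<open>t\<close> runs through the half-open unit interval.\<close>

lemma card_grid_vertices:
  assumes x: "x \<in> standard_simplex N" and m: "m > 0"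
  shows "finite (grid_vertex m x ` {0..<1}) \<and> card (grid_vertex m x ` {0..<1}) \<le> card {i. x i \<noteq> 0}"
proof -
  define \<sigma> where "\<sigma> = {i. x i \<noteq> 0}"
  have "\<sigma> \<subseteq> {..N}" using x by (auto simp: \<sigma>_def standard_simplex_def) (meson not_le)
  then have fin: "finite \<sigma>" by (rule finite_subset) simp
  have ne: "\<sigma> \<noteq> {}"
  proof
    assume "\<sigma> = {}"
    then have "x i = 0" for i by (auto simp: \<sigma>_def)
    then show False using x by (simp add: standard_simplex_def)
  qed
  let ?S = "\<lambda>i. scaled_sum m x (Suc i)"
  define \<Psi> where "\<Psi> t = (\<Sum>i\<in>\<sigma>. \<lfloor>?S i + t\<rfloor>)" for t
  define c where "c = (\<Sum>i\<in>\<sigma>. \<lfloor>?S i\<rfloor>)"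
  \<comment> \<open>At the last vertex of the support the partial sum is the integer
    \<open>m\<close>, so its floor is constant for \<open>0 \<le> t < 1\<close>. This reduces the
    number of possible values of \<open>\<Psi>\<close> from \<open>card \<sigma> + 1\<close> to
    \<open>card \<sigma>\<close>.\<close>
  have top: "?S (Max \<sigma>) = m"
  proof (rule scaled_sum_simplex[OF x])
    fix j assume "Suc (Max \<sigma>) \<le> j"
    then have "j \<notin> \<sigma>" using Max_ge[OF fin, of j] by auto
    then show "x j = 0" by (simp add: \<sigma>_def)
  qed
  have rng: "\<Psi> t \<in> {c..c + int (card \<sigma>) - 1}" if t: "t \<in> {0..<1}" for t
  proof -
    have "c \<le> \<Psi> t" unfolding c_def \<Psi>_def using t by (intro sum_mono floor_mono) auto
    moreover have "\<Psi> t \<le> (\<Sum>i\<in>\<sigma>. \<lfloor>?S i\<rfloor> + (if i = Max \<sigma> then 0 else 1))"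
      unfolding \<Psi>_def
    proof (rule sum_mono)
      fix i
      have "\<lfloor>?S i + t\<rfloor> \<le> \<lfloor>?S i\<rfloor> + 1" using t by (simp add: floor_le_iff) linarith
      moreover have "\<lfloor>?S (Max \<sigma>) + t\<rfloor> = \<lfloor>?S (Max \<sigma>)\<rfloor>"
        unfolding top using t by (simp add: floor_eq_iff)
      ultimately show "\<lfloor>?S i + t\<rfloor> \<le> \<lfloor>?S i\<rfloor> + (if i = Max \<sigma> then 0 else 1)" by auto
    qed
    moreover have "(\<Sum>i\<in>\<sigma>. if i = Max \<sigma> then 0 else 1 :: int) = int (card \<sigma>) - 1"
    proof -
      have "(\<Sum>i\<in>\<sigma>. if i = Max \<sigma> then 0 else 1 :: int) = (\<Sum>i\<in>\<sigma> - {Max \<sigma>}. 1)"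
        by (rule sum.mono_neutral_cong_right) (use fin in auto)
      then show ?thesis using fin ne card_gt_0_iff[of \<sigma>] by (simp add: of_nat_diff)
    qed
    ultimately show ?thesis by (simp add: c_def sum.distrib)
  qed
  have inj: "grid_vertex m x t = grid_vertex m x t'" if t: "t \<in> {0..<1}" "t' \<in> {0..<1}" "t \<le> t'" "\<Psi> t = \<Psi> t'" for t t'
  proof -
    have *: "\<lfloor>?S i + t\<rfloor> = \<lfloor>?S i + t'\<rfloor>" if "i \<in> \<sigma>" for i
      by (rule sum_mono_inv[OF t(4)[unfolded \<Psi>_def] _ that fin]) (use t in \<open>auto intro: floor_mono\<close>)
    have "\<lfloor>scaled_sum m x i + t\<rfloor> = \<lfloor>scaled_sum m x i + t'\<rfloor>" for i
    proof (induction i)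
      case 0
      have "\<lfloor>t\<rfloor> = 0" "\<lfloor>t'\<rfloor> = 0" using t by (auto simp: floor_eq_iff)
      then show ?case by simp
    next
      case (Suc i)
      show ?case
      proof (cases "i \<in> \<sigma>")
        case False
        then show ?thesis using Suc by (simp add: scaled_sum_Suc \<sigma>_def)
      qed (use * in simp)
    qed
    then show ?thesis by (simp add: grid_vertex_def fun_eq_iff)
  qed
  then have inj': "grid_vertex m x t = grid_vertex m x t'" if "t \<in> {0..<1}" "t' \<in> {0..<1}" "\<Psi> t = \<Psi> t'" for t t'
    using that by (metis linear)
  define h where "h k = grid_vertex m x (SOME t. t \<in> {0..<1} \<and> \<Psi> t = k)" for k
  have h: "grid_vertex m x t = h (\<Psi> t)" if "t \<in> {0..<1}" for t
  proof -
    have "(SOME t'. t' \<in> {0..<1} \<and> \<Psi> t' = \<Psi> t) \<in> {0..<1} \<and> \<Psi> (SOME t'. t' \<in> {0..<1} \<and> \<Psi> t' = \<Psi> t) = \<Psi> t"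
      by (rule someI[of _ t]) (use that in simp)
    then show ?thesis unfolding h_def using inj' that by metis
  qed
  have sub: "grid_vertex m x ` {0..<1} \<subseteq> h ` {c..c + int (card \<sigma>) - 1}"
    using h rng by (metis (no_types, lifting) image_subsetI imageI)
  have "card (grid_vertex m x ` {0..<1}) \<le> card {c..c + int (card \<sigma>) - 1}"
    using card_mono[OF _ sub] card_image_le[of "{c..c + int (card \<sigma>) - 1}" h] by simp
  then show ?thesis using sub finite_subset[OF sub] by (simp add: \<sigma>_def)
qed

text \<open>The \<open>t\<close> that yield \<open>v\<close> form the half-open interval from
  \<open>lo v x\<close> to \<open>hi v x\<close>. Its ends are a maximum and a minimum of finitely
  many continuous functions of \<open>x\<close>, so its length is continuous. For fixed
  \<open>x\<close> these intervals partition the half-open unit interval, so the lengths add up to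
  one.\<close>

lemma fine_partition_of_unity:
  fixes m N :: nat
  assumes m: "m > 0"
  obtains V :: "(nat \<Rightarrow> real) set" and l :: "(nat \<Rightarrow> real) \<Rightarrow> (nat \<Rightarrow> real) \<Rightarrow> real"
  where "finite V" "V \<subseteq> standard_simplex N"
    "\<And>v. v \<in> V \<Longrightarrow> continuous_on (standard_simplex N) (l v)"
    "\<And>v x. 0 \<le> l v x"
    "\<And>x. x \<in> standard_simplex N \<Longrightarrow> (\<Sum>v\<in>V. l v x) = 1"
    "\<And>v x i. v \<in> V \<Longrightarrow> x \<in> standard_simplex N \<Longrightarrow> 0 < l v x \<Longrightarrow> x i = 0 \<Longrightarrow> v i = 0"
    "\<And>v x i. v \<in> V \<Longrightarrow> x \<in> standard_simplex N \<Longrightarrow> 0 < l v x \<Longrightarrow> \<bar>v i - x i\<bar> < 1 / m"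
    "\<And>x. x \<in> standard_simplex N \<Longrightarrow> card {v\<in>V. 0 < l v x} \<le> card {i. x i \<noteq> 0}"
proof -
  define V :: "(nat \<Rightarrow> real) set" where "V = {v \<in> standard_simplex N. \<forall>i. real m * v i \<in> \<int>}"
  \<comment> \<open>\<open>t\<close> yields \<open>v\<close> iff each
    \<open>scaled_sum m v i\<close> is the floor of \<open>scaled_sum m x i + t\<close>; the bounds
    are these conditions solved for \<open>t\<close>. The index \<open>0\<close> contributes
    \<open>0 \<le> t < 1\<close>.\<close>
  define lo :: "(nat \<Rightarrow> real) \<Rightarrow> (nat \<Rightarrow> real) \<Rightarrow> real" where "lo v x = Max ((\<lambda>i. scaled_sum m v i - scaled_sum m x i) ` {..Suc N})" for v x
  define hi :: "(nat \<Rightarrow> real) \<Rightarrow> (nat \<Rightarrow> real) \<Rightarrow> real" where "hi v x = Min ((\<lambda>i. scaled_sum m v i + 1 - scaled_sum m x i) ` {..Suc N})" for v x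
  define l where "l v x = max 0 (hi v x - lo v x)" for v x
  have finV: "finite V"
  proof (rule finite_subset)
    show "V \<subseteq> {f. \<forall>i. (i \<in> {..N} \<longrightarrow> f i \<in> (\<lambda>k. real_of_int k / m) ` {0..int m}) \<and> (i \<notin> {..N} \<longrightarrow> f i = 0)}"
    proof clarify
      fix v i assume v: "v \<in> V"
      then obtain k where k: "m * v i = of_int k" unfolding V_def by (auto elim: Ints_cases)
      have "0 \<le> v i" "v i \<le> 1" using v by (auto simp: V_def standard_simplex_def)
      then have "0 \<le> m * v i" "m * v i \<le> m" using m by (auto simp: mult_left_le)
      then have "k \<in> {0..int m}" using k by simp
      moreover have "v i = of_int k / m" using k m by (simp add: field_simps)
      moreover have "i \<notin> {..N} \<Longrightarrow> v i = 0" using v by (auto simp: V_def standard_simplex_def)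
      ultimately show "(i \<in> {..N} \<longrightarrow> v i \<in> (\<lambda>k. real_of_int k / m) ` {0..int m}) \<and> (i \<notin> {..N} \<longrightarrow> v i = 0)"
        by blast
    qed
  qed (intro finite_set_of_finite_funs; simp)
  have set_eq: "{t \<in> {0..<1}. grid_vertex m x t = v} = {lo v x..<hi v x}"
    if x: "x \<in> standard_simplex N" and v: "v \<in> V" for x v :: "nat \<Rightarrow> real"
  proof -
    have int: "\<exists>k. scaled_sum m v i = of_int k" for i
    proof (induction i)
      case (Suc i)
      obtain k where "m * v i = of_int k" using v unfolding V_def by (auto elim: Ints_cases)
      then show ?case using Suc by (auto simp: scaled_sum_Suc) (metis of_int_add)
    qed (auto intro: exI[of _ 0])
    have "t \<in> {lo v x..<hi v x} \<longleftrightarrow> t \<in> {0..<1} \<and> grid_vertex m x t = v" for t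
    proof -
      have "t \<in> {lo v x..<hi v x} \<longleftrightarrow> (\<forall>i\<le>Suc N. scaled_sum m v i - scaled_sum m x i \<le> t \<and> t < scaled_sum m v i + 1 - scaled_sum m x i)"
        by (auto simp: lo_def hi_def)
      also have "\<dots> \<longleftrightarrow> (\<forall>i\<le>Suc N. scaled_sum m v i = of_int \<lfloor>scaled_sum m x i + t\<rfloor>)"
      proof (intro all_cong)
        fix i
        obtain k where k: "scaled_sum m v i = of_int k" using int by blast
        show "(scaled_sum m v i - scaled_sum m x i \<le> t \<and> t < scaled_sum m v i + 1 - scaled_sum m x i) =
            (scaled_sum m v i = of_int \<lfloor>scaled_sum m x i + t\<rfloor>)"
          unfolding k of_int_eq_iff by (subst eq_commute, subst floor_eq_iff) auto
      qed
      also have "\<dots> \<longleftrightarrow> t \<in> {0..<1} \<and> grid_vertex m x t = v"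
      proof
        assume *: "\<forall>i\<le>Suc N. scaled_sum m v i = of_int \<lfloor>scaled_sum m x i + t\<rfloor>"
        from *[rule_format, of 0] have "\<lfloor>t\<rfloor> = 0" by simp
        then have "t \<in> {0..<1}" by (simp add: floor_eq_iff)
        moreover have "grid_vertex m x t = v"
        proof
          fix i
          show "grid_vertex m x t i = v i"
          proof (cases "i \<le> N")
            case True
            have "m * v i = scaled_sum m v (Suc i) - scaled_sum m v i" by (simp add: scaled_sum_Suc)
            also have "\<dots> = of_int \<lfloor>scaled_sum m x (Suc i) + t\<rfloor> - of_int \<lfloor>scaled_sum m x i + t\<rfloor>"
              using * True by simp
            finally show ?thesis using m by (simp add: grid_vertex_def field_simps)
          next
            case False
            then have "x i = 0" "v i = 0" using x v by (auto simp: V_def standard_simplex_def)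
            then show ?thesis by (simp add: grid_vertex_eq_0)
          qed
        qed
        ultimately show "t \<in> {0..<1} \<and> grid_vertex m x t = v" ..
      next
        assume "t \<in> {0..<1} \<and> grid_vertex m x t = v"
        then show "\<forall>i\<le>Suc N. scaled_sum m v i = of_int \<lfloor>scaled_sum m x i + t\<rfloor>"
          using scaled_sum_grid_vertex[OF m, of t x] by auto
      qed
      finally show ?thesis .
    qed
    then show ?thesis by blast
  qed
  have l_measure: "l v x = measure lborel {t \<in> {0..<1}. grid_vertex m x t = v}"
    if x: "x \<in> standard_simplex N" and v: "v \<in> V" for x v
    unfolding set_eq[OF that] l_def by (cases "lo v x \<le> hi v x") auto
  have l_pos: "\<exists>t\<in>{0..<1}. grid_vertex m x t = v" if "x \<in> standard_simplex N" "v \<in> V" "0 < l v x" for x v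
    using set_eq[OF that(1,2)] that(3) by (auto simp: l_def max_def split: if_splits)
      (metis (mono_tags, lifting) atLeastLessThan_iff mem_Collect_eq order_refl)
  have inV: "grid_vertex m x t \<in> V" if "x \<in> standard_simplex N" "t \<in> {0..<1}" for x t
    unfolding V_def using that m by (auto simp: grid_vertex_in_simplex) (simp add: grid_vertex_def)
  show thesis
  proof
    show "finite V" by (rule finV)
    show "V \<subseteq> standard_simplex N" by (auto simp: V_def)
    show "continuous_on (standard_simplex N) (l v)" if "v \<in> V" for v
      unfolding l_def lo_def hi_def scaled_sum_def
      by (intro continuous_on_max continuous_on_diff continuous_on_Max_image continuous_on_Min_image continuous_intros
          continuous_on_subset[OF continuous_on_product_coordinates]) auto
    show "0 \<le> l v x" for v x by (simp add: l_def)
    show "(\<Sum>v\<in>V. l v x) = 1" if x: "x \<in> standard_simplex N" for x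
    proof -
      have "(\<Sum>v\<in>V. l v x) = (\<Sum>v\<in>V. measure lborel {t \<in> {0..<1}. grid_vertex m x t = v})"
        using l_measure[OF x] by (intro sum.cong) auto
      also have "\<dots> = measure lborel (\<Union>v\<in>V. {t \<in> {0..<1}. grid_vertex m x t = v})"
      proof (rule measure_finite_Union[symmetric, OF finV])
        show "(\<lambda>v. {t \<in> {0..<1}. grid_vertex m x t = v}) ` V \<subseteq> sets lborel"
          using set_eq[OF x] by auto
        show "disjoint_family_on (\<lambda>v. {t \<in> {0..<1}. grid_vertex m x t = v}) V"
          by (auto simp: disjoint_family_on_def)
        show "emeasure lborel {t \<in> {0..<1}. grid_vertex m x t = v} \<noteq> \<infinity>" if "v \<in> V" for v
          unfolding set_eq[OF x that] by (cases "lo v x \<le> hi v x") auto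
      qed
      also have "(\<Union>v\<in>V. {t \<in> {0..<1}. grid_vertex m x t = v}) = {0..<1}"
        using inV[OF x] by auto
      finally show ?thesis by simp
    qed
    show "v i = 0" if "v \<in> V" "x \<in> standard_simplex N" "0 < l v x" "x i = 0" for v x i
      using l_pos[OF that(2,1,3)] grid_vertex_eq_0[of x i m] that(4) by auto
    show "\<bar>v i - x i\<bar> < 1 / m" if "v \<in> V" "x \<in> standard_simplex N" "0 < l v x" for v x i
      using l_pos[OF that(2,1,3)] grid_vertex_near[OF m, of x] by auto
    show "card {v\<in>V. 0 < l v x} \<le> card {i. x i \<noteq> 0}" if x: "x \<in> standard_simplex N" for x
    proof -
      have "{v\<in>V. 0 < l v x} \<subseteq> grid_vertex m x ` {0..<1}" using l_pos[OF x] by auto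
      then show ?thesis using card_grid_vertices[OF x m] by (meson card_mono order_trans)
    qed
  qed
qed

section \<open>Maps in general position\<close>

text \<open>The metric on functions weights the coordinates by powers of \<open>1/2\<close>, and the
  weights sum to \<open>2\<close>.\<close>

lemma dist_fun_le:
  fixes x y :: "nat \<Rightarrow> real"
  assumes "\<And>i. \<bar>x i - y i\<bar> \<le> e"
  shows "dist x y \<le> 2 * e"
proof -
  have e: "0 \<le> e" using assms[of 0] by linarith
  have g: "(\<lambda>n. e * (1/2)^n) sums (e * 2)"
    using sums_mult[OF geometric_sums[of "1/2::real"], of e] by simp
  have le: "(1/2)^n * min (dist (x (from_nat n)) (y (from_nat n))) 1 \<le> e * (1/2)^n" for n
    using assms[of "from_nat n"] by (simp add: dist_real_def mult.commute min_le_iff_disj)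
  have "summable (\<lambda>n. (1/2)^n * min (dist (x (from_nat n)) (y (from_nat n))) 1)"
    by (rule summable_comparison_test'[OF sums_summable[OF g], of 0]) (use le e in simp)
  from suminf_le[OF le this sums_summable[OF g]] show ?thesis
    unfolding dist_fun_def using g by (simp add: sums_iff mult.commute)
qed

section \<open>Compactness of faces and skeleta, and supports of points\<close>

lemma compact_standard_simplex: "compact (standard_simplex N)"
  using compactin_standard_simplex[of N] by (simp add: euclidean_product_topology)

lemma closed_face_real: "closed (face_real N \<sigma>)"
proof -
  have "face_real N \<sigma> = standard_simplex N \<inter> (\<Inter>i\<in>-\<sigma>. (\<lambda>x. x i) -` {0})"
    by (auto simp: face_real_def)
  moreover have "closed (standard_simplex N)" using closedin_standard_simplex[of N] by (simp add: euclidean_product_topology)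
  moreover have "closed ((\<lambda>x::nat\<Rightarrow>real. x i) -` {0})" for i
    by (intro closed_vimage continuous_on_product_coordinates closed_singleton)
  ultimately show ?thesis by (simp add: closed_INT closed_Int)
qed

lemma face_real_subset: "face_real N \<sigma> \<subseteq> standard_simplex N"
  by (auto simp: face_real_def)

lemma compact_face_real: "compact (face_real N \<sigma>)"
  using compact_Int_closed[OF compact_standard_simplex closed_face_real] face_real_subset
  by (metis inf.absorb2)

lemma finite_skeleton_faces: "finite (skeleton_faces N k)"
  by (rule finite_subset[of _ "Pow {..N}"]) (auto simp: skeleton_faces_def)

lemma compact_skeleton: "compact (skeleton N k)"
  unfolding skeleton_def by (intro compact_UN finite_skeleton_faces compact_face_real)

lemma skeleton_subset: "skeleton N k \<subseteq> standard_simplex N"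
  using face_real_subset by (auto simp: skeleton_def)

definition support :: "(nat \<Rightarrow> real) \<Rightarrow> nat set" where "support x = {i. x i \<noteq> 0}"

lemma support_simplex:
  assumes "x \<in> standard_simplex N"
  shows "support x \<subseteq> {..N}" "finite (support x)" "support x \<noteq> {}"
proof -
  show "support x \<subseteq> {..N}" using assms by (auto simp: support_def standard_simplex_def) (meson not_le)
  then show "finite (support x)" by (rule finite_subset) simp
  show "support x \<noteq> {}"
  proof
    assume "support x = {}"
    then have "x i = 0" for i by (auto simp: support_def)
    then show False using assms by (simp add: standard_simplex_def)
  qed
qed

lemma face_real_iff: "x \<in> face_real N \<sigma> \<longleftrightarrow> x \<in> standard_simplex N \<and> support x \<subseteq> \<sigma>"
  by (auto simp: face_real_def support_def)

lemma skeleton_iff: "x \<in> skeleton N k \<longleftrightarrow> x \<in> standard_simplex N \<and> card (support x) \<le> k + 1"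
proof
  assume "x \<in> skeleton N k"
  then obtain \<sigma> where "\<sigma> \<in> skeleton_faces N k" "x \<in> face_real N \<sigma>" by (auto simp: skeleton_def)
  then have "x \<in> standard_simplex N" "support x \<subseteq> \<sigma>" "card \<sigma> \<le> k + 1" "finite \<sigma>"
    by (auto simp: face_real_iff skeleton_faces_def intro: finite_subset)
  then show "x \<in> standard_simplex N \<and> card (support x) \<le> k + 1" by (meson card_mono order_trans)
next
  assume *: "x \<in> standard_simplex N \<and> card (support x) \<le> k + 1"
  then have "support x \<in> skeleton_faces N k" "x \<in> face_real N (support x)"
    using support_simplex[of x N] by (auto simp: skeleton_faces_def face_real_iff)
  then show "x \<in> skeleton N k" by (auto simp: skeleton_def)
qed

text \<open>\<open>f'\<close> is piecewise linear on a fine triangulation whose vertices have images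
  in general position. Disjoint faces use disjoint sets of these vertices, and each point of a face
  \<open>\<tau>\<close> is carried by at most \<open>card \<tau>\<close> of them. A common value of
  several faces thus lies in an intersection of flats to which the codimension bound
  applies.\<close>

lemma general_position_approximation:
  fixes f :: "(nat \<Rightarrow> real) \<Rightarrow> 'a::euclidean_space"
  assumes f: "continuous_on (skeleton N k) f" and \<epsilon>: "\<epsilon> > 0"
  obtains f' :: "(nat \<Rightarrow> real) \<Rightarrow> 'a" where "continuous_on (standard_simplex N) f'"
    "\<And>x. x \<in> skeleton N k \<Longrightarrow> dist (f' x) (f x) < \<epsilon>"
    "\<And>\<T>. \<T> \<subseteq> skeleton_faces N DIM('a) \<Longrightarrow> pairwise disjnt \<T> \<Longrightarrow>
       (\<Sum>\<tau>\<in>\<T>. DIM('a) + 1 - card \<tau>) > DIM('a) \<Longrightarrow> (\<Inter>\<tau>\<in>\<T>. f' ` face_real N \<tau>) = {}"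
    "\<And>\<T>. \<T> \<subseteq> skeleton_faces N DIM('a) \<Longrightarrow> pairwise disjnt \<T> \<Longrightarrow>
       (\<Sum>\<tau>\<in>\<T>. DIM('a) + 1 - card \<tau>) = DIM('a) \<Longrightarrow> finite (\<Inter>\<tau>\<in>\<T>. f' ` face_real N \<tau>)"
proof -
  obtain \<eta> where \<eta>: "\<eta> > 0" "\<And>x y. x \<in> skeleton N k \<Longrightarrow> y \<in> skeleton N k \<Longrightarrow> dist y x < \<eta> \<Longrightarrow> dist (f y) (f x) < \<epsilon> / 2"
    using compact_uniformly_continuous[OF f compact_skeleton] \<epsilon>
    unfolding uniformly_continuous_on_def by (metis half_gt_zero)
  \<comment> \<open>The factor \<open>2\<close> is the one lost in \<open>dist_fun_le\<close> when
    coordinates differ by at most \<open>1 / m\<close>.\<close>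
  obtain m :: nat where m: "m > 0" "2 / m < \<eta>"
  proof -
    obtain n where "inverse (of_nat (Suc n)) < \<eta> / 2" using reals_Archimedean[of "\<eta>/2"] \<eta> by auto
    then show ?thesis by (intro that[of "Suc n"]) (simp_all add: field_simps)
  qed
  obtain V :: "(nat \<Rightarrow> real) set" and l :: "(nat \<Rightarrow> real) \<Rightarrow> (nat \<Rightarrow> real) \<Rightarrow> real"
    where V: "finite V" "V \<subseteq> standard_simplex N"
    and cl: "\<And>v. v \<in> V \<Longrightarrow> continuous_on (standard_simplex N) (l v)"
    and l0: "\<And>v x. 0 \<le> l v x"
    and l1: "\<And>x. x \<in> standard_simplex N \<Longrightarrow> (\<Sum>v\<in>V. l v x) = 1"
    and lz: "\<And>v x i. v \<in> V \<Longrightarrow> x \<in> standard_simplex N \<Longrightarrow> 0 < l v x \<Longrightarrow> x i = 0 \<Longrightarrow> v i = 0"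
    and lm: "\<And>v x i. v \<in> V \<Longrightarrow> x \<in> standard_simplex N \<Longrightarrow> 0 < l v x \<Longrightarrow> \<bar>v i - x i\<bar> < 1 / m"
    and lc: "\<And>x. x \<in> standard_simplex N \<Longrightarrow> card {v\<in>V. 0 < l v x} \<le> card {i. x i \<noteq> 0}"
    by (rule fine_partition_of_unity[OF m(1), where N = N]) (rule that)
  \<comment> \<open>Outside the skeleton nothing is known about \<open>f v\<close>. The estimate on
    the skeleton is not affected, because the support of a vertex carrying \<open>x\<close> is
    contained in that of \<open>x\<close>.\<close>
  obtain w :: "(nat \<Rightarrow> real) \<Rightarrow> 'a" where w: "general_position V w" "\<And>v. v \<in> V \<Longrightarrow> dist (w v) (f v) < \<epsilon> / 2"
    using general_position_near[OF V(1), of "\<epsilon>/2" f] \<epsilon> by auto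
  define f' where "f' x = (\<Sum>v\<in>V. l v x *\<^sub>R w v)" for x
  define J where "J x = {v\<in>V. 0 < l v x}" for x
  have Jface: "J x \<subseteq> V \<inter> face_real N \<tau>" if "x \<in> face_real N \<tau>" for x \<tau>
    using that lz V(2) by (fastforce simp: J_def face_real_def)
  have f'J: "f' x = (\<Sum>v\<in>J x. l v x *\<^sub>R w v)" for x
    unfolding f'_def J_def using V(1) l0 by (intro sum.mono_neutral_right) (auto simp: less_le dest: sym)
  have sumJ: "(\<Sum>v\<in>J x. l v x) = 1" if "x \<in> standard_simplex N" for x
    unfolding l1[OF that, symmetric] J_def using V(1) l0
    by (intro sum.mono_neutral_left) (auto simp: less_le dest: sym)
  have finJ: "finite (J x)" for x using V by (simp add: J_def)
  have hull: "f' x \<in> affine hull (w ` J x)" if x: "x \<in> standard_simplex N" for x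
  proof -
    have "f' x \<in> convex hull (w ` J x)"
      unfolding f'J using finJ sumJ[OF x] l0 by (intro convex_sum) (auto intro: hull_inc)
    then show ?thesis using convex_hull_subset_affine_hull by blast
  qed
  have close: "dist (f' x) (f x) < \<epsilon>" if x: "x \<in> skeleton N k" for x
  proof -
    have xs: "x \<in> standard_simplex N" using x skeleton_subset by blast
    have "dist (w v) (f x) < \<epsilon>" if v: "v \<in> J x" for v
    proof -
      have vV: "v \<in> V" and lv: "0 < l v x" using v by (auto simp: J_def)
      have "support v \<subseteq> support x" using lz[OF vV xs lv] by (auto simp: support_def)
      then have "card (support v) \<le> card (support x)" by (rule card_mono[OF support_simplex(2)[OF xs]])
      moreover have "v \<in> standard_simplex N" using V(2) vV by (rule subsetD)
      ultimately have "v \<in> skeleton N k"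
        using x unfolding skeleton_iff by linarith
      moreover have "dist v x \<le> 2 * (1 / m)"
        using lm[OF vV xs lv] by (intro dist_fun_le) (simp add: less_imp_le)
      ultimately have "dist (f v) (f x) < \<epsilon> / 2" using \<eta>(2)[OF x] m by simp
      then show ?thesis using w(2)[OF vV] dist_triangle_less_add by (metis dist_triangle_half_l dist_commute)
    qed
    then have "w ` J x \<subseteq> ball (f x) \<epsilon>" by (auto simp: dist_commute)
    moreover have "f' x \<in> convex hull (w ` J x)"
      unfolding f'J using finJ sumJ[OF xs] l0 by (intro convex_sum) (auto intro: hull_inc)
    ultimately have "f' x \<in> ball (f x) \<epsilon>" by (meson convex_ball hull_minimal subsetD)
    then show ?thesis by (simp add: dist_commute)
  qed
  have key: "\<exists>\<I>. \<I> \<subseteq> Pow V \<and> p \<in> (\<Inter>I\<in>\<I>. affine hull (w ` I)) \<and>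
      aff_dim (\<Inter>I\<in>\<I>. affine hull (w ` I)) \<le> max (-1) (int DIM('a) - int (\<Sum>\<tau>\<in>\<T>. DIM('a) + 1 - card \<tau>))"
    if \<T>: "\<T> \<subseteq> skeleton_faces N DIM('a)" "pairwise disjnt \<T>" and p: "p \<in> (\<Inter>\<tau>\<in>\<T>. f' ` face_real N \<tau>)" for \<T> p
  proof -
    have "\<forall>\<tau>\<in>\<T>. \<exists>x. x \<in> face_real N \<tau> \<and> f' x = p" using p by blast
    then obtain x where x: "\<And>\<tau>. \<tau> \<in> \<T> \<Longrightarrow> x \<tau> \<in> face_real N \<tau>" "\<And>\<tau>. \<tau> \<in> \<T> \<Longrightarrow> f' (x \<tau>) = p"
      by metis
    have fin: "finite \<T>" using \<T>(1) finite_skeleton_faces finite_subset by blast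
    have xs: "x \<tau> \<in> standard_simplex N" if "\<tau> \<in> \<T>" for \<tau> using x(1)[OF that] by (simp add: face_real_iff)
    define I where "I \<tau> = J (x \<tau>)" for \<tau>
    have Ine: "I \<tau> \<noteq> {}" if "\<tau> \<in> \<T>" for \<tau> using sumJ[OF xs[OF that]] by (auto simp: I_def)
    have Icard: "card (I \<tau>) \<le> card \<tau>" if "\<tau> \<in> \<T>" for \<tau>
    proof -
      have "finite \<tau>" using \<T>(1) that by (auto simp: skeleton_faces_def intro: finite_subset)
      moreover have "support (x \<tau>) \<subseteq> \<tau>" using x(1)[OF that] by (simp add: face_real_iff)
      ultimately show ?thesis
        using lc[OF xs[OF that]] card_mono[of \<tau> "support (x \<tau>)"] unfolding I_def J_def support_def by linarith
    qed
    have cd: "card \<tau> \<le> DIM('a) + 1" if "\<tau> \<in> \<T>" for \<tau> using \<T>(1) that by (auto simp: skeleton_faces_def)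
    have disj: "disjnt (I \<tau>) (I \<tau>')" if "\<tau> \<in> \<T>" "\<tau>' \<in> \<T>" "\<tau> \<noteq> \<tau>'" for \<tau> \<tau>'
    proof -
      have "\<tau> \<inter> \<tau>' = {}" using \<T>(2) that by (auto simp: pairwise_def disjnt_def)
      then have "face_real N \<tau> \<inter> face_real N \<tau>' = {}"
        using support_simplex(3) by (fastforce simp: face_real_iff)
      then show ?thesis using Jface[OF x(1)[OF that(1)]] Jface[OF x(1)[OF that(2)]]
        unfolding I_def disjnt_def by blast
    qed
    have inj: "inj_on I \<T>"
    proof (rule inj_onI, rule ccontr)
      fix \<tau> \<tau>' assume *: "\<tau> \<in> \<T>" "\<tau>' \<in> \<T>" "I \<tau> = I \<tau>'" "\<tau> \<noteq> \<tau>'"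
      then show False using disj[OF *(1,2,4)] Ine[OF *(1)] by (simp add: disjnt_def)
    qed
    have "aff_dim (\<Inter>S\<in>I ` \<T>. affine hull (w ` S)) \<le>
         max (-1) (int DIM('a) - (\<Sum>S\<in>I ` \<T>. int DIM('a) + 1 - int (card S)))"
    proof (rule w(1)[unfolded general_position_def, rule_format])
      show "I ` \<T> \<subseteq> Pow V" by (auto simp: I_def J_def)
      show "pairwise disjnt (I ` \<T>)" using disj by (auto simp: pairwise_def)
      show "{} \<notin> I ` \<T>" using Ine by auto
      show "card S \<le> DIM('a) + 1" if "S \<in> I ` \<T>" for S using that Icard cd by (auto intro: order_trans)
    qed
    \<comment> \<open>A carrier with fewer than \<open>card \<tau>\<close> vertices only raises the
      codimension, and \<open>card \<tau> \<le> DIM('a) + 1\<close> keeps the truncated subtraction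
      exact.\<close>
    moreover have "int (\<Sum>\<tau>\<in>\<T>. DIM('a) + 1 - card \<tau>) \<le> (\<Sum>S\<in>I ` \<T>. int DIM('a) + 1 - int (card S))"
      unfolding sum.reindex[OF inj] o_def of_nat_sum
    proof (rule sum_mono)
      fix \<tau> assume "\<tau> \<in> \<T>"
      then show "int (DIM('a) + 1 - card \<tau>) \<le> int DIM('a) + 1 - int (card (I \<tau>))"
        using Icard[of \<tau>] cd[of \<tau>] by (simp add: of_nat_diff)
    qed
    ultimately have "aff_dim (\<Inter>S\<in>I ` \<T>. affine hull (w ` S)) \<le> max (-1) (int DIM('a) - int (\<Sum>\<tau>\<in>\<T>. DIM('a) + 1 - card \<tau>))"
      by linarith
    moreover have "p \<in> (\<Inter>S\<in>I ` \<T>. affine hull (w ` S))"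
      using hull[OF xs] x(2) unfolding I_def by fastforce
    moreover have "I ` \<T> \<subseteq> Pow V" by (auto simp: I_def J_def)
    ultimately show ?thesis by blast
  qed
  show thesis
  proof
    show "continuous_on (standard_simplex N) f'"
      unfolding f'_def using cl by (intro continuous_intros) auto
    show "dist (f' x) (f x) < \<epsilon>" if "x \<in> skeleton N k" for x using close[OF that] .
    fix \<T> assume \<T>: "\<T> \<subseteq> skeleton_faces N DIM('a)" "pairwise disjnt \<T>"
    show "(\<Inter>\<tau>\<in>\<T>. f' ` face_real N \<tau>) = {}" if "(\<Sum>\<tau>\<in>\<T>. DIM('a) + 1 - card \<tau>) > DIM('a)"
    proof (rule ccontr)
      assume "(\<Inter>\<tau>\<in>\<T>. f' ` face_real N \<tau>) \<noteq> {}"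
      then obtain p where p: "p \<in> (\<Inter>\<tau>\<in>\<T>. f' ` face_real N \<tau>)" by blast
      from key[OF \<T> p] obtain \<I> where \<I>: "p \<in> (\<Inter>I\<in>\<I>. affine hull (w ` I))"
        "aff_dim (\<Inter>I\<in>\<I>. affine hull (w ` I)) \<le> max (-1) (int DIM('a) - int (\<Sum>\<tau>\<in>\<T>. DIM('a) + 1 - card \<tau>))"
        by (elim exE conjE) (rule that)
      then have "aff_dim (\<Inter>I\<in>\<I>. affine hull (w ` I)) < 0" using that by linarith
      then show False using \<I>(1) by (simp only: aff_dim_negative_iff empty_iff)
    qed
    show "finite (\<Inter>\<tau>\<in>\<T>. f' ` face_real N \<tau>)" if "(\<Sum>\<tau>\<in>\<T>. DIM('a) + 1 - card \<tau>) = DIM('a)"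
    proof -
      let ?G = "\<lambda>\<I>. \<Inter>I\<in>\<I>. affine hull (w ` I)"
      \<comment> \<open>Different common values may come from different carriers. All carriers are
        subsets of the finite set \<open>V\<close>, so only finitely many flats arise, each of them
        at most a point.\<close>
      define \<G> where "\<G> = {?G \<I> |\<I>. \<I> \<subseteq> Pow V \<and> aff_dim (?G \<I>) \<le> 0}"
      have sub: "(\<Inter>\<tau>\<in>\<T>. f' ` face_real N \<tau>) \<subseteq> \<Union>\<G>"
      proof
        fix p assume "p \<in> (\<Inter>\<tau>\<in>\<T>. f' ` face_real N \<tau>)"
        from key[OF \<T> this] obtain \<I> where \<I>: "\<I> \<subseteq> Pow V" "p \<in> ?G \<I>"
          "aff_dim (?G \<I>) \<le> max (-1) (int DIM('a) - int (\<Sum>\<tau>\<in>\<T>. DIM('a) + 1 - card \<tau>))" by (elim exE conjE) (rule that)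
        then have "aff_dim (?G \<I>) \<le> 0" using that by linarith
        then show "p \<in> \<Union>\<G>" unfolding \<G>_def using \<I>(1,2) by blast
      qed
      have "finite (Pow (Pow V))" using V(1) by simp
      then have "finite \<G>"
        unfolding \<G>_def by (rule finite_surj[of _ _ ?G]) auto
      moreover have "finite S" if "S \<in> \<G>" for S
      proof -
        have "aff_dim S \<le> 0" using that unfolding \<G>_def by blast
        then have "aff_dim S < 0 \<or> aff_dim S = 0" by linarith
        then show ?thesis by (auto simp: aff_dim_eq_0)
      qed
      ultimately have "finite (\<Union>\<G>)" by (rule finite_Union)
      then show ?thesis using sub by (rule finite_subset[rotated])
    qed
  qed
qed

section \<open>Winding numbers and extensions over a face\<close>

lemma face_boundary_iff: "x \<in> face_boundary N \<sigma> \<longleftrightarrow> x \<in> standard_simplex N \<and> support x \<subset> \<sigma>"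
proof
  assume "x \<in> face_boundary N \<sigma>"
  then obtain \<tau> where "\<tau> \<subset> \<sigma>" "x \<in> face_real N \<tau>"
    unfolding face_boundary_def by (elim UN_E CollectE conjE) (rule that)
  then show "x \<in> standard_simplex N \<and> support x \<subset> \<sigma>" by (auto simp: face_real_iff)
next
  assume x: "x \<in> standard_simplex N \<and> support x \<subset> \<sigma>"
  then have "support x \<noteq> {}" "x \<in> face_real N (support x)" using support_simplex(3)[of x N] by (auto simp: face_real_iff)
  then show "x \<in> face_boundary N \<sigma>"
    unfolding face_boundary_def by (intro UN_I[of "support x"] CollectI) (use x in simp_all)
qed

lemma face_boundary_subset: "face_boundary N \<sigma> \<subseteq> face_real N \<sigma>"
  by (auto simp: face_boundary_iff face_real_iff)

lemma compact_face_boundary: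
  assumes "finite \<sigma>"
  shows "compact (face_boundary N \<sigma>)"
proof -
  have "finite {\<tau>. \<tau> \<noteq> {} \<and> \<tau> \<subset> \<sigma>}"
    using assms by (rule finite_subset[rotated, OF finite_Pow_iff[THEN iffD2]]) auto
  then show ?thesis unfolding face_boundary_def by (intro compact_UN ballI compact_face_real)
qed

lemma face_boundary_nonempty:
  assumes "\<sigma> \<subseteq> {..N}" "card \<sigma> \<ge> 2"
  shows "face_boundary N \<sigma> \<noteq> {}"
proof -
  have "\<sigma> \<noteq> {}" using assms(2) by auto
  then obtain i where i: "i \<in> \<sigma>" by blast
  let ?x = "\<lambda>j. if j = i then 1 else 0 :: real"
  have "support ?x = {i}" by (auto simp: support_def)
  moreover have "{i} \<noteq> \<sigma>" using assms(2) by auto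
  ultimately have "?x \<in> face_boundary N \<sigma>" using i assms(1) unfolding face_boundary_iff by auto
  then show ?thesis by blast
qed

lemma face_boundary_subset_skeleton:
  assumes "\<sigma> \<subseteq> {..N}" "card \<sigma> \<le> k + 2"
  shows "face_boundary N \<sigma> \<subseteq> skeleton N k"
proof
  fix x assume x: "x \<in> face_boundary N \<sigma>"
  have "finite \<sigma>" using assms(1) by (rule finite_subset) simp
  then have "card (support x) < card \<sigma>" using x psubset_card_mono[of \<sigma> "support x"] by (simp add: face_boundary_iff)
  then show "x \<in> skeleton N k" using x assms(2) by (simp add: face_boundary_iff skeleton_iff)
qed

text \<open>Forgetting one barycentric coordinate is injective, as the coordinates sum to one. The
  chart is there because the extension theorems concern subsets of a Euclidean space of the same
  dimension as the target.\<close>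

lemma face_chart:
  assumes \<sigma>: "\<sigma> \<subseteq> {..N}" "card \<sigma> = CARD('n) + 1"
  obtains D :: "(real ^ 'n) set" and \<psi> \<psi>' where "homeomorphism (face_real N \<sigma>) D \<psi> \<psi>'"
proof -
  have fin: "finite \<sigma>" using \<sigma>(1) by (rule finite_subset) simp
  have "\<sigma> \<noteq> {}" using \<sigma>(2) by auto
  then obtain v0 where v0: "v0 \<in> \<sigma>" by blast
  have "card (\<sigma> - {v0}) = CARD('n)" using v0 \<sigma>(2) fin by simp
  then obtain \<beta> :: "'n \<Rightarrow> nat" where \<beta>: "bij_betw \<beta> UNIV (\<sigma> - {v0})"
    using finite_same_card_bij[of "UNIV :: 'n set" "\<sigma> - {v0}"] fin by auto
  define \<psi> :: "(nat \<Rightarrow> real) \<Rightarrow> real ^ 'n" where "\<psi> x = (\<chi> i. x (\<beta> i))" for x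
  have cont: "continuous_on (face_real N \<sigma>) \<psi>"
    unfolding \<psi>_def by (intro continuous_intros continuous_on_subset[OF continuous_on_product_coordinates]) auto
  have inj: "inj_on \<psi> (face_real N \<sigma>)"
  proof (rule inj_onI)
    fix x y assume x: "x \<in> face_real N \<sigma>" and y: "y \<in> face_real N \<sigma>" and eq: "\<psi> x = \<psi> y"
    have 1: "x j = y j" if "j \<in> \<sigma> - {v0}" for j
    proof -
      obtain i where "j = \<beta> i" using \<beta> \<open>j \<in> \<sigma> - {v0}\<close> by (auto simp: bij_betw_def)
      then show ?thesis using eq by (simp add: \<psi>_def vec_eq_iff)
    qed
    have sum: "(\<Sum>j\<in>\<sigma>. z j) = 1" if "z \<in> face_real N \<sigma>" for z
    proof -
      have "(\<Sum>j\<in>\<sigma>. z j) = (\<Sum>j\<le>N. z j)"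
        using that \<sigma>(1) by (intro sum.mono_neutral_left) (auto simp: face_real_def)
      then show ?thesis using that by (simp add: face_real_def standard_simplex_def)
    qed
    have "x v0 + (\<Sum>j\<in>\<sigma> - {v0}. x j) = y v0 + (\<Sum>j\<in>\<sigma> - {v0}. y j)"
      using sum[OF x] sum[OF y] by (simp add: sum.remove[OF fin v0])
    moreover have "(\<Sum>j\<in>\<sigma> - {v0}. x j) = (\<Sum>j\<in>\<sigma> - {v0}. y j)" using 1 by (rule sum.cong[OF refl])
    ultimately have "x v0 = y v0" by simp
    show "x = y"
    proof
      fix j
      show "x j = y j"
        using 1[of j] \<open>x v0 = y v0\<close> x y by (cases "j \<in> \<sigma> - {v0}"; cases "j = v0") (simp_all add: face_real_def)
    qed
  qed
  obtain \<psi>' where "homeomorphism (face_real N \<sigma>) (\<psi> ` face_real N \<sigma>) \<psi> \<psi>'"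
    using homeomorphism_compact[OF compact_face_real cont refl inj] by blast
  then show thesis by (rule that)
qed

text \<open>The constant map at \<open>g b\<close> fills the face and misses \<open>p\<close>. The
  null-homotopy, regarded as a free one, joins it to \<open>g\<close> on the boundary, and homotopy
  extension carries the filling along.\<close>

lemma winding_zero_extends:
  fixes g :: "(nat \<Rightarrow> real) \<Rightarrow> real ^ 'n"
  assumes \<sigma>: "\<sigma> \<subseteq> {..N}" "card \<sigma> = CARD('n) + 1" and n: "CARD('n) \<ge> 2"
    and p: "p \<notin> W_nonzero (face_boundary N \<sigma>) g"
  obtains G where "continuous_on (face_real N \<sigma>) G" "\<And>x. x \<in> face_boundary N \<sigma> \<Longrightarrow> G x = g x"
    "p \<notin> G ` face_real N \<sigma>"
proof -
  let ?B = "face_boundary N \<sigma>" and ?F = "face_real N \<sigma>"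
  have fin: "finite \<sigma>" using \<sigma>(1) by (rule finite_subset) simp
  obtain D :: "(real ^ 'n) set" and \<psi> \<psi>' where h: "homeomorphism ?F D \<psi> \<psi>'" using face_chart[OF \<sigma>] .
  have pg: "p \<notin> g ` ?B" and "\<not> winding_nonzero ?B g p" using p by (auto simp: W_nonzero_def)
  then have "\<exists>b\<in>?B. homotopic_with_canon (\<lambda>h. h b = g b) ?B (- {p}) g (\<lambda>_. g b)"
    using n unfolding winding_nonzero_def by simp
  then obtain b where b: "b \<in> ?B" "homotopic_with_canon (\<lambda>h. h b = g b) ?B (- {p}) g (\<lambda>_. g b)"
    by (elim bexE) (rule that)
  have hom: "homotopic_with_canon (\<lambda>_. True) ?B (- {p}) g (\<lambda>_. g b)"
    by (rule homotopic_with_mono[OF b(2)]) simp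
  define S where "S = \<psi> ` ?B"
  have cont: "continuous_on ?F \<psi>" "continuous_on D \<psi>'" using h by (simp_all add: homeomorphism_def)
  have BF: "?B \<subseteq> ?F" by (rule face_boundary_subset)
  have SD: "S \<subseteq> D" using image_mono[OF BF, of \<psi>] h by (simp add: S_def homeomorphism_def)
  have inv: "\<psi>' (\<psi> x) = x" if "x \<in> ?F" for x using h that by (simp add: homeomorphism_def)
  have "compact S" unfolding S_def
    by (rule compact_continuous_image[OF continuous_on_subset[OF cont(1) BF] compact_face_boundary[OF fin]])
  then have clS: "closedin (top_of_set D) S" using SD by (simp add: closed_subset compact_imp_closed)
  have "homotopic_with_canon (\<lambda>_. True) S (- {p}) (g \<circ> \<psi>') ((\<lambda>_. g b) \<circ> \<psi>')"
  proof (rule homotopic_with_compose_continuous_map_right[OF hom])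
    show "continuous_map (top_of_set S) (top_of_set ?B) \<psi>'"
      using continuous_on_subset[OF cont(2) SD] inv BF by (auto simp: S_def)
  qed simp
  then have hom': "homotopic_with_canon (\<lambda>_. True) S (- {p}) (\<lambda>_. g b) (g \<circ> \<psi>')"
    unfolding o_def by (rule homotopic_with_symD)
  have anr: "ANR (- {p})" by (simp add: open_imp_ANR open_Compl)
  have gb: "(\<lambda>_. g b) \<in> D \<rightarrow> - {p}" using pg b(1) by auto
  obtain G' where G': "continuous_on D G'" "G' ` D \<subseteq> - {p}" "\<And>x. x \<in> S \<Longrightarrow> G' x = (g \<circ> \<psi>') x"
    by (rule Borsuk_homotopy_extension_homotopic[OF clS disjI2[OF anr] continuous_on_const gb hom'])
      (rule that, assumption, assumption, blast)
  have \<psi>D: "\<psi> ` ?F = D" using h by (simp add: homeomorphism_def)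
  show thesis
  proof
    show "continuous_on ?F (\<lambda>x. G' (\<psi> x))"
      by (rule continuous_on_compose2[OF G'(1) cont(1)]) (simp add: \<psi>D)
    show "G' (\<psi> x) = g x" if "x \<in> ?B" for x
    proof -
      have "\<psi> x \<in> S" "x \<in> ?F" using that BF by (auto simp: S_def)
      then show ?thesis using G'(3) inv by simp
    qed
    show "p \<notin> (\<lambda>x. G' (\<psi> x)) ` ?F" using G'(2) unfolding \<psi>D[symmetric] by (simp add: image_subset_iff image_iff Bex_def) blast
  qed
qed

text \<open>The straight-line contraction of the face to a boundary point \<open>b\<close> keeps
  \<open>b\<close> fixed. If \<open>G\<close> missed \<open>p\<close>, composing it with this
  contraction would be a null-homotopy of \<open>g\<close> relative to \<open>b\<close>; for
  \<open>d = 1\<close> the image of a segment would be a path between the two values.\<close>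

lemma W_nonzero_subset_extension:
  fixes G :: "(nat \<Rightarrow> real) \<Rightarrow> real ^ 'n"
  assumes \<sigma>: "\<sigma> \<subseteq> {..N}" "card \<sigma> = CARD('n) + 1"
    and G: "continuous_on (face_real N \<sigma>) G" and eq: "\<And>x. x \<in> face_boundary N \<sigma> \<Longrightarrow> G x = g x"
  shows "W_nonzero (face_boundary N \<sigma>) g \<subseteq> G ` face_real N \<sigma>"
proof
  let ?B = "face_boundary N \<sigma>" and ?F = "face_real N \<sigma>"
  fix p assume p: "p \<in> W_nonzero ?B g"
  show "p \<in> G ` ?F"
  proof (rule ccontr)
    assume pG: "p \<notin> G ` ?F"
    have BF: "?B \<subseteq> ?F" by (rule face_boundary_subset)
    have "p \<noteq> g x" if "x \<in> ?B" for x using pG imageI[OF subsetD[OF BF that], of G] eq[OF that] by metis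
    then have "p \<notin> g ` ?B" by blast
    then have W: "winding_nonzero ?B g p" using p by (auto simp: W_nonzero_def)
    have line: "(\<lambda>i. (1 - t) * x i + t * b i) \<in> ?F" if "x \<in> ?F" "b \<in> ?F" "t \<in> {0..1}" for x b t
      using that convex_standard_simplex[of x N b t] by (auto simp: face_real_def)
    have cl: "continuous_on ({0..1} \<times> ?F) (\<lambda>z. G (\<lambda>i. (1 - fst z) * snd z i + fst z * b i))" if "b \<in> ?F" for b
    proof (rule continuous_on_compose2[OF G])
      show "continuous_on ({0..1} \<times> ?F) (\<lambda>z i. (1 - fst z) * snd z i + fst z * b i)"
        by (intro continuous_on_coordinatewise_then_product continuous_intros
           continuous_on_product_then_coordinatewise[OF continuous_on_snd[OF continuous_on_id]])
    qed (use line that in auto)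
    obtain b where b: "b \<in> ?B" using face_boundary_nonempty[OF \<sigma>(1)] \<sigma>(2)
      by (metis Suc_eq_plus1 Suc_le_mono all_not_in_conv numeral_2_eq_2 One_nat_def Suc_leI zero_less_card_finite)
    have bF: "b \<in> ?F" using b BF by blast
    show False
    proof (cases "CARD('n) = 1")
      case True
      then obtain x y where xy: "x \<in> ?B" "y \<in> ?B" "\<not> connected_component (- {p}) (g x) (g y)"
        using W by (auto simp: winding_nonzero_def)
      let ?P = "(\<lambda>t. G (\<lambda>i. (1 - t) * x i + t * y i)) ` {0..1}"
      have F: "x \<in> ?F" "y \<in> ?F" using xy BF by auto
      have "continuous_on {0..1} (\<lambda>t. G (\<lambda>i. (1 - t) * x i + t * y i))"
        by (rule continuous_on_compose2[OF cl[OF F(2)], where f = "\<lambda>t. (t, x)", simplified])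
           (use F in \<open>auto intro!: continuous_intros\<close>)
      then have "connected ?P" by (intro connected_continuous_image) auto
      moreover have "?P \<subseteq> - {p}" using line[OF F] pG by blast
      moreover have "g x \<in> ?P" using eq[OF xy(1)] by (intro image_eqI[of _ _ 0]) auto
      moreover have "g y \<in> ?P" using eq[OF xy(2)] by (intro image_eqI[of _ _ 1]) auto
      ultimately show False using xy(3) unfolding connected_component_def by blast
    next
      case False
      have "homotopic_with_canon (\<lambda>h. h b = g b) ?B (- {p}) g (\<lambda>_. g b)"
      proof (rule homotopic_with_canonI[where h = "\<lambda>t x. G (\<lambda>i. (1 - t) * x i + t * b i)"])
        show "continuous_on ({0..1} \<times> ?B) (\<lambda>z. G (\<lambda>i. (1 - fst z) * snd z i + fst z * b i))"
          by (rule continuous_on_subset[OF cl[OF bF]]) (use BF in auto)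
        show "G (\<lambda>i. (1 - t) * x i + t * b i) \<in> - {p}" if "t \<in> {0..1}" "x \<in> ?B" for t x
          using line[of x b t] bF BF pG that by blast
        show "G (\<lambda>i. (1 - t) * b i + t * b i) = g b" for t
          using eq[OF b] by (simp add: algebra_simps)
        show "(h b = g b) = (k b = g b)" if "\<And>x. x \<in> ?B \<Longrightarrow> h x = k x" for h k
          using that[OF b] by simp
        show "G (\<lambda>i. (1 - 0) * x i + 0 * b i) = g x" if "x \<in> ?B" for x using eq[OF that] by simp
        show "G (\<lambda>i. (1 - 1) * x i + 1 * b i) = g b" for x using eq[OF b] by simp
      qed
      then show False using W b False by (auto simp: winding_nonzero_def)
    qed
  qed
qed

lemma face_extension_avoiding_finite:
  fixes g :: "(nat \<Rightarrow> real) \<Rightarrow> real ^ 'n"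
  assumes \<sigma>: "\<sigma> \<subseteq> {..N}" "card \<sigma> = CARD('n) + 1" and n: "CARD('n) \<ge> 3"
    and g: "continuous_on (face_boundary N \<sigma>) g" and Z: "finite Z"
    and ex: "\<And>z. z \<in> Z \<Longrightarrow> \<exists>G. continuous_on (face_real N \<sigma>) G \<and> (\<forall>x\<in>face_boundary N \<sigma>. G x = g x) \<and> z \<notin> G ` face_real N \<sigma>"
  obtains G where "continuous_on (face_real N \<sigma>) G" "\<And>x. x \<in> face_boundary N \<sigma> \<Longrightarrow> G x = g x"
    "G ` face_real N \<sigma> \<inter> Z = {}"
proof -
  let ?B = "face_boundary N \<sigma>" and ?F = "face_real N \<sigma>"
  have fin: "finite \<sigma>" using \<sigma>(1) by (rule finite_subset) simp
  obtain D :: "(real ^ 'n) set" and \<psi> \<psi>' where h: "homeomorphism ?F D \<psi> \<psi>'" using face_chart[OF \<sigma>] .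
  define S where "S = \<psi> ` ?B"
  have cont: "continuous_on ?F \<psi>" "continuous_on D \<psi>'" using h by (auto simp: homeomorphism_def)
  have BF: "?B \<subseteq> ?F" by (rule face_boundary_subset)
  have \<psi>D: "\<psi> ` ?F = D" "\<psi>' ` D = ?F" using h by (simp_all add: homeomorphism_def)
  have SD: "S \<subseteq> D" using image_mono[OF BF, of \<psi>] \<psi>D by (simp add: S_def)
  have inv: "\<psi>' (\<psi> x) = x" if "x \<in> ?F" for x using h that by (auto simp: homeomorphism_def)
  have clS: "closed S" unfolding S_def
    by (rule compact_imp_closed[OF compact_continuous_image[OF continuous_on_subset[OF cont(1) BF] compact_face_boundary[OF fin]]])
  have cD: "compact D" using compact_continuous_image[OF cont(1) compact_face_real] \<psi>D by simp
  have \<psi>'S: "\<psi>' x \<in> ?B" if "x \<in> S" for x using that inv BF by (auto simp: S_def)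
  have g': "continuous_on S (\<lambda>x. g (\<psi>' x))"
    by (rule continuous_on_compose2[OF g continuous_on_subset[OF cont(2) SD]]) (use \<psi>'S in auto)
  have "\<exists>G. continuous_on D G \<and> (\<forall>x\<in>S. G x = g (\<psi>' x)) \<and> z \<notin> G ` D" if z: "z \<in> Z" for z
  proof -
    obtain G where G: "continuous_on ?F G" "\<forall>x\<in>?B. G x = g x" "z \<notin> G ` ?F" using ex[OF z] by blast
    have "continuous_on D (\<lambda>x. G (\<psi>' x))"
      by (rule continuous_on_compose2[OF G(1) cont(2)]) (simp add: \<psi>D)
    moreover have "z \<notin> (\<lambda>x. G (\<psi>' x)) ` D" using G(3) unfolding \<psi>D(2)[symmetric] by (simp add: image_iff)
    ultimately show ?thesis using G(2) \<psi>'S by (intro exI[of _ "\<lambda>x. G (\<psi>' x)"]) auto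
  qed
  then have "\<exists>G. continuous_on D G \<and> (\<forall>x\<in>S. G x = g (\<psi>' x)) \<and> G ` D \<inter> Z = {}"
    by (intro extend_avoiding_finite[OF _ cD clS SD g' Z]) (use n in simp_all)
  then obtain G where G: "continuous_on D G" "\<forall>x\<in>S. G x = g (\<psi>' x)" "G ` D \<inter> Z = {}"
    by (elim exE conjE) (rule that)
  show thesis
  proof
    show "continuous_on ?F (\<lambda>x. G (\<psi> x))"
      by (rule continuous_on_compose2[OF G(1) cont(1)]) (simp add: \<psi>D)
    show "G (\<psi> x) = g x" if "x \<in> ?B" for x
    proof -
      have "\<psi> x \<in> S" "x \<in> ?F" using that BF by (auto simp: S_def)
      then show ?thesis using G(2) inv by simp
    qed
    show "(\<lambda>x. G (\<psi> x)) ` ?F \<inter> Z = {}" using G(3) by (simp only: \<psi>D(1)[symmetric] image_image)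
  qed
qed

section \<open>Stability of winding partitions\<close>

lemma compact_imp_closedin_subset:
  fixes S :: "'a::t2_space set"
  assumes "compact S" "S \<subseteq> T"
  shows "closedin (top_of_set T) S"
  using assms by (simp add: closed_subset compact_imp_closed)

lemma Tietze_compact:
  fixes f :: "'a::{metric_space,second_countable_topology} \<Rightarrow> 'b::real_inner"
  assumes "compact S" "S \<subseteq> T" "continuous_on S f"
  obtains g where "continuous_on T g" "\<And>x. x \<in> S \<Longrightarrow> g x = f x"
proof -
  have "bounded (f ` S)" using assms by (simp add: compact_continuous_image compact_imp_bounded)
  then obtain B where B: "B > 0" "\<forall>y\<in>f ` S. norm y \<le> B" unfolding bounded_pos by blast
  show ?thesis
  proof (rule Tietze[OF assms(3) compact_imp_closedin_subset[OF assms(1,2)], of B])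
    show "0 \<le> B" "\<And>x. x \<in> S \<Longrightarrow> norm (f x) \<le> B" using B by auto
  qed (rule that, assumption, blast)
qed

text \<open>The \<open>else\<close> branch is meant for faces of dimension \<open>d\<close>; the
  definition is applied to members of \<open>skeleton_faces N CARD('n)\<close>, which contains no
  larger ones.\<close>

definition winding_target ::
  "nat \<Rightarrow> ((nat \<Rightarrow> real) \<Rightarrow> real ^ 'n) \<Rightarrow> nat set \<Rightarrow> (real ^ 'n) set" where
  "winding_target N f \<sigma> =
     (if card \<sigma> \<le> CARD('n) then f ` face_real N \<sigma> else W_nonzero (face_boundary N \<sigma>) f)"

lemma winding_partition_iff:
  fixes f :: "(nat \<Rightarrow> real) \<Rightarrow> real ^ 'n"
  shows "winding_partition N q f P \<longleftrightarrow>
     P \<subseteq> skeleton_faces N CARD('n) \<and> card P = q \<and> pairwise disjnt P \<and>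
     (\<exists>p. \<forall>\<sigma>\<in>P. p \<in> winding_target N f \<sigma>)"
proof -
  have key: "((card \<sigma> \<le> CARD('n) \<longrightarrow> p \<in> f ` face_real N \<sigma>) \<and>
        (card \<sigma> = CARD('n) + 1 \<longrightarrow> p \<in> W_nonzero (face_boundary N \<sigma>) f)) = (p \<in> winding_target N f \<sigma>)"
    if "\<sigma> \<in> skeleton_faces N CARD('n)" for \<sigma> p
  proof -
    have "card \<sigma> \<le> CARD('n) \<or> card \<sigma> = CARD('n) + 1" using that by (auto simp: skeleton_faces_def)
    then show ?thesis unfolding winding_target_def by auto
  qed
  show ?thesis
  proof (cases "P \<subseteq> skeleton_faces N CARD('n)")
    case True
    then have "(\<forall>\<sigma>\<in>P. (card \<sigma> \<le> CARD('n) \<longrightarrow> p \<in> f ` face_real N \<sigma>) \<and>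
        (card \<sigma> = CARD('n) + 1 \<longrightarrow> p \<in> W_nonzero (face_boundary N \<sigma>) f)) = (\<forall>\<sigma>\<in>P. p \<in> winding_target N f \<sigma>)" for p
      by (intro ball_cong refl key) blast
    then show ?thesis unfolding winding_partition_def by simp
  qed (simp add: winding_partition_def)
qed

text \<open>If \<open>\<sigma>\<close> has dimension \<open>d\<close>, the difference of
  \<open>f'\<close> and \<open>f\<close> on its boundary extends over the face with the same bound
  \<open>r\<close>. Added to \<open>G\<close> it gives a filling of \<open>f'\<close>, and this has
  to cover \<open>y\<close>.\<close>

lemma winding_target_near:
  fixes f f' G :: "(nat \<Rightarrow> real) \<Rightarrow> real ^ 'n"
  assumes \<sigma>: "\<sigma> \<in> skeleton_faces N CARD('n)"
    and f: "continuous_on (skeleton N (CARD('n) - 1)) f" and f': "continuous_on (skeleton N (CARD('n) - 1)) f'"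
    and near: "\<And>x. x \<in> skeleton N (CARD('n) - 1) \<Longrightarrow> dist (f' x) (f x) < r"
    and G: "continuous_on (face_real N \<sigma>) G"
    and Gf: "\<And>x. x \<in> face_real N \<sigma> \<Longrightarrow> x \<in> skeleton N (CARD('n) - 1) \<Longrightarrow> G x = f x"
    and y: "y \<in> winding_target N f' \<sigma>"
  shows "\<exists>x\<in>face_real N \<sigma>. dist y (G x) \<le> r"
proof (cases "card \<sigma> \<le> CARD('n)")
  case True
  have "\<sigma> \<in> skeleton_faces N (CARD('n) - 1)" using \<sigma> True by (simp add: skeleton_faces_def)
  then have sub: "face_real N \<sigma> \<subseteq> skeleton N (CARD('n) - 1)" by (auto simp: skeleton_def)
  obtain x where x: "x \<in> face_real N \<sigma>" "y = f' x" using y True by (auto simp: winding_target_def)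
  then have "dist y (G x) \<le> r" using near[of x] Gf[of x] sub by (simp add: less_imp_le subsetD)
  then show ?thesis using x(1) by blast
next
  case False
  then have c: "card \<sigma> = CARD('n) + 1" and s: "\<sigma> \<subseteq> {..N}" using \<sigma> by (auto simp: skeleton_faces_def)
  have fin: "finite \<sigma>" using s by (rule finite_subset) simp
  let ?B = "face_boundary N \<sigma>"
  have BS: "?B \<subseteq> skeleton N (CARD('n) - 1)"
    using face_boundary_subset_skeleton[OF s, of "CARD('n) - 1"] c by simp
  have r: "r \<ge> 0"
  proof -
    obtain x where "x \<in> ?B" using face_boundary_nonempty[OF s] c by auto
    then have "dist (f' x) (f x) < r" using near BS by blast
    then show ?thesis using zero_le_dist[of "f' x" "f x"] by linarith
  qed
  obtain e where e: "continuous_on (face_real N \<sigma>) e" "\<And>x. x \<in> ?B \<Longrightarrow> e x = f' x - f x"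
    "\<And>x. x \<in> face_real N \<sigma> \<Longrightarrow> norm (e x) \<le> r"
  proof (rule Tietze[of ?B "\<lambda>x. f' x - f x" "face_real N \<sigma>" r])
    show "continuous_on ?B (\<lambda>x. f' x - f x)"
      using f f' BS by (intro continuous_on_diff) (auto intro: continuous_on_subset)
    show "closedin (top_of_set (face_real N \<sigma>)) ?B"
      by (rule compact_imp_closedin_subset[OF compact_face_boundary[OF fin] face_boundary_subset])
    show "norm (f' x - f x) \<le> r" if "x \<in> ?B" for x
      using near[OF subsetD[OF BS that]] by (simp add: dist_norm)
  qed (rule r, rule that)
  have "W_nonzero ?B f' \<subseteq> (\<lambda>x. G x + e x) ` face_real N \<sigma>"
  proof (rule W_nonzero_subset_extension[OF s c])
    show "continuous_on (face_real N \<sigma>) (\<lambda>x. G x + e x)" using G e(1) by (rule continuous_on_add)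
    show "G x + e x = f' x" if "x \<in> ?B" for x
      using Gf[of x] e(2)[OF that] subsetD[OF BS that] subsetD[OF face_boundary_subset that] by simp
  qed
  then obtain x where "x \<in> face_real N \<sigma>" "y = G x + e x" using y False by (auto simp: winding_target_def)
  then have "x \<in> face_real N \<sigma>" "dist y (G x) \<le> r" using e(3) by (auto simp: dist_norm)
  then show ?thesis by blast
qed

text \<open>A filling of \<open>f\<close> that misses \<open>p\<close> keeps a distance
  \<open>d\<close> from it. One half of \<open>d\<close> is spent on changing the map and the other
  half on moving the point.\<close>

lemma winding_target_robust:
  fixes f :: "(nat \<Rightarrow> real) \<Rightarrow> real ^ 'n"
  assumes \<sigma>: "\<sigma> \<in> skeleton_faces N CARD('n)" and n: "CARD('n) \<ge> 2"
    and f: "continuous_on (skeleton N (CARD('n) - 1)) f" and p: "p \<notin> winding_target N f \<sigma>"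
  obtains r where "r > 0" "\<forall>f' p'. continuous_on (skeleton N (CARD('n) - 1)) f' \<and>
      (\<forall>x\<in>skeleton N (CARD('n) - 1). dist (f' x) (f x) < r) \<longrightarrow> dist p' p < r \<longrightarrow> p' \<notin> winding_target N f' \<sigma>"
proof -
  obtain G where G: "continuous_on (face_real N \<sigma>) G" "p \<notin> G ` face_real N \<sigma>"
    and Gf: "\<And>x. x \<in> face_real N \<sigma> \<Longrightarrow> x \<in> skeleton N (CARD('n) - 1) \<Longrightarrow> G x = f x"
  proof (cases "card \<sigma> \<le> CARD('n)")
    case True
    have "\<sigma> \<in> skeleton_faces N (CARD('n) - 1)" using \<sigma> True by (simp add: skeleton_faces_def)
    then have sub: "face_real N \<sigma> \<subseteq> skeleton N (CARD('n) - 1)" by (auto simp: skeleton_def)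
    show ?thesis
      by (rule that[of f]) (use p True continuous_on_subset[OF f sub] in \<open>simp_all add: winding_target_def\<close>)
  next
    case False
    then have c: "card \<sigma> = CARD('n) + 1" and s: "\<sigma> \<subseteq> {..N}" using \<sigma> by (auto simp: skeleton_faces_def)
    have pW: "p \<notin> W_nonzero (face_boundary N \<sigma>) f" using p False by (simp add: winding_target_def)
    have fin: "finite \<sigma>" using s by (rule finite_subset) simp
    obtain G where G: "continuous_on (face_real N \<sigma>) G" "\<And>x. x \<in> face_boundary N \<sigma> \<Longrightarrow> G x = f x"
      "p \<notin> G ` face_real N \<sigma>"
      by (rule winding_zero_extends[OF s c n pW]) (rule that)
    show ?thesis
    proof (rule that[OF G(1,3)])
      fix x assume x: "x \<in> face_real N \<sigma>" "x \<in> skeleton N (CARD('n) - 1)"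
      have "card (support x) < card \<sigma>" using x(2) c n by (simp add: skeleton_iff)
      then have "support x \<noteq> \<sigma>" by blast
      then have "x \<in> face_boundary N \<sigma>" using x(1) by (auto simp: face_boundary_iff face_real_iff)
      then show "G x = f x" by (rule G(2))
    qed
  qed
  have "compact (G ` face_real N \<sigma>)" using G(1) compact_face_real by (rule compact_continuous_image)
  then have "closed (G ` face_real N \<sigma>)" by (rule compact_imp_closed)
  then obtain d where d: "d > 0" "\<And>y. y \<in> G ` face_real N \<sigma> \<Longrightarrow> d \<le> dist p y"
    using separate_point_closed[OF _ G(2)] by blast
  show thesis
  proof (rule that[of "d/2"], goal_cases)
    case 1
    show "d / 2 > 0" using d by simp
  next
    case 2
    show ?case
    proof (intro allI impI, elim conjE)
      fix f' :: "(nat \<Rightarrow> real) \<Rightarrow> real ^ 'n" and p'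
      assume f': "continuous_on (skeleton N (CARD('n) - 1)) f'"
        and "\<forall>x\<in>skeleton N (CARD('n) - 1). dist (f' x) (f x) < d/2" and pp: "dist p' p < d/2"
      then have near: "\<And>x. x \<in> skeleton N (CARD('n) - 1) \<Longrightarrow> dist (f' x) (f x) < d/2" by blast
      show "p' \<notin> winding_target N f' \<sigma>"
      proof
        assume "p' \<in> winding_target N f' \<sigma>"
        from winding_target_near[OF \<sigma> f f' near G(1) Gf this]
        obtain x where "x \<in> face_real N \<sigma>" "dist p' (G x) \<le> d/2" by blast
        then have "d \<le> dist p (G x)" "dist p' (G x) \<le> d/2" using d(2) by auto
        then show False using pp dist_triangle[of p "G x" p'] by (simp add: dist_commute)
      qed
    qed
  qed
qed

text \<open>This confines the possible common points for all maps near \<open>f\<close> to one ball,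
  whose compactness is used for stability.\<close>

lemma winding_target_bounded:
  fixes f :: "(nat \<Rightarrow> real) \<Rightarrow> real ^ 'n"
  assumes \<sigma>: "\<sigma> \<in> skeleton_faces N CARD('n)" and f: "continuous_on (skeleton N (CARD('n) - 1)) f"
  obtains B where "\<forall>f'. continuous_on (skeleton N (CARD('n) - 1)) f' \<and>
      (\<forall>x\<in>skeleton N (CARD('n) - 1). dist (f' x) (f x) < 1) \<longrightarrow> winding_target N f' \<sigma> \<subseteq> cball 0 B"
proof -
  obtain G where G: "continuous_on (standard_simplex N) G" "\<And>x. x \<in> skeleton N (CARD('n) - 1) \<Longrightarrow> G x = f x"
    by (rule Tietze_compact[OF compact_skeleton skeleton_subset f]) (rule that)
  have G1: "continuous_on (face_real N \<sigma>) G" using G(1) face_real_subset by (rule continuous_on_subset)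
  then have "compact (G ` face_real N \<sigma>)" using compact_face_real by (rule compact_continuous_image)
  then have "bounded (G ` face_real N \<sigma>)" by (rule compact_imp_bounded)
  then obtain C where C: "\<forall>y\<in>G ` face_real N \<sigma>. norm y \<le> C" unfolding bounded_iff by blast
  show thesis
  proof (rule that[of "C + 1"], intro allI impI subsetI, elim conjE)
    fix f' :: "(nat \<Rightarrow> real) \<Rightarrow> real ^ 'n" and y
    assume f': "continuous_on (skeleton N (CARD('n) - 1)) f'"
      and "\<forall>x\<in>skeleton N (CARD('n) - 1). dist (f' x) (f x) < 1" and y: "y \<in> winding_target N f' \<sigma>"
    then have near: "\<And>x. x \<in> skeleton N (CARD('n) - 1) \<Longrightarrow> dist (f' x) (f x) < 1" by blast
    from winding_target_near[OF \<sigma> f f' near G1 G(2) y]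
    obtain x where x: "x \<in> face_real N \<sigma>" "dist y (G x) \<le> 1" by blast
    then have "norm (G x) \<le> C" using C by blast
    then show "y \<in> cball 0 (C + 1)" using x(2) norm_triangle_sub[of y "G x"] by (simp add: dist_norm)
  qed
qed

text \<open>If \<open>P\<close> is not a winding partition of \<open>f\<close>, each point is missed
  by the target of some face in \<open>P\<close>, and this persists for nearby maps and nearby
  points. Finitely many such neighbourhoods cover the ball in which common points can lie. As there
  are only finitely many \<open>P\<close>, a single \<open>\<delta>\<close> serves all of
  them.\<close>

theorem winding_partition_stable:
  fixes f :: "(nat \<Rightarrow> real) \<Rightarrow> real ^ 'n"
  assumes n: "CARD('n) \<ge> 2" and f: "continuous_on (skeleton N (CARD('n) - 1)) f"
  obtains \<delta> where "\<delta> > 0" "\<And>f' P. continuous_on (skeleton N (CARD('n) - 1)) f' \<Longrightarrow>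
      (\<And>x. x \<in> skeleton N (CARD('n) - 1) \<Longrightarrow> dist (f' x) (f x) < \<delta>) \<Longrightarrow>
      winding_partition N q f' P \<Longrightarrow> winding_partition N q f P"
proof -
  let ?near = "\<lambda>f' \<delta>. continuous_on (skeleton N (CARD('n) - 1)) f' \<and> (\<forall>x\<in>skeleton N (CARD('n) - 1). dist (f' x) (f x) < \<delta>)"
  have "\<exists>\<delta>>0. \<forall>f'. ?near f' \<delta> \<longrightarrow> winding_partition N q f' P \<longrightarrow> winding_partition N q f P"
    if P: "P \<subseteq> skeleton_faces N CARD('n)" for P
  proof (cases "winding_partition N q f P \<or> P = {} \<or> card P \<noteq> q \<or> \<not> pairwise disjnt P")
    case True
    have "winding_partition N q f P" if "winding_partition N q f' P" for f' :: "(nat \<Rightarrow> real) \<Rightarrow> real ^ 'n"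
      using True that unfolding winding_partition_iff by auto
    then show ?thesis by (intro exI[of _ 1] conjI allI impI zero_less_one)
  next
    case False
    then have no: "\<exists>\<sigma>\<in>P. p \<notin> winding_target N f \<sigma>" for p using P unfolding winding_partition_iff by blast
    have "\<exists>r>0. \<exists>\<sigma>\<in>P. \<forall>f' p'. ?near f' r \<longrightarrow> dist p' p < r \<longrightarrow> p' \<notin> winding_target N f' \<sigma>" for p
    proof -
      obtain \<sigma> where \<sigma>: "\<sigma> \<in> P" "p \<notin> winding_target N f \<sigma>" using no by blast
      obtain r where "r > 0" "\<forall>f' p'. ?near f' r \<longrightarrow> dist p' p < r \<longrightarrow> p' \<notin> winding_target N f' \<sigma>"
        by (rule winding_target_robust[OF subsetD[OF P \<sigma>(1)] n f \<sigma>(2)]) (rule that)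
      then show ?thesis using \<sigma>(1) by blast
    qed
    then obtain r where r: "\<And>p. r p > 0"
      "\<And>p. \<exists>\<sigma>\<in>P. \<forall>f' p'. ?near f' (r p) \<longrightarrow> dist p' p < r p \<longrightarrow> p' \<notin> winding_target N f' \<sigma>"
      by metis
    obtain \<sigma>0 where \<sigma>0: "\<sigma>0 \<in> P" using False by blast
    obtain B where B: "\<forall>f'. ?near f' 1 \<longrightarrow> winding_target N f' \<sigma>0 \<subseteq> cball 0 B"
      by (rule winding_target_bounded[OF subsetD[OF P \<sigma>0] f]) (rule that)
    obtain C where C: "C \<subseteq> cball 0 B" "finite C" "cball 0 B \<subseteq> (\<Union>p\<in>C. ball p (r p))"
    proof (rule compactE_image[of "cball 0 B" "cball 0 B" "\<lambda>p. ball p (r p)"])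
      show "cball 0 B \<subseteq> (\<Union>p\<in>cball 0 B. ball p (r p))" using r(1) by (auto intro: centre_in_ball[THEN iffD2])
    qed (simp_all add: that)
    define \<delta> where "\<delta> = Min (insert 1 (r ` C))"
    have \<delta>: "\<delta> > 0" "\<delta> \<le> 1" "\<And>p. p \<in> C \<Longrightarrow> \<delta> \<le> r p"
      using C(2) r(1) by (auto simp: \<delta>_def)
    have "\<not> winding_partition N q f' P" if f': "?near f' \<delta>" for f'
    proof
      assume "winding_partition N q f' P"
      then obtain p' where p': "\<forall>\<sigma>\<in>P. p' \<in> winding_target N f' \<sigma>" unfolding winding_partition_iff by blast
      have "?near f' 1" using f' \<delta>(2) by (auto intro: less_le_trans)
      then have "p' \<in> cball 0 B" using B p' \<sigma>0 by blast
      then obtain p where p: "p \<in> C" "dist p' p < r p" using C(3) by (auto simp: dist_commute)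
      have "?near f' (r p)" using f' \<delta>(3)[OF p(1)] by (auto intro: less_le_trans)
      then show False using r(2)[of p] p(2) p' by blast
    qed
    then show ?thesis using \<delta>(1) by blast
  qed
  then obtain \<delta> where \<delta>: "\<And>P. P \<subseteq> skeleton_faces N CARD('n) \<Longrightarrow> \<delta> P > 0"
    "\<And>P f'. P \<subseteq> skeleton_faces N CARD('n) \<Longrightarrow> ?near f' (\<delta> P) \<Longrightarrow> winding_partition N q f' P \<Longrightarrow> winding_partition N q f P"
    by metis
  define m where "m = Min (insert 1 (\<delta> ` Pow (skeleton_faces N CARD('n))))"
  have fin: "finite (\<delta> ` Pow (skeleton_faces N CARD('n)))" by (simp add: finite_skeleton_faces)
  show thesis
  proof (rule that)
    show "m > 0" unfolding m_def using fin \<delta>(1) by simp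
    fix f' :: "(nat \<Rightarrow> real) \<Rightarrow> real ^ 'n" and P
    assume f': "continuous_on (skeleton N (CARD('n) - 1)) f'"
      "\<And>x. x \<in> skeleton N (CARD('n) - 1) \<Longrightarrow> dist (f' x) (f x) < m" and w: "winding_partition N q f' P"
    have P: "P \<subseteq> skeleton_faces N CARD('n)" using w by (simp add: winding_partition_def)
    then have "m \<le> \<delta> P" unfolding m_def using fin by (intro Min_le) auto
    then have "?near f' (\<delta> P)" using f' by (auto intro: less_le_trans)
    then show "winding_partition N q f P" using \<delta>(2)[OF P _ w] by blast
  qed
qed

section \<open>Tverberg partitions in dimension at least three\<close>

lemma continuous_on_glue:
  assumes "finite I" "\<And>i. i \<in> I \<Longrightarrow> closed (C i)" "\<And>i. i \<in> I \<Longrightarrow> continuous_on (C i) (g i)"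
    and "\<And>i x. i \<in> I \<Longrightarrow> x \<in> C i \<Longrightarrow> F x = g i x"
  shows "continuous_on (\<Union>i\<in>I. C i) F"
proof (rule continuous_on_closed_Union[OF assms(1,2)])
  fix i assume i: "i \<in> I"
  have "continuous_on (C i) F \<longleftrightarrow> continuous_on (C i) (g i)" using assms(4)[OF i] by (rule continuous_on_cong[OF refl])
  then show "continuous_on (C i) F" using assms(3)[OF i] by simp
qed

lemma tverberg_partition_full:
  assumes "tverberg_partition N k q F P"
  shows "tverberg_partition N N q F P"
proof -
  have "skeleton_faces N k \<subseteq> skeleton_faces N N"
  proof
    fix \<sigma> assume "\<sigma> \<in> skeleton_faces N k"
    then have "\<sigma> \<noteq> {}" "\<sigma> \<subseteq> {..N}" by (auto simp: skeleton_faces_def)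
    then show "\<sigma> \<in> skeleton_faces N N" using card_mono[of "{..N}" \<sigma>] by (simp add: skeleton_faces_def)
  qed
  then show ?thesis using assms unfolding tverberg_partition_def by (metis order_trans)
qed

lemma winding_partition_imp_tverberg:
  fixes F :: "(nat \<Rightarrow> real) \<Rightarrow> real ^ 'n"
  assumes F: "continuous_on (skeleton N CARD('n)) F" and P: "winding_partition N q F P"
  shows "tverberg_partition N CARD('n) q F P"
proof -
  have PS: "P \<subseteq> skeleton_faces N CARD('n)" "card P = q" "pairwise disjnt P"
    using P by (simp_all add: winding_partition_iff)
  obtain p where p: "\<And>\<sigma>. \<sigma> \<in> P \<Longrightarrow> p \<in> winding_target N F \<sigma>"
    using P unfolding winding_partition_iff by blast
  have "p \<in> F ` face_real N \<sigma>" if \<sigma>: "\<sigma> \<in> P" for \<sigma>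
  proof (cases "card \<sigma> \<le> CARD('n)")
    case True
    then show ?thesis using p[OF \<sigma>] by (simp add: winding_target_def)
  next
    case False
    then have c: "card \<sigma> = CARD('n) + 1" and s: "\<sigma> \<subseteq> {..N}" using PS(1) \<sigma> by (auto simp: skeleton_faces_def)
    have "face_real N \<sigma> \<subseteq> skeleton N CARD('n)" using PS(1) \<sigma> by (auto simp: skeleton_def)
    then have "W_nonzero (face_boundary N \<sigma>) F \<subseteq> F ` face_real N \<sigma>"
      by (intro W_nonzero_subset_extension[OF s c] continuous_on_subset[OF F] refl)
    then show ?thesis using p[OF \<sigma>] False by (auto simp: winding_target_def)
  qed
  then have "p \<in> (\<Inter>\<sigma>\<in>P. F ` face_real N \<sigma>)" by (rule INT_I)
  then have "(\<Inter>\<sigma>\<in>P. F ` face_real N \<sigma>) \<noteq> {}" by (metis empty_iff)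
  then show ?thesis using PS by (simp add: tverberg_partition_def)
qed

text \<open>The number \<open>d\<close> is what is left of \<open>(d + 1) * q\<close> after
  subtracting \<open>(d + 1) * (q - 1) + 1\<close> vertices. Since subtraction is truncated, a face
  with more than \<open>d + 1\<close> vertices counts as codimension zero rather than negative,
  which makes the inequality strict. \<open>c\<close> is left abstract because the planar case
  counts only some of the vertices of each face.\<close>

lemma codimension_count:
  fixes c :: "'b \<Rightarrow> nat"
  assumes P: "finite P" "card P = q" "q \<ge> 1" and sum: "(\<Sum>\<sigma>\<in>P. c \<sigma>) \<le> (d + 1) * (q - 1) + 1"
  shows "d \<le> (\<Sum>\<sigma>\<in>{\<sigma>\<in>P. c \<sigma> \<le> d}. d + 1 - c \<sigma>)"
    and "\<sigma> \<in> P \<Longrightarrow> c \<sigma> > d + 1 \<Longrightarrow> d < (\<Sum>\<sigma>\<in>{\<sigma>\<in>P. c \<sigma> \<le> d}. d + 1 - c \<sigma>)"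
proof -
  have eq: "(\<Sum>\<sigma>\<in>{\<sigma>\<in>P. c \<sigma> \<le> d}. d + 1 - c \<sigma>) = (\<Sum>\<sigma>\<in>P. d + 1 - c \<sigma>)"
    using P(1) by (intro sum.mono_neutral_left) auto
  have q: "(d + 1) * q = (d + 1) * (q - 1) + 1 + d" using P(3) by (cases q) auto
  have "(\<Sum>\<sigma>\<in>P. d + 1) \<le> (\<Sum>\<sigma>\<in>P. (d + 1 - c \<sigma>) + c \<sigma>)" by (intro sum_mono) auto
  then have "(d + 1) * q \<le> (\<Sum>\<sigma>\<in>P. d + 1 - c \<sigma>) + (\<Sum>\<sigma>\<in>P. c \<sigma>)"
    using P(2) by (simp add: sum.distrib mult.commute)
  then show "d \<le> (\<Sum>\<sigma>\<in>{\<sigma>\<in>P. c \<sigma> \<le> d}. d + 1 - c \<sigma>)" unfolding eq using q sum by linarith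
  assume \<sigma>: "\<sigma> \<in> P" "c \<sigma> > d + 1"
  have "(\<Sum>\<sigma>\<in>P. d + 1) < (\<Sum>\<sigma>\<in>P. (d + 1 - c \<sigma>) + c \<sigma>)"
    using P(1) \<sigma> by (intro sum_strict_mono_ex1 bexI[of _ \<sigma>]) auto
  then have "(d + 1) * q < (\<Sum>\<sigma>\<in>P. d + 1 - c \<sigma>) + (\<Sum>\<sigma>\<in>P. c \<sigma>)"
    using P(2) by (simp add: sum.distrib mult.commute)
  then show "d < (\<Sum>\<sigma>\<in>{\<sigma>\<in>P. c \<sigma> \<le> d}. d + 1 - c \<sigma>)" unfolding eq using q sum by linarith
qed

lemma sum_card_Int_le:
  assumes "finite P" "pairwise disjnt P" "finite A"
  shows "(\<Sum>\<sigma>\<in>P. card (\<sigma> \<inter> A)) \<le> card A"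
proof -
  have "(\<Sum>\<sigma>\<in>P. card (\<sigma> \<inter> A)) = card (\<Union>\<sigma>\<in>P. \<sigma> \<inter> A)"
    using assms by (intro card_UN_disjoint[symmetric]) (auto simp: pairwise_def disjnt_def)
  also have "\<dots> \<le> card A" using assms(3) by (intro card_mono) auto
  finally show ?thesis .
qed

text \<open>These are the candidates for the common point of a Tverberg partition. They are
  determined by the general position map alone, before any face is filled anew.\<close>

definition intersection_points :: "nat \<Rightarrow> ((nat \<Rightarrow> real) \<Rightarrow> 'a::euclidean_space) \<Rightarrow> 'a set" where
  "intersection_points N f = (\<Union>\<T>\<in>{\<T>. \<T> \<subseteq> skeleton_faces N DIM('a) \<and> pairwise disjnt \<T> \<and>
      (\<Sum>\<tau>\<in>\<T>. DIM('a) + 1 - card \<tau>) = DIM('a)}. \<Inter>\<tau>\<in>\<T>. f ` face_real N \<tau>)"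

text \<open>Emptiness above the critical codimension and finiteness at it are combined into one
  implication whose premise, a total codimension of at least \<open>DIM('a)\<close>, is what the
  vertex count delivers.\<close>

lemma general_position_perturbation:
  fixes f :: "(nat \<Rightarrow> real) \<Rightarrow> 'a::euclidean_space"
  assumes "continuous_on (skeleton N k) f" "\<epsilon> > 0"
  obtains f' :: "(nat \<Rightarrow> real) \<Rightarrow> 'a" where "continuous_on (standard_simplex N) f'"
    "\<And>x. x \<in> skeleton N k \<Longrightarrow> dist (f' x) (f x) < \<epsilon>" "finite (intersection_points N f')"
    "\<forall>\<T> p. \<T> \<subseteq> skeleton_faces N DIM('a) \<longrightarrow> pairwise disjnt \<T> \<longrightarrow>
       DIM('a) \<le> (\<Sum>\<tau>\<in>\<T>. DIM('a) + 1 - card \<tau>) \<longrightarrow> (\<forall>\<tau>\<in>\<T>. p \<in> f' ` face_real N \<tau>) \<longrightarrow>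
       (\<Sum>\<tau>\<in>\<T>. DIM('a) + 1 - card \<tau>) = DIM('a) \<and> p \<in> intersection_points N f'"
proof -
  obtain f' :: "(nat \<Rightarrow> real) \<Rightarrow> 'a" where f': "continuous_on (standard_simplex N) f'"
    "\<And>x. x \<in> skeleton N k \<Longrightarrow> dist (f' x) (f x) < \<epsilon>"
    and e: "\<And>\<T>. \<T> \<subseteq> skeleton_faces N DIM('a) \<Longrightarrow> pairwise disjnt \<T> \<Longrightarrow>
       (\<Sum>\<tau>\<in>\<T>. DIM('a) + 1 - card \<tau>) > DIM('a) \<Longrightarrow> (\<Inter>\<tau>\<in>\<T>. f' ` face_real N \<tau>) = {}"
    and f: "\<And>\<T>. \<T> \<subseteq> skeleton_faces N DIM('a) \<Longrightarrow> pairwise disjnt \<T> \<Longrightarrow>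
       (\<Sum>\<tau>\<in>\<T>. DIM('a) + 1 - card \<tau>) = DIM('a) \<Longrightarrow> finite (\<Inter>\<tau>\<in>\<T>. f' ` face_real N \<tau>)"
    by (rule general_position_approximation[OF assms]) (rule that)
  show thesis
  proof (rule that[OF f'])
    have "finite {\<T>. \<T> \<subseteq> skeleton_faces N DIM('a) \<and> pairwise disjnt \<T> \<and>
      (\<Sum>\<tau>\<in>\<T>. DIM('a) + 1 - card \<tau>) = DIM('a)}"
      by (rule finite_subset[of _ "Pow (skeleton_faces N DIM('a))"]) (auto simp: finite_skeleton_faces)
    then show "finite (intersection_points N f')"
      unfolding intersection_points_def by (rule finite_UN_I) (use f in blast)
    show "\<forall>\<T> p. \<T> \<subseteq> skeleton_faces N DIM('a) \<longrightarrow> pairwise disjnt \<T> \<longrightarrow>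
       DIM('a) \<le> (\<Sum>\<tau>\<in>\<T>. DIM('a) + 1 - card \<tau>) \<longrightarrow> (\<forall>\<tau>\<in>\<T>. p \<in> f' ` face_real N \<tau>) \<longrightarrow>
       (\<Sum>\<tau>\<in>\<T>. DIM('a) + 1 - card \<tau>) = DIM('a) \<and> p \<in> intersection_points N f'"
    proof (intro allI impI)
      fix \<T> p assume \<T>: "\<T> \<subseteq> skeleton_faces N DIM('a)" "pairwise disjnt \<T>"
        "DIM('a) \<le> (\<Sum>\<tau>\<in>\<T>. DIM('a) + 1 - card \<tau>)" "\<forall>\<tau>\<in>\<T>. p \<in> f' ` face_real N \<tau>"
      have p: "p \<in> (\<Inter>\<tau>\<in>\<T>. f' ` face_real N \<tau>)" using \<T>(4) by (intro INT_I) blast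
      then have "\<not> (\<Sum>\<tau>\<in>\<T>. DIM('a) + 1 - card \<tau>) > DIM('a)" using e[OF \<T>(1,2)] by auto
      then have eq: "(\<Sum>\<tau>\<in>\<T>. DIM('a) + 1 - card \<tau>) = DIM('a)" using \<T>(3) by linarith
      then show "(\<Sum>\<tau>\<in>\<T>. DIM('a) + 1 - card \<tau>) = DIM('a) \<and> p \<in> intersection_points N f'"
        unfolding intersection_points_def using \<T>(1,2) p by (intro conjI UN_I[of \<T>] CollectI) auto
    qed
  qed
qed

theorem tverberg_winding_extension:
  fixes f :: "(nat \<Rightarrow> real) \<Rightarrow> real ^ 'n"
  assumes n: "CARD('n) \<ge> 3" and q: "q \<ge> 1" and N: "N = (CARD('n) + 1) * (q - 1)"
    and f: "continuous_on (skeleton N (CARD('n) - 1)) f" and \<epsilon>: "\<epsilon> > 0"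
  obtains F :: "(nat \<Rightarrow> real) \<Rightarrow> real ^ 'n" where "continuous_on (standard_simplex N) F"
    "\<forall>x\<in>skeleton N (CARD('n) - 1). dist (F x) (f x) < \<epsilon>"
    "\<forall>P. tverberg_partition N N q F P \<longrightarrow> winding_partition N q f P"
proof -
  let ?d = "CARD('n)"
  have n2: "?d \<ge> 2" using n by simp
  obtain \<delta> where \<delta>: "\<delta> > 0" "\<And>f' P. continuous_on (skeleton N (?d - 1)) f' \<Longrightarrow>
      (\<And>x. x \<in> skeleton N (?d - 1) \<Longrightarrow> dist (f' x) (f x) < \<delta>) \<Longrightarrow>
      winding_partition N q f' P \<Longrightarrow> winding_partition N q f P"
    by (rule winding_partition_stable[OF n2 f, where q = q]) (rule that, assumption, blast)
  \<comment> \<open>\<open>\<epsilon>\<close> is the required accuracy; \<open>\<delta>\<close>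
    allows winding partitions of the perturbed map to be taken back to \<open>f\<close>.\<close>
  have "min \<epsilon> \<delta> > 0" using \<epsilon> \<delta>(1) by simp
  note perturb = general_position_perturbation[OF f this, unfolded DIM_cart DIM_real mult_1_right]
  obtain f' :: "(nat \<Rightarrow> real) \<Rightarrow> real ^ 'n" where
    f': "continuous_on (standard_simplex N) f'" "\<And>x. x \<in> skeleton N (?d - 1) \<Longrightarrow> dist (f' x) (f x) < min \<epsilon> \<delta>"
    and Z: "finite (intersection_points N f')"
    and gp: "\<forall>\<T> p. \<T> \<subseteq> skeleton_faces N ?d \<longrightarrow> pairwise disjnt \<T> \<longrightarrow>
       ?d \<le> (\<Sum>\<tau>\<in>\<T>. ?d + 1 - card \<tau>) \<longrightarrow> (\<forall>\<tau>\<in>\<T>. p \<in> f' ` face_real N \<tau>) \<longrightarrow>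
       (\<Sum>\<tau>\<in>\<T>. ?d + 1 - card \<tau>) = ?d \<and> p \<in> intersection_points N f'"
    by (rule perturb) (rule that)
  have f's: "continuous_on (skeleton N (?d - 1)) f'" using f'(1) skeleton_subset by (rule continuous_on_subset)
  \<comment> \<open>Candidates in \<open>W_nonzero\<close> are met by every filling, all others are
    to be missed. For each of the others separately a filling exists because its winding number
    vanishes; here \<open>d \<ge> 3\<close> yields one filling for all of them.\<close>
  have "\<exists>G. continuous_on (face_real N \<sigma>) G \<and> (\<forall>x\<in>face_boundary N \<sigma>. G x = f' x) \<and>
      G ` face_real N \<sigma> \<inter> (intersection_points N f' - W_nonzero (face_boundary N \<sigma>) f') = {}"
    if \<sigma>: "\<sigma> \<subseteq> {..N}" "card \<sigma> = ?d + 1" for \<sigma>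
  proof -
    have c: "continuous_on (face_boundary N \<sigma>) f'"
      using f'(1) by (rule continuous_on_subset) (use face_boundary_subset face_real_subset in blast)
    have ex: "\<exists>G. continuous_on (face_real N \<sigma>) G \<and> (\<forall>x\<in>face_boundary N \<sigma>. G x = f' x) \<and> z \<notin> G ` face_real N \<sigma>"
      if "z \<in> intersection_points N f' - W_nonzero (face_boundary N \<sigma>) f'" for z
    proof -
      have "z \<notin> W_nonzero (face_boundary N \<sigma>) f'" using that by blast
      then obtain G where "continuous_on (face_real N \<sigma>) G" "\<And>x. x \<in> face_boundary N \<sigma> \<Longrightarrow> G x = f' x"
        "z \<notin> G ` face_real N \<sigma>"
        by (rule winding_zero_extends[OF \<sigma> n2]) (rule that)
      then show ?thesis by (intro exI[of _ G] conjI ballI)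
    qed
    have Z': "finite (intersection_points N f' - W_nonzero (face_boundary N \<sigma>) f')" using Z by simp
    obtain G where "continuous_on (face_real N \<sigma>) G" "\<And>x. x \<in> face_boundary N \<sigma> \<Longrightarrow> G x = f' x"
      "G ` face_real N \<sigma> \<inter> (intersection_points N f' - W_nonzero (face_boundary N \<sigma>) f') = {}"
      by (rule face_extension_avoiding_finite[OF \<sigma> n c Z' ex]) (assumption, rule that)
    then show ?thesis by (intro exI[of _ G] conjI ballI)
  qed
  note ex = this
  define G where "G \<sigma> = (SOME G. continuous_on (face_real N \<sigma>) G \<and> (\<forall>x\<in>face_boundary N \<sigma>. G x = f' x) \<and>
      G ` face_real N \<sigma> \<inter> (intersection_points N f' - W_nonzero (face_boundary N \<sigma>) f') = {})" for \<sigma>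
  have G: "continuous_on (face_real N \<sigma>) (G \<sigma>)" "\<And>x. x \<in> face_boundary N \<sigma> \<Longrightarrow> G \<sigma> x = f' x"
    "G \<sigma> ` face_real N \<sigma> \<inter> (intersection_points N f' - W_nonzero (face_boundary N \<sigma>) f') = {}"
    if "\<sigma> \<subseteq> {..N}" "card \<sigma> = ?d + 1" for \<sigma>
    using someI_ex[OF ex[OF that]] unfolding G_def[symmetric] by blast+
  \<comment> \<open>The interior points of a \<open>d\<close>-face are those whose support is that
    face, so the support selects the filling. On the boundary the filling agrees with
    \<open>f'\<close>, which makes the pieces fit.\<close>
  define F0 where "F0 x = (if card (support x) = ?d + 1 then G (support x) x else f' x)" for x
  define g where "g \<sigma> = (if card \<sigma> = ?d + 1 then G \<sigma> else f')" for \<sigma>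
  have F0g: "F0 x = g \<sigma> x" if \<sigma>: "\<sigma> \<in> skeleton_faces N ?d" and x: "x \<in> face_real N \<sigma>" for \<sigma> x
  proof -
    have s: "\<sigma> \<subseteq> {..N}" "finite \<sigma>" "card \<sigma> \<le> ?d + 1" using \<sigma> by (auto simp: skeleton_faces_def intro: finite_subset)
    have sx: "support x \<subseteq> \<sigma>" "x \<in> standard_simplex N" using x by (auto simp: face_real_iff)
    show ?thesis
    proof (cases "support x = \<sigma>")
      case True
      then show ?thesis by (simp add: F0_def g_def)
    next
      case False
      then have "x \<in> face_boundary N \<sigma>" "card (support x) < card \<sigma>"
        using sx s(2) by (auto simp: face_boundary_iff psubset_card_mono)
      then show ?thesis using s G(2)[of \<sigma> x] by (auto simp: F0_def g_def)
    qed
  qed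
  have "continuous_on (skeleton N ?d) F0"
    unfolding skeleton_def
  proof (rule continuous_on_glue[where g = g])
    show "finite (skeleton_faces N ?d)" by (rule finite_skeleton_faces)
    show "closed (face_real N \<sigma>)" for \<sigma> by (rule closed_face_real)
    show "continuous_on (face_real N \<sigma>) (g \<sigma>)" if "\<sigma> \<in> skeleton_faces N ?d" for \<sigma>
      using that G(1)[of \<sigma>] continuous_on_subset[OF f'(1) face_real_subset, of \<sigma>] by (auto simp: g_def skeleton_faces_def)
  qed (rule F0g)
  \<comment> \<open>Any continuous extension over the larger faces will do, since the vertex count
    excludes such faces from Tverberg partitions.\<close>
  then obtain F where F: "continuous_on (standard_simplex N) F" "\<And>x. x \<in> skeleton N ?d \<Longrightarrow> F x = F0 x"
    by (rule Tietze_compact[OF compact_skeleton skeleton_subset]) (rule that)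
  have Ff': "F x = f' x" if "x \<in> skeleton N (?d - 1)" for x
  proof -
    have "card (support x) \<le> ?d" "x \<in> skeleton N ?d" using that n by (auto simp: skeleton_iff)
    then show ?thesis using F(2) by (simp add: F0_def)
  qed
  show thesis
  proof (rule that[OF F(1)])
    show "\<forall>x\<in>skeleton N (?d - 1). dist (F x) (f x) < \<epsilon>" using f'(2) Ff' by simp
    show "\<forall>P. tverberg_partition N N q F P \<longrightarrow> winding_partition N q f P"
    proof (intro allI impI)
      fix P assume T: "tverberg_partition N N q F P"
      then have P: "P \<subseteq> skeleton_faces N N" "card P = q" "pairwise disjnt P" by (simp_all add: tverberg_partition_def)
      obtain p where p: "\<And>\<sigma>. \<sigma> \<in> P \<Longrightarrow> p \<in> F ` face_real N \<sigma>" using T by (auto simp: tverberg_partition_def)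
      have finP: "finite P" using P(1) finite_skeleton_faces by (rule finite_subset)
      have PN: "\<sigma> \<subseteq> {..N}" "\<sigma> \<noteq> {}" if "\<sigma> \<in> P" for \<sigma> using that P(1) by (auto simp: skeleton_faces_def)
      have sum: "(\<Sum>\<sigma>\<in>P. card \<sigma>) \<le> (?d + 1) * (q - 1) + 1"
        using sum_card_Int_le[OF finP P(3), of "{..N}"] PN(1) by (simp add: N inf.absorb1)
      define \<T> where "\<T> = {\<sigma>\<in>P. card \<sigma> \<le> ?d}"
      have low: "p \<in> f' ` face_real N \<sigma>" if "\<sigma> \<in> \<T>" for \<sigma>
      proof -
        have s: "\<sigma> \<in> P" "card \<sigma> \<le> ?d" using that by (auto simp: \<T>_def)
        then have "\<sigma> \<in> skeleton_faces N (?d - 1)" using PN by (simp add: skeleton_faces_def)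
        then have "face_real N \<sigma> \<subseteq> skeleton N (?d - 1)" by (auto simp: skeleton_def)
        then have "F ` face_real N \<sigma> = f' ` face_real N \<sigma>" using Ff' by (intro image_cong) auto
        then show ?thesis using p[OF s(1)] by simp
      qed
      have \<T>s: "\<T> \<subseteq> skeleton_faces N ?d" using PN by (auto simp: \<T>_def skeleton_faces_def)
      have \<T>d: "pairwise disjnt \<T>" using P(3) by (rule pairwise_subset) (auto simp: \<T>_def)
      have ge: "?d \<le> (\<Sum>\<tau>\<in>\<T>. ?d + 1 - card \<tau>)"
        unfolding \<T>_def by (rule codimension_count(1)[OF finP P(2) q sum])
      \<comment> \<open>The faces with at most \<open>d\<close> vertices, on which \<open>F\<close>
        is still \<open>f'\<close>, place \<open>p\<close> among the candidates by themselves. That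
        their codimensions add up to exactly \<open>d\<close> is also what rules out faces with more
        than \<open>d + 1\<close> vertices.\<close>
      have eq: "(\<Sum>\<tau>\<in>\<T>. ?d + 1 - card \<tau>) = ?d" and pZ: "p \<in> intersection_points N f'"
        using gp[rule_format, OF \<T>s \<T>d ge, of p] low by auto
      have le: "card \<sigma> \<le> ?d + 1" if "\<sigma> \<in> P" for \<sigma>
        using codimension_count(2)[OF finP P(2) q sum that] eq unfolding \<T>_def by linarith
      have "winding_partition N q f' P"
        unfolding winding_partition_iff
      proof (intro conjI exI ballI)
        show "P \<subseteq> skeleton_faces N ?d" using PN le by (auto simp: skeleton_faces_def)
        show "card P = q" "pairwise disjnt P" by fact+
        fix \<sigma> assume \<sigma>: "\<sigma> \<in> P"
        show "p \<in> winding_target N f' \<sigma>"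
        proof (cases "card \<sigma> \<le> ?d")
          case True
          then show ?thesis using low[of \<sigma>] \<sigma> by (simp add: winding_target_def \<T>_def)
        next
          case False
          then have c: "card \<sigma> = ?d + 1" using le[OF \<sigma>] by simp
          have sk: "\<sigma> \<in> skeleton_faces N ?d" using PN[OF \<sigma>] c by (simp add: skeleton_faces_def)
          then have "face_real N \<sigma> \<subseteq> skeleton N ?d" by (auto simp: skeleton_def)
          then have "F ` face_real N \<sigma> = G \<sigma> ` face_real N \<sigma>"
            using F(2) F0g[OF sk] c by (intro image_cong) (auto simp: g_def)
          then have "p \<in> G \<sigma> ` face_real N \<sigma>" using p[OF \<sigma>] by simp
          then have "p \<in> W_nonzero (face_boundary N \<sigma>) f'" using G(3)[OF PN(1)[OF \<sigma>] c] pZ by blast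
          then show ?thesis using False by (simp add: winding_target_def)
        qed
      qed
      then show "winding_partition N q f P" using \<delta>(2)[OF f's, of P] f'(2) by simp
    qed
  qed
qed

section \<open>The planar case\<close>

definition in_space :: "real ^ 2 \<Rightarrow> real \<Rightarrow> real ^ 3" where
  "in_space u h = (\<chi> i. if i = 1 then u $ 1 else if i = 2 then u $ 2 else h)"

lemma in_space_nth [simp]: "in_space u h $ 1 = u $ 1" "in_space u h $ 2 = u $ 2" "in_space u h $ 3 = h"
  by (simp_all add: in_space_def)

lemma in_space_eq_iff: "in_space u h = in_space u' h' \<longleftrightarrow> u = u' \<and> h = h'"
  by (auto simp: vec_eq_iff forall_2 forall_3)

lemma plane_in_space_eq: "plane_in_space u = in_space u 0"
  by (simp add: plane_in_space_def vec_eq_iff forall_3)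

lemma continuous_on_in_space:
  assumes "continuous_on S u" "continuous_on S h"
  shows "continuous_on S (\<lambda>x. in_space (u x) (h x))"
  unfolding in_space_def
proof (rule continuous_on_vec_lambda)
  fix i :: 3
  show "continuous_on S (\<lambda>x. if i = 1 then u x $ 1 else if i = 2 then u x $ 2 else h x)"
    using assms by (cases "i = 1"; cases "i = 2") (auto intro!: continuous_intros)
qed

lemma standard_simplexI:
  assumes "\<And>i. 0 \<le> x i" "\<And>i. i > p \<Longrightarrow> x i = 0" "(\<Sum>i\<le>p. x i) = 1"
  shows "x \<in> standard_simplex p"
proof -
  have "x i \<le> 1" for i
  proof (cases "i \<le> p")
    case True
    then have "x i \<le> (\<Sum>i\<le>p. x i)" using assms(1) by (intro member_le_sum) auto
    then show ?thesis using assms(3) by simp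
  qed (use assms(2) in simp)
  then show ?thesis using assms by (auto simp: standard_simplex_def)
qed

definition triples :: "nat \<Rightarrow> nat set set" where
  "triples M = {\<tau>. \<tau> \<subseteq> {..M} \<and> card \<tau> = 3}"

text \<open>The depth is positive on the interior of a triangle and zero on the edges.\<close>

definition depth :: "nat \<Rightarrow> (nat \<Rightarrow> real) \<Rightarrow> real" where
  "depth M x = (\<Sum>\<tau>\<in>triples M. Min (x ` \<tau>))"

lemma finite_triples: "finite (triples M)"
  by (rule finite_subset[of _ "Pow {..M}"]) (auto simp: triples_def)

lemma triples_finite_nonempty: "\<tau> \<in> triples M \<Longrightarrow> finite \<tau> \<and> \<tau> \<noteq> {}"
  by (auto simp: triples_def intro: card_ge_0_finite)

lemma continuous_on_coordinate: "continuous_on S (\<lambda>x::nat \<Rightarrow> real. x i)"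
  by (rule continuous_on_subset[OF continuous_on_product_coordinates]) simp

lemma continuous_on_depth: "continuous_on S (depth M)"
  unfolding depth_def
  by (intro continuous_on_sum continuous_on_Min_image continuous_on_coordinate)
     (use triples_finite_nonempty in blast)+

lemma Min_image_eq_0_iff:
  fixes x :: "nat \<Rightarrow> real"
  assumes "\<And>i. 0 \<le> x i" "finite \<tau>" "\<tau> \<noteq> {}"
  shows "Min (x ` \<tau>) = 0 \<longleftrightarrow> (\<exists>v\<in>\<tau>. x v = 0)"
proof
  assume "Min (x ` \<tau>) = 0"
  then show "\<exists>v\<in>\<tau>. x v = 0" using Min_in[of "x ` \<tau>"] assms by auto
next
  assume "\<exists>v\<in>\<tau>. x v = 0"
  then show "Min (x ` \<tau>) = 0" using assms by (intro Min_eqI) auto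
qed

lemma depth_nonneg:
  assumes "\<And>i. 0 \<le> x i"
  shows "0 \<le> depth M x"
  unfolding depth_def using assms triples_finite_nonempty by (intro sum_nonneg) (simp add: Min_ge_iff)

lemma depth_eq_0:
  assumes x: "\<And>i. 0 \<le> x i" and c: "card (support x \<inter> {..M}) \<le> 2"
  shows "depth M x = 0"
  unfolding depth_def
proof (rule sum.neutral, rule ballI)
  fix \<tau> assume \<tau>: "\<tau> \<in> triples M"
  have "\<not> \<tau> \<subseteq> support x"
  proof
    assume "\<tau> \<subseteq> support x"
    then have "card \<tau> \<le> card (support x \<inter> {..M})" using \<tau> by (intro card_mono) (auto simp: triples_def)
    then show False using \<tau> c by (simp add: triples_def)
  qed
  then show "Min (x ` \<tau>) = 0"
    using Min_image_eq_0_iff[OF x, of \<tau>] triples_finite_nonempty[OF \<tau>] by (auto simp: support_def)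
qed

text \<open>Any other triangle has a vertex that is neither in \<open>\<tau>\<close> nor the apex;
  its coordinate vanishes, and with it the term of that triangle.\<close>

lemma depth_on_cone:
  assumes x: "\<And>i. 0 \<le> x i" and \<tau>: "\<tau> \<in> triples M" and s: "support x \<subseteq> insert (Suc M) \<tau>"
  shows "depth M x = Min (x ` \<tau>)"
proof -
  have "Min (x ` \<tau>') = 0" if "\<tau>' \<in> triples M - {\<tau>}" for \<tau>'
  proof -
    have fin: "finite \<tau>" "finite \<tau>'" "\<tau>' \<noteq> {}" using triples_finite_nonempty \<tau> that by auto
    have "\<not> \<tau>' \<subseteq> \<tau>"
      using card_subset_eq[OF fin(1), of \<tau>'] \<tau> that by (auto simp: triples_def)
    then obtain v where v: "v \<in> \<tau>'" "v \<notin> \<tau>" by blast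
    have "\<tau>' \<subseteq> {..M}" using that by (simp add: triples_def)
    then have "v \<noteq> Suc M" using subsetD[of \<tau>' "{..M}" v] v(1) by auto
    then have "x v = 0" using s v(2) by (auto simp: support_def)
    then show ?thesis using Min_image_eq_0_iff[of x \<tau>', OF x fin(2,3)] v(1) by blast
  qed
  then show ?thesis unfolding depth_def
    using sum.remove[OF finite_triples \<tau>, of "\<lambda>\<tau>. Min (x ` \<tau>)"] by simp
qed

text \<open>The height \<open>x (Suc M) - depth M x\<close> vanishes on a disc bounded by the boundary of the triangle \<open>\<tau>\<close>;
  on that disc the planar part of the extension is a map of \<open>\<tau>\<close> that misses \<open>z\<close>.\<close>

lemma cone_extension:
  fixes c :: "(nat \<Rightarrow> real) \<Rightarrow> real ^ 2"
  assumes \<tau>: "\<tau> \<in> triples M" and c: "continuous_on (standard_simplex (Suc M)) c"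
    and z: "z \<notin> W_nonzero (face_boundary M \<tau>) c"
  obtains E where "continuous_on (face_real (Suc M) (insert (Suc M) \<tau>)) E"
    "\<And>x. x \<in> face_boundary (Suc M) (insert (Suc M) \<tau>) \<Longrightarrow> E x = in_space (c x) (x (Suc M) - depth M x)"
    "in_space z 0 \<notin> E ` face_real (Suc M) (insert (Suc M) \<tau>)"
proof -
  let ?s = "Suc M" and ?T = "face_real (Suc M) (insert (Suc M) \<tau>)" and ?B = "face_boundary (Suc M) (insert (Suc M) \<tau>)"
  have t: "\<tau> \<subseteq> {..M}" "card \<tau> = CARD(2) + 1" using \<tau> by (auto simp: triples_def)
  have t3: "card \<tau> = 3" using \<tau> by (auto simp: triples_def)
  have fin: "finite \<tau>" "\<tau> \<noteq> {}" using triples_finite_nonempty[OF \<tau>] by auto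
  have sn: "?s \<notin> \<tau>" using t(1) by auto
  obtain H where H: "continuous_on (face_real M \<tau>) H" "\<And>x. x \<in> face_boundary M \<tau> \<Longrightarrow> H x = c x"
    "z \<notin> H ` face_real M \<tau>"
    by (rule winding_zero_extends[OF t _ z]) (simp, rule that)
  have pos: "0 \<le> x i" if "x \<in> ?T" for x i using that by (simp add: face_real_def standard_simplex_def)
  \<comment> \<open>The weight of the apex is shared equally by the three vertices of
    \<open>\<tau>\<close>. This projects the cone to \<open>\<tau>\<close> and is the identity on
    \<open>\<tau>\<close>.\<close>
  define \<rho> :: "(nat \<Rightarrow> real) \<Rightarrow> nat \<Rightarrow> real" where "\<rho> x v = (if v \<in> \<tau> then x v + x ?s / 3 else 0)" for x v
  have sumT: "(\<Sum>v\<in>\<tau>. x v) + x ?s = 1" if "x \<in> ?T" for x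
  proof -
    have "(\<Sum>v\<in>insert ?s \<tau>. x v) = (\<Sum>v\<le>?s. x v)"
      using that t(1) by (intro sum.mono_neutral_left) (auto simp: face_real_def)
    then show ?thesis using that fin sn by (simp add: face_real_def standard_simplex_def)
  qed
  have \<rho>face: "\<rho> x \<in> face_real M \<tau>" if x: "x \<in> ?T" for x
  proof -
    have "(\<Sum>v\<le>M. \<rho> x v) = (\<Sum>v\<in>\<tau>. \<rho> x v)"
      using t(1) by (intro sum.mono_neutral_right) (auto simp: \<rho>_def)
    also have "\<dots> = (\<Sum>v\<in>\<tau>. x v + x ?s / 3)" by (intro sum.cong) (auto simp: \<rho>_def)
    also have "\<dots> = 1" using sumT[OF x] t3 by (simp add: sum.distrib)
    finally have "\<rho> x \<in> standard_simplex M"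
      using pos[OF x] t(1) by (intro standard_simplexI) (auto simp: \<rho>_def)
    then show ?thesis by (simp add: face_real_def \<rho>_def)
  qed
  \<comment> \<open>Only points of height zero are mapped into the plane. So the planar part has to
    be controlled on \<open>A\<close> and on the boundary, and Tietze extension supplies the
    rest.\<close>
  define A where "A = {x\<in>?T. x ?s - Min (x ` \<tau>) = 0}"
  define w0 where "w0 x = (if x \<in> ?B then c x else H (\<rho> x))" for x
  have cM: "continuous_on S (\<lambda>x::nat \<Rightarrow> real. x ?s - Min (x ` \<tau>))" for S
    by (intro continuous_on_diff continuous_on_coordinate continuous_on_Min_image fin)
  have BT: "?B \<subseteq> ?T" by (rule face_boundary_subset)
  have clA: "closed A"
  proof -
    have "A = ?T \<inter> (\<lambda>x. x ?s - Min (x ` \<tau>)) -` {0}" by (auto simp: A_def)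
    then show ?thesis using continuous_closed_preimage[OF cM closed_face_real closed_singleton] by simp
  qed
  have cB: "compact ?B" using fin by (intro compact_face_boundary) simp
  \<comment> \<open>The two prescriptions agree where they overlap: on the boundary of the cone some
    coordinate vanishes, and height zero then forces both the apex coordinate and some coordinate of
    \<open>\<tau>\<close> to vanish. Such a point lies on the boundary of \<open>\<tau>\<close>,
    where \<open>H\<close> equals \<open>c\<close>.\<close>
  have w0A: "w0 x = H (\<rho> x)" if x: "x \<in> A" for x
  proof (cases "x \<in> ?B")
    case True
    have xT: "x \<in> ?T" and eq: "x ?s = Min (x ` \<tau>)" using x by (auto simp: A_def)
    have "support x \<subset> insert ?s \<tau>" using True by (simp add: face_boundary_iff)
    then obtain v where v: "v \<in> insert ?s \<tau>" "x v = 0" by (auto simp: support_def)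
    then have s0: "x ?s = 0" using eq Min_image_eq_0_iff[OF pos[OF xT] fin] by auto
    then obtain u where u: "u \<in> \<tau>" "x u = 0" using eq Min_image_eq_0_iff[OF pos[OF xT] fin] by auto
    have \<rho>x: "\<rho> x = x"
    proof
      fix i
      show "\<rho> x i = x i"
        using s0 xT by (cases "i = ?s") (auto simp: \<rho>_def face_real_def)
    qed
    have "x \<in> standard_simplex M" "support x \<subseteq> \<tau>" using \<rho>face[OF xT] unfolding \<rho>x by (auto simp: face_real_iff)
    then have "x \<in> face_boundary M \<tau>" using u by (auto simp: face_boundary_iff support_def)
    then show ?thesis using H(2) True \<rho>x by (simp add: w0_def)
  qed (simp add: w0_def)
  have "continuous_on ?B w0"
  proof -
    have "continuous_on ?B c" using c by (rule continuous_on_subset) (use BT face_real_subset in blast)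
    then show ?thesis by (subst continuous_on_cong[OF refl, of _ _ c]) (simp_all add: w0_def)
  qed
  moreover have "continuous_on A w0"
  proof -
    have "continuous_on A \<rho>"
    proof (rule continuous_on_coordinatewise_then_product)
      show "continuous_on A (\<lambda>x. \<rho> x i)" for i
        unfolding \<rho>_def by (cases "i \<in> \<tau>") (auto intro!: continuous_intros continuous_on_coordinate)
    qed
    then have "continuous_on A (\<lambda>x. H (\<rho> x))"
      by (rule continuous_on_compose2[OF H(1)]) (use \<rho>face in \<open>auto simp: A_def\<close>)
    then show ?thesis using w0A by (subst continuous_on_cong[OF refl, of _ _ "\<lambda>x. H (\<rho> x)"]) simp_all
  qed
  ultimately have cw0: "continuous_on (?B \<union> A) w0"
    by (intro continuous_on_closed_Un compact_imp_closed cB clA)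
  have "compact (?B \<union> A)"
  proof (rule compact_Un[OF cB])
    have "A = ?T \<inter> A" by (auto simp: A_def)
    then show "compact A" using compact_Int_closed[OF compact_face_real clA, of ?s "insert ?s \<tau>"] by simp
  qed
  moreover have "?B \<union> A \<subseteq> ?T" using BT by (auto simp: A_def)
  ultimately obtain w where w: "continuous_on ?T w" "\<And>x. x \<in> ?B \<union> A \<Longrightarrow> w x = w0 x"
    by (rule Tietze_compact[OF _ _ cw0]) (rule that)
  show thesis
  proof (rule that[of "\<lambda>x. in_space (w x) (x ?s - Min (x ` \<tau>))"])
    show "continuous_on ?T (\<lambda>x. in_space (w x) (x ?s - Min (x ` \<tau>)))"
      by (intro continuous_on_in_space w(1) cM)
    show "in_space (w x) (x ?s - Min (x ` \<tau>)) = in_space (c x) (x ?s - depth M x)" if x: "x \<in> ?B" for x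
    proof -
      have xT: "x \<in> ?T" using x BT by blast
      then have "support x \<subseteq> insert ?s \<tau>" by (simp add: face_real_iff)
      then have "depth M x = Min (x ` \<tau>)" by (rule depth_on_cone[OF pos[OF xT] \<tau>])
      moreover have "w x = c x" using w(2)[of x] x by (simp add: w0_def)
      ultimately show ?thesis by simp
    qed
    show "in_space z 0 \<notin> (\<lambda>x. in_space (w x) (x ?s - Min (x ` \<tau>))) ` ?T"
    proof
      assume "in_space z 0 \<in> (\<lambda>x. in_space (w x) (x ?s - Min (x ` \<tau>))) ` ?T"
      then obtain x where x: "x \<in> ?T" "z = w x" "x ?s - Min (x ` \<tau>) = 0" by (auto simp: in_space_eq_iff)
      then have "x \<in> A" by (simp add: A_def)
      then have "z = H (\<rho> x)" using x(2) w(2)[of x] w0A by simp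
      then show False using H(3) \<rho>face[OF x(1)] by blast
    qed
  qed
qed

section \<open>Collapsing the additional vertices to one apex\<close>

definition collapse :: "nat \<Rightarrow> nat \<Rightarrow> (nat \<Rightarrow> real) \<Rightarrow> nat \<Rightarrow> real" where
  "collapse M N x i = (if i \<le> M then x i else if i = Suc M then \<Sum>j=Suc M..N. x j else 0)"

lemma continuous_on_collapse: "continuous_on S (collapse M N)"
proof (rule continuous_on_coordinatewise_then_product)
  fix i
  show "continuous_on S (\<lambda>x. collapse M N x i)"
    unfolding collapse_def
    by (cases "i \<le> M"; cases "i = Suc M") (auto intro!: continuous_on_sum continuous_on_coordinate)
qed

lemma collapse_in_simplex:
  assumes "x \<in> standard_simplex N" "M \<le> N"
  shows "collapse M N x \<in> standard_simplex (Suc M)"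
proof (rule standard_simplexI)
  show "0 \<le> collapse M N x i" for i
    using assms(1) by (simp add: collapse_def standard_simplex_def sum_nonneg)
  show "collapse M N x i = 0" if "i > Suc M" for i using that by (simp add: collapse_def)
  have "(\<Sum>i\<le>Suc M. collapse M N x i) = (\<Sum>i\<le>M. x i) + (\<Sum>j=Suc M..N. x j)"
    by (simp add: collapse_def)
  also have "\<dots> = (\<Sum>i\<in>{..M} \<union> {Suc M..N}. x i)" by (intro sum.union_disjoint[symmetric]) auto
  also have "{..M} \<union> {Suc M..N} = {..N}" using assms(2) by auto
  finally show "(\<Sum>i\<le>Suc M. collapse M N x i) = 1" using assms(1) by (simp add: standard_simplex_def)
qed

lemma collapse_support: "support (collapse M N x) \<inter> {..M} = support x \<inter> {..M}"
  by (auto simp: support_def collapse_def)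

lemma collapse_extra:
  assumes "support x \<subseteq> {..M}"
  shows "collapse M N x (Suc M) = 0"
  unfolding collapse_def using assms by (auto simp: support_def intro!: sum.neutral)

theorem tverberg_winding_extension_plane:
  fixes f :: "(nat \<Rightarrow> real) \<Rightarrow> real ^ 2"
  assumes q: "q \<ge> 1" and M: "M = 3 * (q - 1)" and N: "N = 4 * (q - 1)"
    and f: "continuous_on (skeleton M 1) f" and \<epsilon>: "\<epsilon> > 0"
  obtains f' :: "(nat \<Rightarrow> real) \<Rightarrow> real ^ 2" and F :: "(nat \<Rightarrow> real) \<Rightarrow> real ^ 3"
  where "continuous_on (skeleton M 1) f'" "\<forall>x\<in>skeleton M 1. dist (f' x) (f x) < \<epsilon>"
    "continuous_on (standard_simplex N) F" "\<forall>x\<in>skeleton M 1. F x = plane_in_space (f' x)"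
    "\<forall>P. tverberg_partition N N q F P \<longrightarrow> winding_partition M q f ((\<lambda>\<sigma>. \<sigma> \<inter> {..M}) ` P)"
proof -
  let ?s = "Suc M"
  have MN: "M \<le> N" by (simp add: M N)
  have two: "CARD(2) \<ge> 2" "CARD(2) - 1 = 1" by simp_all
  note stable = winding_partition_stable[where 'n = 2 and N = M and q = q, unfolded two(2), OF two(1) f]
  obtain \<delta> where \<delta>: "\<delta> > 0" "\<And>f' P. continuous_on (skeleton M 1) f' \<Longrightarrow>
      (\<And>x. x \<in> skeleton M 1 \<Longrightarrow> dist (f' x) (f x) < \<delta>) \<Longrightarrow>
      winding_partition M q f' P \<Longrightarrow> winding_partition M q f P"
    by (rule stable) (rule that, assumption, blast)
  have "min \<epsilon> \<delta> > 0" using \<epsilon> \<delta>(1) by simp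
  note perturb = general_position_perturbation[OF f this, unfolded DIM_cart DIM_real mult_1_right]
  obtain f' :: "(nat \<Rightarrow> real) \<Rightarrow> real ^ 2" where
    f': "continuous_on (standard_simplex M) f'" "\<And>x. x \<in> skeleton M 1 \<Longrightarrow> dist (f' x) (f x) < min \<epsilon> \<delta>"
    and Z: "finite (intersection_points M f')"
    and gp: "\<forall>\<T> p. \<T> \<subseteq> skeleton_faces M CARD(2) \<longrightarrow> pairwise disjnt \<T> \<longrightarrow>
       CARD(2) \<le> (\<Sum>\<tau>\<in>\<T>. CARD(2) + 1 - card \<tau>) \<longrightarrow> (\<forall>\<tau>\<in>\<T>. p \<in> f' ` face_real M \<tau>) \<longrightarrow>
       (\<Sum>\<tau>\<in>\<T>. CARD(2) + 1 - card \<tau>) = CARD(2) \<and> p \<in> intersection_points M f'"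
    by (rule perturb) (rule that)
  have MS: "standard_simplex M \<subseteq> standard_simplex ?s" by (rule standard_simplex_mono) simp
  obtain c where c: "continuous_on (standard_simplex ?s) c" "\<And>x. x \<in> standard_simplex M \<Longrightarrow> c x = f' x"
    by (rule Tietze_compact[OF compact_standard_simplex MS f'(1)]) (rule that)
  \<comment> \<open>Off the base simplex the values of \<open>c\<close> are unspecified. On cones
    over edges this does no harm: the depth is zero there, so the height is positive away from the
    base.\<close>
  define F0 where "F0 x = in_space (c x) (x ?s - depth M x)" for x
  have cF0: "continuous_on (standard_simplex ?s) F0"
    unfolding F0_def by (intro continuous_on_in_space c(1) continuous_on_diff continuous_on_coordinate continuous_on_depth)
  let ?T = "\<lambda>\<tau>. face_real ?s (insert ?s \<tau>)" and ?B = "\<lambda>\<tau>. face_boundary ?s (insert ?s \<tau>)"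
  \<comment> \<open>The candidates about which the boundary of \<open>\<tau>\<close> has winding
    number zero, placed in the plane; the filling of the cone over \<open>\<tau>\<close> has to miss
    them.\<close>
  define Y where "Y \<tau> = (\<lambda>z. in_space z 0) ` (intersection_points M f' - W_nonzero (face_boundary M \<tau>) c)" for \<tau>
  define G where "G \<tau> = (SOME G. continuous_on (?T \<tau>) G \<and> (\<forall>x\<in>?B \<tau>. G x = F0 x) \<and> G ` ?T \<tau> \<inter> Y \<tau> = {})" for \<tau>
  have G: "continuous_on (?T \<tau>) (G \<tau>)" "\<And>x. x \<in> ?B \<tau> \<Longrightarrow> G \<tau> x = F0 x" "G \<tau> ` ?T \<tau> \<inter> Y \<tau> = {}"
    if \<tau>: "\<tau> \<in> triples M" for \<tau>
  proof -
    have t: "\<tau> \<subseteq> {..M}" "card \<tau> = 3" "finite \<tau>"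
      using \<tau> triples_finite_nonempty[OF \<tau>] by (simp_all add: triples_def)
    then have "?s \<notin> \<tau>" by (meson Suc_n_not_le_n atMost_iff subsetD)
    then have ins: "insert ?s \<tau> \<subseteq> {..?s}" "card (insert ?s \<tau>) = CARD(3) + 1"
      using subset_insertI2[OF t(1), of ?s] t by (simp_all add: atMost_Suc)
    have cB: "continuous_on (?B \<tau>) F0"
      using cF0 by (rule continuous_on_subset) (use face_boundary_subset face_real_subset in blast)
    have finY: "finite (Y \<tau>)" using Z by (simp add: Y_def)
    have ex: "\<exists>G. continuous_on (?T \<tau>) G \<and> (\<forall>x\<in>?B \<tau>. G x = F0 x) \<and> y \<notin> G ` ?T \<tau>" if y: "y \<in> Y \<tau>" for y
    proof -
      obtain z where z: "y = in_space z 0" "z \<notin> W_nonzero (face_boundary M \<tau>) c" using y by (auto simp: Y_def)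
      obtain E where "continuous_on (?T \<tau>) E" "\<And>x. x \<in> ?B \<tau> \<Longrightarrow> E x = in_space (c x) (x ?s - depth M x)"
        "in_space z 0 \<notin> E ` ?T \<tau>"
        by (rule cone_extension[OF \<tau> c(1) z(2)]) (rule that)
      then show ?thesis unfolding z(1) F0_def by (intro exI[of _ E] conjI ballI)
    qed
    have three: "CARD(3) \<ge> 3" by simp
    obtain G' where "continuous_on (?T \<tau>) G'" "\<And>x. x \<in> ?B \<tau> \<Longrightarrow> G' x = F0 x" "G' ` ?T \<tau> \<inter> Y \<tau> = {}"
      by (rule face_extension_avoiding_finite[OF ins three cB finY ex]) (assumption, rule that)
    then have "\<exists>G. continuous_on (?T \<tau>) G \<and> (\<forall>x\<in>?B \<tau>. G x = F0 x) \<and> G ` ?T \<tau> \<inter> Y \<tau> = {}"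
      by (intro exI[of _ G'] conjI ballI)
    from someI_ex[OF this]
    show "continuous_on (?T \<tau>) (G \<tau>)" "\<And>x. x \<in> ?B \<tau> \<Longrightarrow> G \<tau> x = F0 x" "G \<tau> ` ?T \<tau> \<inter> Y \<tau> = {}"
      unfolding G_def[symmetric] by blast+
  qed
  define F1 where "F1 x = (if card (support x) = 4 \<and> ?s \<in> support x then G (support x - {?s}) x else F0 x)" for x
  \<comment> \<open>The base enters as a single piece whatever its dimension, because the height has
    to be nonpositive on all of it. The other pieces include the cones over edges and over
    triangles.\<close>
  define I where "I = insert {..M} (skeleton_faces ?s 3)"
  define g where "g \<sigma> = (if card \<sigma> = 4 \<and> ?s \<in> \<sigma> then G (\<sigma> - {?s}) else F0)" for \<sigma>
  have cone: "\<sigma> - {?s} \<in> triples M \<and> \<sigma> = insert ?s (\<sigma> - {?s})" if "\<sigma> \<subseteq> {..?s}" "card \<sigma> = 4" "?s \<in> \<sigma>" for \<sigma>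
  proof -
    have "finite \<sigma>" using that(1) by (rule finite_subset) simp
    then have "card (\<sigma> - {?s}) = 3" using that by simp
    moreover have "\<sigma> - {?s} \<subseteq> {..M}"
    proof
      fix i assume "i \<in> \<sigma> - {?s}"
      then have "i \<le> Suc M" "i \<noteq> Suc M" using that(1) by auto
      then show "i \<in> {..M}" by simp
    qed
    ultimately show ?thesis using that(3) by (auto simp: triples_def)
  qed
  have F1g: "F1 x = g \<sigma> x" if \<sigma>: "\<sigma> \<in> I" and x: "x \<in> face_real ?s \<sigma>" for \<sigma> x
  proof -
    have sx: "support x \<subseteq> \<sigma>" "x \<in> standard_simplex ?s" using x by (auto simp: face_real_iff)
    show ?thesis
    proof (cases "support x = \<sigma>")
      case True
      then show ?thesis by (simp add: F1_def g_def)
    next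
      case ne: False
      show ?thesis
      proof (cases "\<sigma> = {..M}")
        case True
        then have "?s \<notin> support x" "?s \<notin> \<sigma>" using sx by auto
        then show ?thesis by (simp add: F1_def g_def)
      next
        case False
        then have s: "\<sigma> \<subseteq> {..?s}" "finite \<sigma>" "card \<sigma> \<le> 4" using \<sigma> by (auto simp: I_def skeleton_faces_def intro: finite_subset)
        have lt: "card (support x) < card \<sigma>" using sx s(2) ne by (auto intro: psubset_card_mono)
        then have F1: "F1 x = F0 x" using s(3) by (simp add: F1_def)
        show ?thesis
        proof (cases "card \<sigma> = 4 \<and> ?s \<in> \<sigma>")
          case True
          note co = cone[OF s(1)] 
          have "x \<in> face_boundary ?s \<sigma>" using sx ne by (auto simp: face_boundary_iff)
          then have "x \<in> ?B (\<sigma> - {?s})" using True by (simp add: insert_absorb)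
          then have "G (\<sigma> - {?s}) x = F0 x" using G(2) co True by blast
          then show ?thesis using F1 True by (simp add: g_def)
        qed (auto simp: F1 g_def)
      qed
    qed
  qed
  have finI: "finite I" by (simp add: I_def finite_skeleton_faces)
  have cF1: "continuous_on (\<Union>\<sigma>\<in>I. face_real ?s \<sigma>) F1"
  proof (rule continuous_on_glue[OF finI, where g = g])
    show "closed (face_real ?s \<sigma>)" for \<sigma> by (rule closed_face_real)
    show "continuous_on (face_real ?s \<sigma>) (g \<sigma>)" if \<sigma>: "\<sigma> \<in> I" for \<sigma>
    proof (cases "card \<sigma> = 4 \<and> ?s \<in> \<sigma>")
      case True
      then have "\<sigma> \<noteq> {..M}" by auto
      then have "\<sigma> \<subseteq> {..?s}" using \<sigma> by (auto simp: I_def skeleton_faces_def)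
      then have "\<sigma> - {?s} \<in> triples M" using cone True by blast
      from G(1)[OF this] show ?thesis using True by (simp add: g_def insert_absorb)
    next
      case False
      then have "g \<sigma> = F0" by (auto simp: g_def)
      then show ?thesis using continuous_on_subset[OF cF0 face_real_subset] by simp
    qed
  qed (rule F1g)
  have cI: "compact (\<Union>\<sigma>\<in>I. face_real ?s \<sigma>)" by (intro compact_UN finI compact_face_real)
  have subI: "(\<Union>\<sigma>\<in>I. face_real ?s \<sigma>) \<subseteq> standard_simplex ?s" using face_real_subset by blast
  obtain F2 where F2: "continuous_on (standard_simplex ?s) F2" "\<And>x. x \<in> (\<Union>\<sigma>\<in>I. face_real ?s \<sigma>) \<Longrightarrow> F2 x = F1 x"
    by (rule Tietze_compact[OF cI subI cF1]) (rule that)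
  have pos: "0 \<le> x i" if "x \<in> standard_simplex p" for x :: "nat \<Rightarrow> real" and p i using that by (simp add: standard_simplex_def)
  have inM: "x \<in> standard_simplex M" if "x \<in> standard_simplex ?s" "x ?s = 0" for x
    using that by (intro standard_simplexI) (auto simp: standard_simplex_def not_less_eq dest: Suc_lessI)
  have F2_M: "F2 x = in_space (f' x) (- depth M x)" if x: "x \<in> standard_simplex ?s" "x ?s = 0" for x
  proof -
    have "x \<in> face_real ?s {..M}"
      using x inM[OF x] by (auto simp: face_real_def standard_simplex_def)
    then have "F2 x = F1 x" using F2(2) by (auto simp: I_def)
    moreover have "?s \<notin> support x" using x(2) by (simp add: support_def)
    ultimately show ?thesis using c(2)[OF inM[OF x]] x(2) by (simp add: F1_def F0_def)
  qed
  have F2_low: "F2 x = in_space (c x) (x ?s)" if x: "x \<in> standard_simplex ?s" "card (support x \<inter> {..M}) \<le> 2" for x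
  proof -
    have "support x \<subseteq> insert ?s (support x \<inter> {..M})"
    proof
      fix i assume i: "i \<in> support x"
      then have "i \<le> Suc M" using support_simplex(1)[OF x(1)] by auto
      then show "i \<in> insert ?s (support x \<inter> {..M})" using i by (cases "i = Suc M") auto
    qed
    then have "card (support x) \<le> card (insert ?s (support x \<inter> {..M}))" by (intro card_mono) auto
    also have "\<dots> \<le> 3" using x(2) by (simp add: card_insert_if)
    finally have s3: "card (support x) \<le> 3" .
    then have "support x \<in> skeleton_faces ?s 3" "x \<in> face_real ?s (support x)"
      using support_simplex[OF x(1)] x(1) by (auto simp: skeleton_faces_def face_real_iff)
    then have "F2 x = F1 x" using F2(2) by (auto simp: I_def)
    then show ?thesis using s3 depth_eq_0[OF pos[OF x(1)] x(2)] by (simp add: F1_def F0_def)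
  qed
  define F where "F x = F2 (collapse M N x)" for x
  show thesis
  proof (rule that[of f' F])
    show cf's: "continuous_on (skeleton M 1) f'" using f'(1) skeleton_subset by (rule continuous_on_subset)
    show "\<forall>x\<in>skeleton M 1. dist (f' x) (f x) < \<epsilon>" using f'(2) by simp
    show "continuous_on (standard_simplex N) F"
      unfolding F_def by (rule continuous_on_compose2[OF F2(1) continuous_on_collapse]) (use collapse_in_simplex[OF _ MN] in blast)
    show "\<forall>x\<in>skeleton M 1. F x = plane_in_space (f' x)"
    proof
      fix x assume "x \<in> skeleton M 1"
      then have x: "x \<in> standard_simplex M" "card (support x) \<le> 2" by (simp_all add: skeleton_iff)
      have sM: "support x \<subseteq> {..M}" using support_simplex(1)[OF x(1)] .
      have col: "collapse M N x = x"
      proof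
        fix i
        show "collapse M N x i = x i"
          using collapse_extra[OF sM, of N] x(1) by (auto simp: collapse_def standard_simplex_def)
      qed
      have x0: "x ?s = 0" using x(1) by (simp add: standard_simplex_def)
      have "support x \<inter> {..M} = support x" using sM by blast
      then have "depth M x = 0" using x(2) by (intro depth_eq_0[OF pos[OF x(1)]]) simp
      then show "F x = plane_in_space (f' x)"
        unfolding F_def col plane_in_space_eq using F2_M[OF subsetD[OF MS x(1)] x0] by simp
    qed
    show "\<forall>P. tverberg_partition N N q F P \<longrightarrow> winding_partition M q f ((\<lambda>\<sigma>. \<sigma> \<inter> {..M}) ` P)"
    proof (intro allI impI)
      fix P assume T: "tverberg_partition N N q F P"
      then have P: "P \<subseteq> skeleton_faces N N" "card P = q" "pairwise disjnt P" by (simp_all add: tverberg_partition_def)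
      obtain p where p: "\<And>\<sigma>. \<sigma> \<in> P \<Longrightarrow> p \<in> F ` face_real N \<sigma>" using T by (auto simp: tverberg_partition_def)
      have finP: "finite P" using P(1) finite_skeleton_faces by (rule finite_subset)
      define t where "t \<sigma> = \<sigma> \<inter> {..M}" for \<sigma> :: "nat set"
      define z :: "real ^ 2" where "z = (\<chi> i. if i = 1 then p $ 1 else p $ 2)"
      have pz: "p = in_space z (p $ 3)" by (simp add: vec_eq_iff forall_3 z_def)
      have ex: "\<exists>y. y \<in> standard_simplex ?s \<and> F2 y = p \<and> support y \<inter> {..M} \<subseteq> t \<sigma> \<and> (\<sigma> \<subseteq> {..M} \<longrightarrow> y ?s = 0)"
        if \<sigma>: "\<sigma> \<in> P" for \<sigma>
      proof -
        obtain x where x: "x \<in> face_real N \<sigma>" "p = F x" using p[OF \<sigma>] by blast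
        then have xs: "x \<in> standard_simplex N" "support x \<subseteq> \<sigma>" by (simp_all add: face_real_iff)
        show ?thesis
          using collapse_in_simplex[OF xs(1) MN] x(2) collapse_support[of M N x] xs(2) collapse_extra[of x M N]
          by (intro exI[of _ "collapse M N x"]) (auto simp: F_def t_def)
      qed
      define y where "y \<sigma> = (SOME y. y \<in> standard_simplex ?s \<and> F2 y = p \<and> support y \<inter> {..M} \<subseteq> t \<sigma> \<and>
          (\<sigma> \<subseteq> {..M} \<longrightarrow> y ?s = 0))" for \<sigma>
      have y: "y \<sigma> \<in> standard_simplex ?s" "F2 (y \<sigma>) = p" "support (y \<sigma>) \<inter> {..M} \<subseteq> t \<sigma>"
        "\<sigma> \<subseteq> {..M} \<Longrightarrow> y \<sigma> ?s = 0" if "\<sigma> \<in> P" for \<sigma>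
        using someI_ex[OF ex[OF that]] unfolding y_def[symmetric] by simp_all
      \<comment> \<open>There are \<open>q\<close> disjoint faces but only
        \<open>N - M = q - 1\<close> additional vertices. On a face without any of these the height
        is minus the depth.\<close>
      obtain \<sigma>0 where \<sigma>0: "\<sigma>0 \<in> P" "\<sigma>0 \<subseteq> {..M}"
      proof -
        have "\<exists>\<sigma>\<in>P. \<sigma> \<subseteq> {..M}"
        proof (rule ccontr)
          assume "\<not> (\<exists>\<sigma>\<in>P. \<sigma> \<subseteq> {..M})"
          then have no: "\<not> \<sigma> \<subseteq> {..M}" if "\<sigma> \<in> P" for \<sigma> using that by blast
          have "1 \<le> card (\<sigma> \<inter> {Suc M..N})" if "\<sigma> \<in> P" for \<sigma>
          proof -
            obtain i where "i \<in> \<sigma>" "\<not> i \<le> M" using no[OF \<open>\<sigma> \<in> P\<close>] by auto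
            moreover have "\<sigma> \<subseteq> {..N}" using P(1) \<open>\<sigma> \<in> P\<close> by (auto simp: skeleton_faces_def)
            ultimately have "i \<in> \<sigma> \<inter> {Suc M..N}" by auto
            then have "\<sigma> \<inter> {Suc M..N} \<noteq> {}" by blast
            then show ?thesis by (simp add: Suc_le_eq card_gt_0_iff)
          qed
          then have "(\<Sum>\<sigma>\<in>P. 1) \<le> (\<Sum>\<sigma>\<in>P. card (\<sigma> \<inter> {Suc M..N}))" by (rule sum_mono)
          also have "\<dots> \<le> N - M" using sum_card_Int_le[OF finP P(3), of "{Suc M..N}"] by simp
          finally have "q \<le> N - M" using P(2) by simp
          moreover have "N - M = q - 1" unfolding M N by simp
          ultimately show False using q by linarith
        qed
        then show thesis using that by (elim bexE)
      qed
      have "p $ 3 \<le> 0"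
      proof -
        have "p = in_space (f' (y \<sigma>0)) (- depth M (y \<sigma>0))"
          using F2_M[OF y(1)[OF \<sigma>0(1)] y(4)[OF \<sigma>0]] y(2)[OF \<sigma>0(1)] by simp
        then have "p $ 3 = - depth M (y \<sigma>0)" by simp
        then show ?thesis using depth_nonneg[OF pos[OF y(1)[OF \<sigma>0(1)]], of M] by simp
      qed
      have sumt: "(\<Sum>\<sigma>\<in>P. card (t \<sigma>)) \<le> (2 + 1) * (q - 1) + 1"
        using sum_card_Int_le[OF finP P(3), of "{..M}"] by (simp add: t_def M)
      define L where "L = {\<sigma>\<in>P. card (t \<sigma>) \<le> 2}"
      have ge: "2 \<le> (\<Sum>\<sigma>\<in>L. 2 + 1 - card (t \<sigma>))"
        unfolding L_def by (rule codimension_count(1)[OF finP P(2) q sumt])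
      have fint: "finite (t \<sigma>)" for \<sigma> by (simp add: t_def)
      have ylow: "F2 (y \<sigma>) = in_space (c (y \<sigma>)) (y \<sigma> ?s)" if "\<sigma> \<in> L" for \<sigma>
      proof -
        have s: "\<sigma> \<in> P" "card (t \<sigma>) \<le> 2" using that by (auto simp: L_def)
        have "card (support (y \<sigma>) \<inter> {..M}) \<le> 2" using card_mono[OF fint y(3)[OF s(1)]] s(2) by linarith
        then show ?thesis by (rule F2_low[OF y(1)[OF s(1)]])
      qed
      \<comment> \<open>A total codimension of at least two forces some face to have at most two
        vertices in the base. The depth vanishes there, so the height is the apex coordinate and
        cannot be negative.\<close>
      have p3: "p $ 3 = 0"
      proof -
        have "L \<noteq> {}" using ge by auto
        then obtain \<sigma> where \<sigma>: "\<sigma> \<in> L" by blast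
        then have "\<sigma> \<in> P" by (simp add: L_def)
        then have "p $ 3 = y \<sigma> ?s" using ylow[OF \<sigma>] y(2) by simp
        then show ?thesis using pos[OF y(1)[OF \<open>\<sigma> \<in> P\<close>], of ?s] \<open>p $ 3 \<le> 0\<close> by simp
      qed
      have pz0: "p = in_space z 0" using pz p3 by simp
      have planar: "y \<sigma> \<in> standard_simplex M \<and> support (y \<sigma>) \<subseteq> t \<sigma> \<and> f' (y \<sigma>) = z"
        if \<sigma>: "\<sigma> \<in> P" "y \<sigma> ?s = 0" for \<sigma>
      proof -
        have yM: "y \<sigma> \<in> standard_simplex M" by (rule inM[OF y(1)[OF \<sigma>(1)] \<sigma>(2)])
        then have "support (y \<sigma>) \<subseteq> t \<sigma>" using y(3)[OF \<sigma>(1)] support_simplex(1)[OF yM] by blast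
        moreover have "f' (y \<sigma>) = z"
          using F2_M[OF y(1)[OF \<sigma>(1)] \<sigma>(2)] y(2)[OF \<sigma>(1)] pz0 by (simp add: in_space_eq_iff)
        ultimately show ?thesis using yM by blast
      qed
      have low: "z \<in> f' ` face_real M (t \<sigma>) \<and> t \<sigma> \<noteq> {}" if \<sigma>: "\<sigma> \<in> L" for \<sigma>
      proof -
        have sP: "\<sigma> \<in> P" using \<sigma> by (simp add: L_def)
        have "y \<sigma> ?s = 0" using ylow[OF \<sigma>] y(2)[OF sP] pz0 by (simp add: in_space_eq_iff)
        note pl = planar[OF sP this]
        then have "y \<sigma> \<in> face_real M (t \<sigma>)" by (simp add: face_real_iff)
        moreover have "support (y \<sigma>) \<noteq> {}" using pl support_simplex(3) by blast
        ultimately show ?thesis using pl by blast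
      qed
      \<comment> \<open>A face without vertices in the base would belong to \<open>L\<close>. For
        members of \<open>L\<close> the common point is attained in the base, which is impossible
        with empty support.\<close>
      have tne: "t \<sigma> \<noteq> {}" if "\<sigma> \<in> P" for \<sigma>
        using low[of \<sigma>] that by (cases "card (t \<sigma>) \<le> 2") (auto simp: L_def)
      have tdisj: "disjnt (t \<sigma>) (t \<sigma>')" if "\<sigma> \<in> P" "\<sigma>' \<in> P" "\<sigma> \<noteq> \<sigma>'" for \<sigma> \<sigma>'
        using P(3) that by (auto simp: pairwise_def disjnt_def t_def)
      have inj: "inj_on t P"
      proof (rule inj_onI, rule ccontr)
        fix \<sigma> \<sigma>' assume *: "\<sigma> \<in> P" "\<sigma>' \<in> P" "t \<sigma> = t \<sigma>'" "\<sigma> \<noteq> \<sigma>'"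
        then show False using tdisj[OF *(1,2,4)] tne[OF *(1)] by (simp add: disjnt_def)
      qed
      have disj: "pairwise disjnt (t ` P)" using tdisj by (auto simp: pairwise_def)
      have LP: "L \<subseteq> P" by (auto simp: L_def)
      have sums: "(\<Sum>\<tau>\<in>t ` L. CARD(2) + 1 - card \<tau>) = (\<Sum>\<sigma>\<in>L. 2 + 1 - card (t \<sigma>))"
        using sum.reindex[OF inj_on_subset[OF inj LP], of "\<lambda>\<tau>. CARD(2) + 1 - card \<tau>"] by (simp add: o_def)
      have gp1: "t ` L \<subseteq> skeleton_faces M CARD(2)" using low by (auto simp: skeleton_faces_def t_def L_def)
      have gp2: "pairwise disjnt (t ` L)" using disj by (rule pairwise_subset) (use LP in blast)
      have gp3: "CARD(2) \<le> (\<Sum>\<tau>\<in>t ` L. CARD(2) + 1 - card \<tau>)" unfolding sums using ge by simp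
      have eq: "(\<Sum>\<sigma>\<in>L. 2 + 1 - card (t \<sigma>)) = 2" and zZ: "z \<in> intersection_points M f'"
        using gp[rule_format, OF gp1 gp2 gp3, of z] low unfolding sums by auto
      have le: "card (t \<sigma>) \<le> 3" if "\<sigma> \<in> P" for \<sigma>
        using codimension_count(2)[OF finP P(2) q sumt that] eq unfolding L_def by fastforce
      have "winding_partition M q f' (t ` P)"
        unfolding winding_partition_iff
      proof (intro conjI exI ballI)
        show "t ` P \<subseteq> skeleton_faces M CARD(2)" using le tne by (auto simp: skeleton_faces_def t_def)
        show "card (t ` P) = q" using card_image[OF inj] P(2) by simp
        show "pairwise disjnt (t ` P)" by fact
        fix \<tau> assume "\<tau> \<in> t ` P"
        then obtain \<sigma> where \<sigma>: "\<sigma> \<in> P" "\<tau> = t \<sigma>" by blast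
        show "z \<in> winding_target M f' \<tau>"
        proof (cases "card \<tau> \<le> 2")
          case True
          then have "\<sigma> \<in> L" using \<sigma> by (simp add: L_def)
          then show ?thesis using low[of \<sigma>] True \<sigma> by (simp add: winding_target_def)
        next
          case False
          then have t3: "card \<tau> = 3" using le \<sigma> by force
          then have tri: "\<tau> \<in> triples M" using \<sigma>(2) by (simp add: triples_def t_def)
          have fin\<tau>: "finite \<tau>" "\<tau> \<noteq> {}" using triples_finite_nonempty[OF tri] by auto
          have sn: "?s \<notin> \<tau>" using \<sigma>(2) by (simp add: t_def)
          let ?y = "y \<sigma>"
          have ys: "?y \<in> standard_simplex ?s" using y(1) \<sigma>(1) by blast
          have sup: "support ?y \<subseteq> insert ?s \<tau>"
          proof
            fix i assume i: "i \<in> support ?y"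
            then have "i \<le> Suc M" using support_simplex(1)[OF ys] by auto
            then show "i \<in> insert ?s \<tau>" using i y(3)[OF \<sigma>(1)] \<sigma>(2) by (cases "i = Suc M") auto
          qed
          then have yT: "?y \<in> ?T \<tau>" using ys by (simp add: face_real_iff)
          have "card (insert ?s \<tau>) = 4" using t3 sn fin\<tau> by simp
          moreover have "\<tau> \<subseteq> {..M}" using tri by (simp add: triples_def)
          then have "insert ?s \<tau> \<subseteq> {..?s}" using subset_insertI2[of \<tau> "{..M}" ?s] by (simp add: atMost_Suc)
          ultimately have Tsk: "insert ?s \<tau> \<in> I" by (simp add: I_def skeleton_faces_def)
          then have F21: "F2 ?y = F1 ?y" using F2(2) yT by blast
          \<comment> \<open>In the interior of the cone the filling was chosen to miss candidates of
            winding number zero. On the boundary of the cone the point has height zero, which forces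
            it onto the boundary of \<open>\<tau>\<close>, so that \<open>z\<close> is a boundary
            value.\<close>
          have W: "z \<in> W_nonzero (face_boundary M \<tau>) f'"
          proof (cases "support ?y = insert ?s \<tau>")
            case True
            then have "F1 ?y = G \<tau> ?y" using t3 sn fin\<tau> by (simp add: F1_def)
            then have "p \<in> G \<tau> ` ?T \<tau>" using F21 y(2)[OF \<sigma>(1)] yT by auto
            then have "p \<notin> Y \<tau>" using G(3)[OF tri] by blast
            then have zc: "z \<in> W_nonzero (face_boundary M \<tau>) c" using zZ unfolding Y_def pz0 by blast
            \<comment> \<open>As \<open>c\<close> and \<open>f'\<close> agree on the boundary, a
              filling of \<open>f'\<close> missing \<open>z\<close> is also one of \<open>c\<close>;
              this takes the nonzero winding number from \<open>c\<close> to
              \<open>f'\<close>.\<close>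
            have cf: "c x = f' x" if "x \<in> face_boundary M \<tau>" for x using c(2) that by (simp add: face_boundary_iff)
            show ?thesis
            proof (rule ccontr)
              assume no: "z \<notin> W_nonzero (face_boundary M \<tau>) f'"
              have tt: "\<tau> \<subseteq> {..M}" "card \<tau> = CARD(2) + 1" using tri by (simp_all add: triples_def)
              obtain H where H: "continuous_on (face_real M \<tau>) H" "\<And>x. x \<in> face_boundary M \<tau> \<Longrightarrow> H x = f' x"
                "z \<notin> H ` face_real M \<tau>"
                by (rule winding_zero_extends[OF tt two(1) no]) (rule that)
              have "W_nonzero (face_boundary M \<tau>) c \<subseteq> H ` face_real M \<tau>"
                by (rule W_nonzero_subset_extension[OF tt H(1)]) (simp add: H(2) cf)
              then show False using zc H(3) by blast
            qed
          next
            case False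
            have "card (support ?y) < 4"
              using psubset_card_mono[of "insert ?s \<tau>" "support ?y"] sup False fin\<tau> sn t3 by auto
            then have "F1 ?y = F0 ?y" by (simp add: F1_def)
            then have dep: "?y ?s = depth M ?y"
              using F21 y(2)[OF \<sigma>(1)] pz0 by (simp add: F0_def in_space_eq_iff)
            have depM: "depth M ?y = Min (?y ` \<tau>)" by (rule depth_on_cone[OF pos[OF ys] tri sup])
            have "\<exists>v\<in>\<tau>. ?y v = 0"
            proof (rule ccontr)
              assume "\<not> (\<exists>v\<in>\<tau>. ?y v = 0)"
              then have "\<tau> \<subseteq> support ?y" by (auto simp: support_def)
              then have "?s \<notin> support ?y" using sup False by blast
              then have "Min (?y ` \<tau>) = 0" using dep depM by (simp add: support_def)
              then show False using Min_image_eq_0_iff[of ?y \<tau>, OF pos[OF ys] fin\<tau>] \<open>\<not> (\<exists>v\<in>\<tau>. ?y v = 0)\<close> by blast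
            qed
            then obtain v where v: "v \<in> \<tau>" "?y v = 0" by blast
            then have "Min (?y ` \<tau>) = 0" using Min_image_eq_0_iff[of ?y \<tau>, OF pos[OF ys] fin\<tau>] by blast
            then have "?y ?s = 0" using dep depM by simp
            note pl = planar[OF \<sigma>(1) this]
            have "support ?y \<noteq> \<tau>" using v by (auto simp: support_def)
            then have "?y \<in> face_boundary M \<tau>" using pl \<sigma>(2) by (auto simp: face_boundary_iff)
            then show ?thesis using pl by (auto simp: W_nonzero_def)
          qed
          show ?thesis using W t3 by (simp add: winding_target_def)
        qed
      qed
      then have "winding_partition M q f (t ` P)" using \<delta>(2)[OF cf's, of "t ` P"] f'(2) by simp
      moreover have "t = (\<lambda>\<sigma>. \<sigma> \<inter> {..M})" by (simp add: t_def fun_eq_iff)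
      ultimately show "winding_partition M q f ((\<lambda>\<sigma>. \<sigma> \<inter> {..M}) ` P)" by simp
    qed
  qed
qed

theorem theorem2p2p14:
  fixes d q N :: nat
  assumes d: "d = CARD('n::finite)"
    and q: "q \<ge> 1"
    and N: "N = (d + 1) * (q - 1)"
  shows
    "(
      (\<forall>F :: (nat \<Rightarrow> real) \<Rightarrow> real ^ 'n. continuous_on (skeleton N d) F \<longrightarrow>
         (\<forall>P. winding_partition N q F P \<longrightarrow> tverberg_partition N d q F P)) \<and>
      (\<forall>F :: (nat \<Rightarrow> real) \<Rightarrow> real ^ 'n. continuous_on (standard_simplex N) F \<longrightarrow>
         (\<forall>P. winding_partition N q F P \<longrightarrow> tverberg_partition N N q F P))
     ) \<and>
     (d \<ge> 3 \<longrightarrow>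
      (\<forall>f :: (nat \<Rightarrow> real) \<Rightarrow> real ^ 'n. continuous_on (skeleton N (d - 1)) f \<longrightarrow>
       (\<forall>\<epsilon>>0. \<exists>f' :: (nat \<Rightarrow> real) \<Rightarrow> real ^ 'n.
          continuous_on (skeleton N (d - 1)) f' \<and>
          (\<forall>x\<in>skeleton N (d - 1). norm (f' x - f x) < \<epsilon>) \<and>
          (\<exists>F :: (nat \<Rightarrow> real) \<Rightarrow> real ^ 'n.
             continuous_on (skeleton N d) F \<and>
             (\<forall>x\<in>skeleton N (d - 1). F x = f' x) \<and>
             (\<forall>P. tverberg_partition N d q F P \<longrightarrow> winding_partition N q f P)) \<and>
          (\<exists>F :: (nat \<Rightarrow> real) \<Rightarrow> real ^ 'n.
             continuous_on (standard_simplex N) F \<and>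
             (\<forall>x\<in>skeleton N (d - 1). F x = f' x) \<and>
             (\<forall>P. tverberg_partition N N q F P \<longrightarrow> winding_partition N q f P))))) \<and>
     (\<forall>f :: (nat \<Rightarrow> real) \<Rightarrow> real ^ 2. continuous_on (skeleton (3 * (q - 1)) 1) f \<longrightarrow>
       (\<forall>\<epsilon>>0. \<exists>f' :: (nat \<Rightarrow> real) \<Rightarrow> real ^ 2.
          continuous_on (skeleton (3 * (q - 1)) 1) f' \<and>
          (\<forall>x\<in>skeleton (3 * (q - 1)) 1. norm (f' x - f x) < \<epsilon>) \<and>
          (\<exists>F :: (nat \<Rightarrow> real) \<Rightarrow> real ^ 3.
             continuous_on (skeleton (4 * (q - 1)) 3) F \<and>
             (\<forall>x\<in>skeleton (3 * (q - 1)) 1. F x = plane_in_space (f' x)) \<and>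
             (\<forall>P. tverberg_partition (4 * (q - 1)) 3 q F P \<longrightarrow>
                winding_partition (3 * (q - 1)) q f ((\<lambda>\<sigma>. \<sigma> \<inter> {..3 * (q - 1)}) ` P))) \<and>
          (\<exists>F :: (nat \<Rightarrow> real) \<Rightarrow> real ^ 3.
             continuous_on (standard_simplex (4 * (q - 1))) F \<and>
             (\<forall>x\<in>skeleton (3 * (q - 1)) 1. F x = plane_in_space (f' x)) \<and>
             (\<forall>P. tverberg_partition (4 * (q - 1)) (4 * (q - 1)) q F P \<longrightarrow>
                winding_partition (3 * (q - 1)) q f ((\<lambda>\<sigma>. \<sigma> \<inter> {..3 * (q - 1)}) ` P)))))"
proof (intro conjI allI impI)
  fix F :: "(nat \<Rightarrow> real) \<Rightarrow> real ^ 'n" and P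
  assume F: "continuous_on (skeleton N d) F" and P: "winding_partition N q F P"
  show "tverberg_partition N d q F P"
    using winding_partition_imp_tverberg[OF _ P] F unfolding d by blast
next
  fix F :: "(nat \<Rightarrow> real) \<Rightarrow> real ^ 'n" and P
  assume F: "continuous_on (standard_simplex N) F" and P: "winding_partition N q F P"
  have "continuous_on (skeleton N CARD('n)) F" using F skeleton_subset by (rule continuous_on_subset)
  then have "tverberg_partition N CARD('n) q F P" using P by (rule winding_partition_imp_tverberg)
  then show "tverberg_partition N N q F P" by (rule tverberg_partition_full)
next
  fix f :: "(nat \<Rightarrow> real) \<Rightarrow> real ^ 'n" and \<epsilon> :: real
  assume d3: "d \<ge> 3" and f: "continuous_on (skeleton N (d - 1)) f" and \<epsilon>: "\<epsilon> > 0"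
  obtain F :: "(nat \<Rightarrow> real) \<Rightarrow> real ^ 'n" where F: "continuous_on (standard_simplex N) F"
    "\<forall>x\<in>skeleton N (d - 1). dist (F x) (f x) < \<epsilon>"
    "\<forall>P. tverberg_partition N N q F P \<longrightarrow> winding_partition N q f P"
    using tverberg_winding_extension[OF d3[unfolded d] q N[unfolded d] f[unfolded d] \<epsilon>] unfolding d .
  \<comment> \<open>One map on the full simplex serves both versions of (b), and on the
    \<open>(d-1)\<close>-skeleton it is itself the approximation of \<open>f\<close>.\<close>
  have sub: "continuous_on (skeleton N k) F" for k using F(1) skeleton_subset by (rule continuous_on_subset)
  have win: "\<forall>P. tverberg_partition N d q F P \<longrightarrow> winding_partition N q f P"
    using F(3) tverberg_partition_full by blast
  show "\<exists>f' :: (nat \<Rightarrow> real) \<Rightarrow> real ^ 'n.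
          continuous_on (skeleton N (d - 1)) f' \<and>
          (\<forall>x\<in>skeleton N (d - 1). norm (f' x - f x) < \<epsilon>) \<and>
          (\<exists>F :: (nat \<Rightarrow> real) \<Rightarrow> real ^ 'n.
             continuous_on (skeleton N d) F \<and>
             (\<forall>x\<in>skeleton N (d - 1). F x = f' x) \<and>
             (\<forall>P. tverberg_partition N d q F P \<longrightarrow> winding_partition N q f P)) \<and>
          (\<exists>F :: (nat \<Rightarrow> real) \<Rightarrow> real ^ 'n.
             continuous_on (standard_simplex N) F \<and>
             (\<forall>x\<in>skeleton N (d - 1). F x = f' x) \<and>
             (\<forall>P. tverberg_partition N N q F P \<longrightarrow> winding_partition N q f P))"
    by (intro exI[of _ F] conjI sub win F(1,3) ballI refl) (use F(2) in \<open>simp add: dist_norm\<close>)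
next
  fix f :: "(nat \<Rightarrow> real) \<Rightarrow> real ^ 2" and \<epsilon> :: real
  let ?M = "3 * (q - 1)" and ?N = "4 * (q - 1)"
  assume f: "continuous_on (skeleton ?M 1) f" and \<epsilon>: "\<epsilon> > 0"
  obtain f' :: "(nat \<Rightarrow> real) \<Rightarrow> real ^ 2" and F :: "(nat \<Rightarrow> real) \<Rightarrow> real ^ 3"
    where f': "continuous_on (skeleton ?M 1) f'" "\<forall>x\<in>skeleton ?M 1. dist (f' x) (f x) < \<epsilon>"
    and F: "continuous_on (standard_simplex ?N) F" "\<forall>x\<in>skeleton ?M 1. F x = plane_in_space (f' x)"
    and T: "\<forall>P. tverberg_partition ?N ?N q F P \<longrightarrow> winding_partition ?M q f ((\<lambda>\<sigma>. \<sigma> \<inter> {..?M}) ` P)"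
    by (rule tverberg_winding_extension_plane[OF q refl refl f \<epsilon>]) (rule that)
  have sub: "continuous_on (skeleton ?N 3) F" using F(1) skeleton_subset by (rule continuous_on_subset)
  have win: "\<forall>P. tverberg_partition ?N 3 q F P \<longrightarrow> winding_partition ?M q f ((\<lambda>\<sigma>. \<sigma> \<inter> {..?M}) ` P)"
    using T tverberg_partition_full by blast
  show "\<exists>f' :: (nat \<Rightarrow> real) \<Rightarrow> real ^ 2.
          continuous_on (skeleton (3 * (q - 1)) 1) f' \<and>
          (\<forall>x\<in>skeleton (3 * (q - 1)) 1. norm (f' x - f x) < \<epsilon>) \<and>
          (\<exists>F :: (nat \<Rightarrow> real) \<Rightarrow> real ^ 3.
             continuous_on (skeleton (4 * (q - 1)) 3) F \<and>
             (\<forall>x\<in>skeleton (3 * (q - 1)) 1. F x = plane_in_space (f' x)) \<and>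
             (\<forall>P. tverberg_partition (4 * (q - 1)) 3 q F P \<longrightarrow>
                winding_partition (3 * (q - 1)) q f ((\<lambda>\<sigma>. \<sigma> \<inter> {..3 * (q - 1)}) ` P))) \<and>
          (\<exists>F :: (nat \<Rightarrow> real) \<Rightarrow> real ^ 3.
             continuous_on (standard_simplex (4 * (q - 1))) F \<and>
             (\<forall>x\<in>skeleton (3 * (q - 1)) 1. F x = plane_in_space (f' x)) \<and>
             (\<forall>P. tverberg_partition (4 * (q - 1)) (4 * (q - 1)) q F P \<longrightarrow>
                winding_partition (3 * (q - 1)) q f ((\<lambda>\<sigma>. \<sigma> \<inter> {..3 * (q - 1)}) ` P)))"
    by (rule exI[of _ f'], intro conjI exI[of _ F] sub win T F f'(1)) (use f'(2) in \<open>simp add: dist_norm\<close>)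
qed

end
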